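(* Let $n\geq2$, $\mu>0$, $k\in\mathbb{N}$ with $k\geq1$, $\varepsilon>0$, and let $p=p_{\mathrm{Str}}(n)$. If $k=1$, assume further that $\mu\in(0,\mu_0^*(n))$, where $\mu_0^*(n):=\frac{1}{p(p-1)}$. Let $u_0\in W^{1,1}_{\mathrm{loc}}(\mathbb{R}^n)$ and $u_1\in L^1_{\mathrm{loc}}(\mathbb{R}^n)$ be nonnegative, not identically zero, and compactly supported functions with $\operatorname{supp}(u_0,u_1)\subset B_R(0)$ for some $R>0$. Let $u$ be a weak solution on $[0,T_\varepsilon)$ of the Cauchy problem $$u_{tt}-\Delta u+b(t)u_t=|u|^p,\qquad u(0,x)=\varepsilon u_0(x),\quad u_t(0,x)=\varepsilon u_1(x),$$ with lifespan $T_\varepsilon$. Then $u$ blows up in finite time and there exists a constant $C>0$, independent of $\varepsilon$, such that: (1) for $k\geq2$, $$\ln T_\varepsilon\left(\ln^{[k]}\left(\mathrm{e}^{[k]}+T_\varepsilon\right)\right)^{-\mu p(p-1)}\leq C\,\varepsilon^{-p(p-1)};$$ (2) for $k=1$ and $\mu\in(0,\mu_0^*(n))$, $$\ln T_\varepsilon\leq C\,\varepsilon^{-\frac{p(p-1)}{1-\mu p(p-1)}}.$$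
   Context: Notation. $B_R(0)=\{x\in\mathbb{R}^n:|x|\le R\}$. Iterated logarithms and exponentials: $\ln^{[1]}(r)=\ln r$, $\ln^{[j]}(r)=\ln(\ln^{[j-1]}(r))$ for $j\ge2$; $\mathrm{e}^{[1]}=\mathrm{e}$, $\mathrm{e}^{[j]}=\mathrm{e}^{\mathrm{e}^{[j-1]}}$ for $j\ge2$. The damping coefficient is $$b(t)=\frac{\mu}{(\mathrm{e}^{[k]}+t)\prod_{j=1}^k\ln^{[j]}(\mathrm{e}^{[k]}+t)},\qquad t\ge0.$$ For $n\ge2$ the Strauss exponent $p_{\mathrm{Str}}(n)$ is the positive root $p$ of the quadratic equation $1+\frac{n+1}{2}p-\frac{n-1}{2}p^2=0$. Weak solution. A weak solution on $[0,T)$ of $u_{tt}-\Delta u+b(t)u_t=f(u,u_t)$, $u(0,\cdot)=\varepsilon u_0$, $u_t(0,\cdot)=\varepsilon u_1$ (here $f(u,u_t)=|u|^p$), with data supported in $B_R(0)$, is a function $u\in\mathscr{C}([0,T),W^{1,1}_{\mathrm{loc}}(\mathbb{R}^n))\cap\mathscr{C}^1([0,T),L^1_{\mathrm{loc}}(\mathbb{R}^n))$ with $f(u,u_t)\in L^1_{\mathrm{loc}}([0,T)\times\mathbb{R}^n)$ such that: (1) $\operatorname{supp}u(t,\cdot)\subset B_{R+t}(0)$ for all $t\in(0,T)$; (2) $u(0,\cdot)=\varepsilon u_0$ in $L^1_{\mathrm{loc}}(\mathbb{R}^n)$; (3) for all $t\in(0,T)$ and all $\psi\in\mathscr{C}_0^\infty([0,T)\times\mathbb{R}^n)$,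 $$\int_0^t\int_{\mathbb{R}^n}\big(-u_t\psi_s+\nabla u\cdot\nabla\psi+b(s)u_t\psi\big)\,\mathrm{d}x\,\mathrm{d}s+\int_{\mathbb{R}^n}u_t(t,x)\psi(t,x)\,\mathrm{d}x=\varepsilon\int_{\mathbb{R}^n}u_1(x)\psi(0,x)\,\mathrm{d}x+\int_0^t\int_{\mathbb{R}^n}f(u,u_t)\psi\,\mathrm{d}x\,\mathrm{d}s,$$ where in the double integrals the functions are evaluated at $(s,x)$. The lifespan $T_\varepsilon$ is the maximal existence time of the solution; "$u$ blows up in finite time" means that the lifespan is finite. *)

theory Defs
  imports "HOL-Analysis.Analysis"
begin

section \<open>Iterated logarithms and exponentials, damping, critical exponent\<close>

definition iter_ln :: "nat \<Rightarrow> real \<Rightarrow> real" where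
  "iter_ln j r = (ln ^^ j) r"

text \<open>For \<open>k \<ge> 1\<close> this is the tower of \<open>k\<close> copies of \<open>e\<close>; \<open>iter_e 0 = 1\<close> is only a convention.\<close>
definition iter_e :: "nat \<Rightarrow> real" where
  "iter_e k = (exp ^^ k) 1"

definition damping :: "real \<Rightarrow> nat \<Rightarrow> real \<Rightarrow> real" where
  "damping \<mu> k t = \<mu> / ((iter_e k + t) * (\<Prod>j=1..k. iter_ln j (iter_e k + t)))"

definition strauss_exponent :: "nat \<Rightarrow> real" where
  "strauss_exponent n =
     (THE p. p > 0 \<and> 1 + (real n + 1) / 2 * p - (real n - 1) / 2 * p\<^sup>2 = 0)"

definition mu0_star :: "nat \<Rightarrow> real" where
  "mu0_star n = 1 / (strauss_exponent n * (strauss_exponent n - 1))"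

section \<open>Smooth functions and test functions\<close>

primrec C_k :: "nat \<Rightarrow> ('a::euclidean_space \<Rightarrow> real) \<Rightarrow> bool" where
  "C_k 0 f \<longleftrightarrow> continuous_on UNIV f"
| "C_k (Suc k) f \<longleftrightarrow> (\<forall>x. f differentiable (at x)) \<and>
     (\<forall>b\<in>Basis. C_k k (\<lambda>x. frechet_derivative f (at x) b))"

definition C_inf :: "('a::euclidean_space \<Rightarrow> real) \<Rightarrow> bool" where
  "C_inf f \<longleftrightarrow> (\<forall>k. C_k k f)"

definition test_function :: "('a::euclidean_space \<Rightarrow> real) \<Rightarrow> bool" where
  "test_function \<phi> \<longleftrightarrow> C_inf \<phi> \<and> compact (closure {x. \<phi> x \<noteq> 0})"

definition gradient :: "('a::euclidean_space \<Rightarrow> real) \<Rightarrow> 'a \<Rightarrow> 'a" where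
  "gradient f x = (\<Sum>b\<in>Basis. frechet_derivative f (at x) b *\<^sub>R b)"

text \<open>
  Smooth functions with compact support in \<open>[0,T) \<times> \<real>\<^sup>n\<close> (not required to vanish at \<open>s = 0\<close>),
  represented by smooth functions on \<open>\<real> \<times> \<real>\<^sup>n\<close> with compact support in \<open>(-\<infinity>,T) \<times> \<real>\<^sup>n\<close>,
  of which only the restriction to \<open>s \<ge> 0\<close> is ever used.
\<close>
definition spacetime_test_function ::
    "ereal \<Rightarrow> (real \<times> 'a::euclidean_space \<Rightarrow> real) \<Rightarrow> bool" where
  "spacetime_test_function T \<psi> \<longleftrightarrow> test_function \<psi> \<and>
     closure {z. \<psi> z \<noteq> 0} \<subseteq> {(s, x). ereal s < T}"

section \<open>Local Lebesgue and Sobolev spaces\<close>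

definition loc_integrable_on ::
    "('a::euclidean_space \<Rightarrow> 'b::euclidean_space) \<Rightarrow> 'a set \<Rightarrow> bool" where
  "loc_integrable_on f S \<longleftrightarrow> (\<forall>K. compact K \<and> K \<subseteq> S \<longrightarrow> f absolutely_integrable_on K)"

text \<open>Complement of the largest open set on which \<open>f\<close> vanishes almost everywhere.\<close>
definition ess_supp :: "('a::euclidean_space \<Rightarrow> real) \<Rightarrow> 'a set" where
  "ess_supp f = - \<Union> {U. open U \<and> (AE x in lebesgue. x \<in> U \<longrightarrow> f x = 0)}"

definition weak_gradient ::
    "('a::euclidean_space \<Rightarrow> real) \<Rightarrow> ('a \<Rightarrow> 'a) \<Rightarrow> bool" where
  "weak_gradient f G \<longleftrightarrow> loc_integrable_on f UNIV \<and> loc_integrable_on G UNIV \<and>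
     (\<forall>\<phi>. test_function \<phi> \<longrightarrow> (\<forall>b\<in>Basis.
        (LINT x|lebesgue. f x * (gradient \<phi> x \<bullet> b)) = - (LINT x|lebesgue. (G x \<bullet> b) * \<phi> x)))"

definition W11_loc :: "('a::euclidean_space \<Rightarrow> real) \<Rightarrow> bool" where
  "W11_loc f \<longleftrightarrow> (\<exists>G. weak_gradient f G)"

text \<open>The topology of \<open>L\<^sup>1\<^sub>l\<^sub>o\<^sub>c\<close> is given by the seminorms \<open>f \<mapsto> \<integral>\<^sub>K |f|\<close>, \<open>K\<close> compact.\<close>
definition cont_L1_loc ::
    "real set \<Rightarrow> (real \<Rightarrow> 'a::euclidean_space \<Rightarrow> 'b::euclidean_space) \<Rightarrow> bool" where
  "cont_L1_loc I f \<longleftrightarrow> (\<forall>t\<in>I. loc_integrable_on (f t) UNIV) \<and>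
     (\<forall>t\<in>I. \<forall>K. compact K \<longrightarrow>
        ((\<lambda>s. LINT x:K|lebesgue. norm (f s x - f t x)) \<longlongrightarrow> 0) (at t within I))"

text \<open>\<open>u \<in> C(I, W\<^sup>1\<^sup>,\<^sup>1\<^sub>l\<^sub>o\<^sub>c)\<close> with weak spatial gradient \<open>G\<close>.\<close>
definition cont_W11_loc ::
    "real set \<Rightarrow> (real \<Rightarrow> 'a::euclidean_space \<Rightarrow> real) \<Rightarrow> (real \<Rightarrow> 'a \<Rightarrow> 'a) \<Rightarrow> bool" where
  "cont_W11_loc I u G \<longleftrightarrow>
     (\<forall>t\<in>I. weak_gradient (u t) (G t)) \<and> cont_L1_loc I u \<and> cont_L1_loc I G"

text \<open>\<open>u \<in> C\<^sup>1(I, L\<^sup>1\<^sub>l\<^sub>o\<^sub>c)\<close> with time derivative \<open>v\<close>.\<close>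
definition C1_L1_loc ::
    "real set \<Rightarrow> (real \<Rightarrow> 'a::euclidean_space \<Rightarrow> real) \<Rightarrow> (real \<Rightarrow> 'a \<Rightarrow> real) \<Rightarrow> bool" where
  "C1_L1_loc I u v \<longleftrightarrow> cont_L1_loc I u \<and> cont_L1_loc I v \<and>
     (\<forall>t\<in>I. \<forall>K. compact K \<longrightarrow>
        ((\<lambda>s. LINT x:K|lebesgue. \<bar>(u s x - u t x) / (s - t) - v t x\<bar>) \<longlongrightarrow> 0) (at t within I))"

section \<open>Weak solutions and lifespan\<close>

definition time_interval :: "ereal \<Rightarrow> real set" where
  "time_interval T = {t. 0 \<le> t \<and> ereal t < T}"

text \<open>
  The time derivative \<open>v\<close> and the weak gradient \<open>G\<close> of \<open>u\<close> are determined by \<open>u\<close> up to null sets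
  for each time. The space-time integrals are iterated, so that they do not depend on the
  representatives of \<open>u t\<close>, \<open>v t\<close>, \<open>G t\<close>. Only the local integrability of \<open>f(u,u\<^sub>t)\<close> refers to
  a jointly measurable choice of representatives; one exists for every curve that is continuous
  into \<open>L\<^sup>1\<^sub>l\<^sub>o\<^sub>c\<close>.
\<close>
definition weak_solution ::
    "(real \<Rightarrow> real \<Rightarrow> real) \<Rightarrow> (real \<Rightarrow> real) \<Rightarrow> real \<Rightarrow>
     (real^'n \<Rightarrow> real) \<Rightarrow> (real^'n \<Rightarrow> real) \<Rightarrow> real \<Rightarrow> ereal \<Rightarrow>
     (real \<Rightarrow> real^'n \<Rightarrow> real) \<Rightarrow> bool" where
  "weak_solution f b \<epsilon> u0 u1 R T u \<longleftrightarrow> 0 < T \<and>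
     (\<exists>v G. cont_W11_loc (time_interval T) u G \<and>
        C1_L1_loc (time_interval T) u v \<and>
        loc_integrable_on (\<lambda>(t, x). f (u t x) (v t x)) (time_interval T \<times> UNIV) \<and>
        (\<forall>t>0. ereal t < T \<longrightarrow> ess_supp (u t) \<subseteq> cball 0 (R + t)) \<and>
        (AE x in lebesgue. u 0 x = \<epsilon> * u0 x) \<and>
        (\<forall>t>0. ereal t < T \<longrightarrow> (\<forall>\<psi>. spacetime_test_function T \<psi> \<longrightarrow>
           (LINT s:{0..t}|lebesgue. (LINT x|lebesgue.
               - v s x * deriv (\<lambda>r. \<psi> (r, x)) s
               + G s x \<bullet> gradient (\<lambda>y. \<psi> (s, y)) x
               + b s * v s x * \<psi> (s, x)))
           + (LINT x|lebesgue. v t x * \<psi> (t, x))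
           = \<epsilon> * (LINT x|lebesgue. u1 x * \<psi> (0, x))
           + (LINT s:{0..t}|lebesgue. (LINT x|lebesgue. f (u s x) (v s x) * \<psi> (s, x))))))"

text \<open>
  \<open>u\<close> is a weak solution on \<open>[0,T)\<close> and \<open>T\<close> is its maximal existence time: no weak solution on
  a longer interval extends \<open>u\<close>. The value \<open>T = \<infinity>\<close> is allowed.
\<close>
definition weak_solution_with_lifespan ::
    "(real \<Rightarrow> real \<Rightarrow> real) \<Rightarrow> (real \<Rightarrow> real) \<Rightarrow> real \<Rightarrow>
     (real^'n \<Rightarrow> real) \<Rightarrow> (real^'n \<Rightarrow> real) \<Rightarrow> real \<Rightarrow> ereal \<Rightarrow>
     (real \<Rightarrow> real^'n \<Rightarrow> real) \<Rightarrow> bool" where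
  "weak_solution_with_lifespan f b \<epsilon> u0 u1 R T u \<longleftrightarrow> weak_solution f b \<epsilon> u0 u1 R T u \<and>
     \<not> (\<exists>T' w. T < T' \<and> weak_solution f b \<epsilon> u0 u1 R T' w \<and>
          (\<forall>t\<in>time_interval T. AE x in lebesgue. w t x = u t x))"

end

theory Submission
  imports Defs
begin

text \<open>
  Proof idea. Let \<open>\<phi>\<^sub>\<kappa>\<close> be the positive radial solution of \<open>\<Delta>\<phi> = \<kappa>\<^sup>2 \<phi>\<close> with \<open>\<phi> \<ge> 1\<close>. Every component
  \<open>Z\<^sub>\<kappa>(t) = \<integral> u(t) \<phi>\<^sub>\<kappa>\<close> solves \<open>Z'' + b Z' - \<kappa>\<^sup>2 Z = N\<close> with \<open>N \<ge> Q = \<integral> |u|\<^sup>p\<close>. With \<open>m = exp (\<integral> b)\<close>, which is a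
  power of the \<open>k\<close>-fold logarithm, the factorization \<open>(d + b - \<kappa>) (d + \<kappa>) Z = N + \<kappa> b Z \<ge> N\<close> gives
  \<open>Z\<^sub>\<kappa>(t) \<ge> \<integral> (m(s)/m(t)) Q(s) sinh(\<kappa>(t-s))/\<kappa> ds\<close> and a linear lower bound with loss \<open>1/m(t)\<close>.
  A weighted sum \<open>U\<close> of the \<open>Z\<^sub>\<kappa>\<close> over dyadic \<open>\<kappa>\<close> replaces the usual integral over \<open>\<kappa>\<close>: the bound
  \<open>\<phi>\<^sub>1(x) \<le> C |x|\<^bsup>-(n-1)/2\<^esup> e\<^bsup>|x|\<^esup>\<close> and Hoelder's inequality bound \<open>Q\<close> below by \<open>U\<^sup>p\<close>, and at the Strauss exponent this
  closes to \<open>U(\<tau>) \<ge> c \<integral> (1 - e\<^bsup>-(\<tau>-\<sigma>)\<^esup>) L\<^bsup>1-p\<^esup> U(\<sigma>)\<^sup>p d\<sigma>\<close> and \<open>U \<ge> c (\<epsilon>/m(T))\<^sup>p L\<close> in logarithmic time, where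
  \<open>L = ln T\<close>. Since \<open>m\<close> varies by a bounded factor on \<open>[\<surd>T, T]\<close>, the kernel costs no further power of \<open>m\<close>, and
  repeatedly doubling the lower bound of \<open>U\<close> forces \<open>L \<le> C (m(T)/\<epsilon>)\<^bsup>p(p-1)\<^esup>\<close>. For large \<open>\<epsilon>\<close> the same doubling
  argument for \<open>Z\<^sub>1\<close> shows \<open>T \<le> 1\<close>.
\<close>

section \<open>Smooth functions and cutoffs\<close>

text \<open>Criticality enters through one identity, \<alpha> (2 - p) - (\<alpha> - 1/p) = -1 with
  \<alpha> = (n - 1)/2. It makes the feedback of the nonlinearity scale invariant, so that only ln T
  is gained and logarithmic time is the natural clock. The exponent p (p - 1) results from a
  cancellation: the time needed for all doublings depends on the start value D of order
  (\<epsilon>/m)^p L and the feedback coefficient L^(1-p) only through K = 1/(L^(1-p) D^(p-1)), in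
  which the powers of L cancel. That time has the form K + sqrt K, comparable to K only if K stays
  away from 0; since one constant must serve every \<epsilon> > 0, large data are treated
  separately. The resulting bound still contains m(T). For k \<ge> 2 this grows more slowly than any
  power of ln T; for k = 1 it is of order (ln T)^\<mu>, and \<mu> p (p - 1) < 1 lets the inequality
  be solved for ln T.\<close>

lemma C_inf_coinduct:
  assumes "P f"
    and step: "\<And>f. P f \<Longrightarrow> (\<forall>x. f differentiable (at x)) \<and>
      (\<forall>b\<in>Basis. P (\<lambda>x. frechet_derivative f (at x) b))"
  shows "C_inf f"
proof -
  have "C_k k f" if "P f" for k f
    using that
  proof (induction k arbitrary: f)
    case 0
    then show ?case using step[OF 0]
      by (auto intro!: differentiable_imp_continuous_on simp: differentiable_on_def
          intro: differentiable_at_withinI)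
  next
    case (Suc k)
    then show ?case using step[OF Suc.prems] by auto
  qed
  then show ?thesis using assms(1) by (auto simp: C_inf_def)
qed

lemma C_k_continuous: "C_k k f \<Longrightarrow> continuous_on UNIV f"
  by (cases k) (auto intro!: differentiable_imp_continuous_on simp: differentiable_on_def
          intro: differentiable_at_withinI)

lemma C_k_SucD: "C_k (Suc k) f \<Longrightarrow> C_k k f"
proof (induction k arbitrary: f)
  case 0
  then show ?case using C_k_continuous[of 1 f] by simp
next
  case (Suc k)
  then show ?case by (auto simp del: C_k.simps simp: C_k.simps(2)[of "Suc k"] C_k.simps(2)[of "k"])
qed

lemma C_inf_frechet: "C_inf f \<Longrightarrow> b \<in> Basis \<Longrightarrow> C_inf (\<lambda>x. frechet_derivative f (at x) b)"
  unfolding C_inf_def by (metis C_k.simps(2))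

lemma C_inf_continuous: "C_inf f \<Longrightarrow> continuous_on S f"
  unfolding C_inf_def using C_k_continuous continuous_on_subset by blast

lemma C_inf_step:
  assumes "\<And>x. (f has_derivative f' x) (at x)" "\<And>b. b \<in> Basis \<Longrightarrow> C_inf (\<lambda>x. f' x b)"
  shows "C_inf f"
proof -
  have e: "frechet_derivative f (at x) = f' x" for x
    by (rule frechet_derivative_at[OF assms(1), symmetric])
  have "C_k (Suc k) f" for k
    using assms by (auto simp: e C_inf_def differentiable_def)
  then have "C_k k f" for k by (rule C_k_SucD)
  then show ?thesis by (simp add: C_inf_def)
qed

lemma C_k_const: "C_k k (\<lambda>x. c)"
  by (induction k arbitrary: c) (auto simp: frechet_derivative_const)

lemma C_inf_const [simp]: "C_inf (\<lambda>x. c)"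
  by (simp add: C_inf_def C_k_const)

lemma C_inf_linear: "bounded_linear f \<Longrightarrow> C_inf f"
  by (rule C_inf_step[of f "\<lambda>x. f"]) (auto intro: bounded_linear.has_derivative)

lemma C_k_add: "C_k k f \<Longrightarrow> C_k k g \<Longrightarrow> C_k k (\<lambda>x. f x + g x)"
proof (induction k arbitrary: f g)
  case 0 then show ?case by (auto intro: continuous_intros)
next
  case (Suc k)
  then have d: "(f has_derivative frechet_derivative f (at x)) (at x)"
     "(g has_derivative frechet_derivative g (at x)) (at x)" for x
    by (auto simp: frechet_derivative_works)
  have "frechet_derivative (\<lambda>x. f x + g x) (at x) =
      (\<lambda>b. frechet_derivative f (at x) b + frechet_derivative g (at x) b)" for x
    by (rule frechet_derivative_at[OF has_derivative_add[OF d], symmetric])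
  with Suc show ?case by simp
qed

lemma C_k_mult: "C_k k f \<Longrightarrow> C_k k g \<Longrightarrow> C_k k (\<lambda>x. f x * g x)"
proof (induction k arbitrary: f g)
  case 0 then show ?case by (auto intro: continuous_intros)
next
  case (Suc k)
  then have d: "(f has_derivative frechet_derivative f (at x)) (at x)"
     "(g has_derivative frechet_derivative g (at x)) (at x)" for x
    by (auto simp: frechet_derivative_works)
  have "frechet_derivative (\<lambda>x. f x * g x) (at x) =
      (\<lambda>b. f x * frechet_derivative g (at x) b + frechet_derivative f (at x) b * g x)" for x
    by (rule frechet_derivative_at[OF has_derivative_mult[OF d], symmetric])
  moreover have "C_k k f" "C_k k g" by (rule C_k_SucD[OF Suc.prems(1)], rule C_k_SucD[OF Suc.prems(2)])
  ultimately show ?case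
    using Suc.IH[OF \<open>C_k k f\<close>] Suc.IH[OF _ \<open>C_k k g\<close>] Suc.prems
    by (simp add: differentiable_mult C_k_add)
qed

text \<open>The partial derivatives of the composite are products of the derivative of
  \<open>h\<close> at \<open>f x\<close> with a partial derivative of \<open>f\<close>, so the
  induction generalizes \<open>h\<close> and \<open>C_k_mult\<close> closes it. A scalar outer
  function is enough because every mode is a function of the one number
  \<open>x \<bullet> x\<close>.\<close>

lemma C_k_compose:
  fixes h :: "real \<Rightarrow> real"
  shows "C_k k h \<Longrightarrow> C_k k f \<Longrightarrow> C_k k (\<lambda>x. h (f x))"
proof (induction k arbitrary: h)
  case 0 then show ?case
    using continuous_on_compose2[of UNIV h UNIV f] by auto
next
  case (Suc k)
  let ?h' = "\<lambda>x. frechet_derivative h (at x) 1"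
  have d: "(f has_derivative frechet_derivative f (at x)) (at x)" for x
    using Suc.prems by (auto simp: frechet_derivative_works)
  have dh: "(h has_derivative frechet_derivative h (at x)) (at x)" for x
    using Suc.prems by (auto simp: frechet_derivative_works)
  have lin: "frechet_derivative h (at x) y = ?h' x * y" for x y
    using linear_cmul[OF has_derivative_linear[OF dh[of x]], of y 1] by simp
  have e: "frechet_derivative (\<lambda>x. h (f x)) (at x) =
      (\<lambda>b. ?h' (f x) * frechet_derivative f (at x) b)" for x
  proof -
    have "((\<lambda>x. h (f x)) has_derivative (\<lambda>b. frechet_derivative h (at (f x)) (frechet_derivative f (at x) b))) (at x)"
      using has_derivative_compose[OF d dh] by blast
    from frechet_derivative_at[OF this, symmetric] show ?thesis
      by (rule trans) (rule ext, rule lin)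
  qed
  have "(\<lambda>x. h (f x)) differentiable at x" for x
    using has_derivative_compose[OF d dh] unfolding differentiable_def by blast
  moreover have "C_k k (\<lambda>x. ?h' (f x))"
    using Suc.IH[of ?h'] Suc.prems(1) C_k_SucD[OF Suc.prems(2)] by auto
  ultimately show ?case using Suc.prems by (auto simp: e intro!: C_k_mult)
qed

lemma C_inf_add: "C_inf f \<Longrightarrow> C_inf g \<Longrightarrow> C_inf (\<lambda>x. f x + g x)"
  and C_inf_mult: "C_inf f \<Longrightarrow> C_inf g \<Longrightarrow> C_inf (\<lambda>x. f x * g x)"
  by (simp_all add: C_inf_def C_k_add C_k_mult)

lemma C_inf_compose:
  fixes h :: "real \<Rightarrow> real"
  shows "C_inf h \<Longrightarrow> C_inf f \<Longrightarrow> C_inf (\<lambda>x. h (f x))"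
  by (simp add: C_inf_def C_k_compose)

lemma C_inf_diff: "C_inf f \<Longrightarrow> C_inf g \<Longrightarrow> C_inf (\<lambda>x. f x - g x)"
  using C_inf_add[of f "\<lambda>x. (-1) * g x"] C_inf_mult[of "\<lambda>x. -1" g] by simp

lemma C_inf_real_step:
  fixes f :: "real \<Rightarrow> real"
  assumes "\<And>x. (f has_real_derivative f' x) (at x)" "C_inf f'"
  shows "C_inf f"
  by (rule C_inf_step[of f "\<lambda>x h. f' x * h"])
    (use assms in \<open>auto simp: has_field_derivative_def\<close>)

lemma C_inf_real_coinduct:
  fixes f :: "real \<Rightarrow> real"
  assumes "P f"
    and step: "\<And>f. P f \<Longrightarrow> \<exists>f'. P f' \<and> (\<forall>x. (f has_real_derivative f' x) (at x))"
  shows "C_inf f"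
proof (rule C_inf_coinduct[of P, OF assms(1)])
  fix f :: "real \<Rightarrow> real" assume "P f"
  from step[OF this] obtain f' where f': "P f'" "\<And>x. (f has_real_derivative f' x) (at x)" by auto
  then have d: "(f has_derivative (\<lambda>h. f' x * h)) (at x)" for x by (auto simp: has_field_derivative_def)
  then have "frechet_derivative f (at x) = (\<lambda>h. f' x * h)" for x
    by (rule frechet_derivative_at[symmetric])
  with f' d show "(\<forall>x. f differentiable (at x)) \<and> (\<forall>b\<in>Basis. P (\<lambda>x. frechet_derivative f (at x) b))"
    by (auto simp: differentiable_def)
qed

text \<open>Entire power series are closed under termwise differentiation and thus form an invariant
  for the coinduction over derivatives.\<close>

lemma C_inf_power_series:
  fixes c :: "nat \<Rightarrow> real"
  assumes "\<And>y. summable (\<lambda>n. c n * y ^ n)"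
  shows "C_inf (\<lambda>y. \<Sum>n. c n * y ^ n)"
proof (rule C_inf_real_coinduct[of "\<lambda>f. \<exists>c. (\<forall>y. summable (\<lambda>n. c n * y ^ n)) \<and> f = (\<lambda>y. \<Sum>n. c n * y ^ n)"])
  show "\<exists>ca. (\<forall>y. summable (\<lambda>n. ca n * y ^ n)) \<and> (\<lambda>y. \<Sum>n. c n * y ^ n) = (\<lambda>y. \<Sum>n. ca n * y ^ n)"
    using assms by blast
next
  fix f :: "real \<Rightarrow> real"
  assume "\<exists>c. (\<forall>y. summable (\<lambda>n. c n * y ^ n)) \<and> f = (\<lambda>y. \<Sum>n. c n * y ^ n)"
  then obtain c where c: "\<And>y. summable (\<lambda>n. c n * y ^ n)" "f = (\<lambda>y. \<Sum>n. c n * y ^ n)" by auto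
  have "summable (\<lambda>n. diffs c n * y ^ n)" for y
    by (rule termdiff_converges_all) (rule c)
  then show "\<exists>f'. (\<exists>c. (\<forall>y. summable (\<lambda>n. c n * y ^ n)) \<and> f' = (\<lambda>y. \<Sum>n. c n * y ^ n)) \<and>
         (\<forall>x. (f has_real_derivative f' x) (at x))"
    using termdiffs_strong_converges_everywhere[OF c(1)] c(2) by blast
qed

definition flat_exp :: "real \<Rightarrow> real" where
  "flat_exp x = (if x \<le> 0 then 0 else exp (- 1 / x))"

lemma poly_mult_exp_minus_tendsto:
  fixes r :: "real poly"
  shows "((\<lambda>y. poly r y * exp (- y)) \<longlongrightarrow> 0) at_top"
proof -
  have "((\<lambda>y. y ^ k * (poly r y * exp (- y))) \<longlongrightarrow> 0) at_top" for k
  proof (induction r arbitrary: k)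
    case 0 then show ?case by simp
  next
    case (pCons a r)
    have "((\<lambda>y::real. a * (y ^ k / exp y) + y ^ Suc k * (poly r y * exp (- y))) \<longlongrightarrow> a * 0 + 0) at_top"
      by (intro tendsto_intros tendsto_power_div_exp_0 pCons.IH)
    then show ?case
      by (simp add: exp_minus field_simps)
  qed
  from this[of 0] show ?thesis by simp
qed

text \<open>The factor \<open>poly r (1 / x)\<close> makes the class invariant: differentiating
  \<open>flat_exp\<close> alone already produces 1/x^2. Smoothness of all orders then reduces to a
  single derivative.\<close>

lemma C_inf_poly_flat_exp: "C_inf (\<lambda>x. poly r (1 / x) * flat_exp x)"
proof (rule C_inf_real_coinduct[of "\<lambda>f. \<exists>r. f = (\<lambda>x. poly r (1 / x) * flat_exp x)"])
  fix f :: "real \<Rightarrow> real"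
  assume "\<exists>r. f = (\<lambda>x. poly r (1 / x) * flat_exp x)"
  then obtain r where r: "f = (\<lambda>x. poly r (1 / x) * flat_exp x)" by auto
  \<comment> \<open>With y = 1/x one has dy/dx = - y^2, and the y-derivative of r(y) exp (- y) is
    (r' - r) exp (- y).\<close>
  let ?q = "[:0, 0, 1:] * (r - pderiv r)"
  have "(f has_real_derivative poly ?q (1 / x) * flat_exp x) (at x)" for x
  proof -
    consider "x > 0" | "x < 0" | "x = 0" by linarith
    then show ?thesis
    proof cases
      case 1
      have "((\<lambda>x. poly r (1 / x) * exp (- 1 / x)) has_real_derivative
          (poly (pderiv r) (1 / x) * (- (1 / x\<^sup>2))) * exp (- 1 / x)
          + (exp (- 1 / x) * (1 / x\<^sup>2)) * poly r (1 / x)) (at x)"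
      proof (rule DERIV_mult)
        have "((\<lambda>x. 1 / x) has_real_derivative - (1 / x\<^sup>2)) (at x)"
          using 1 by (auto intro!: derivative_eq_intros simp: power2_eq_square)
        from DERIV_chain2[OF poly_DERIV this]
        show "((\<lambda>x. poly r (1 / x)) has_real_derivative poly (pderiv r) (1 / x) * - (1 / x\<^sup>2)) (at x)" .
        have "((\<lambda>x. - 1 / x) has_real_derivative (1 / x\<^sup>2)) (at x)"
          using 1 by (auto intro!: derivative_eq_intros simp: power2_eq_square)
        from DERIV_chain2[OF DERIV_exp this]
        show "((\<lambda>x. exp (- 1 / x)) has_real_derivative exp (- 1 / x) * (1 / x\<^sup>2)) (at x)" .
      qed
      also have "(poly (pderiv r) (1 / x) * (- (1 / x\<^sup>2))) * exp (- 1 / x)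
          + (exp (- 1 / x) * (1 / x\<^sup>2)) * poly r (1 / x) = poly ?q (1 / x) * flat_exp x"
        using 1 by (simp add: flat_exp_def power2_eq_square) (simp add: algebra_simps add_divide_distrib diff_divide_distrib)
      finally show ?thesis
        by (rule has_field_derivative_transform_within_open[where S = "{0<..}"])
          (use 1 in \<open>auto simp: r flat_exp_def\<close>)
    next
      case 2
      have "((\<lambda>x. 0) has_real_derivative poly ?q (1 / x) * flat_exp x) (at x)"
        using 2 by (auto simp: flat_exp_def)
      then show ?thesis
        by (rule has_field_derivative_transform_within_open[where S = "{..<0}"])
          (use 2 in \<open>auto simp: r flat_exp_def\<close>)
    next
      case 3
      \<comment> \<open>At 0 the difference quotient from the right is y r(y) exp (- y) with y =
        1/h; the extra factor y is the division by h.\<close>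
      have "((\<lambda>y. poly (pCons 0 r) y * exp (- y)) \<longlongrightarrow> 0) at_top"
        by (rule poly_mult_exp_minus_tendsto)
      from filterlim_compose[OF this filterlim_inverse_at_top_right]
      have "((\<lambda>h. f h / h) \<longlongrightarrow> 0) (at_right 0)"
      proof (rule Lim_transform_eventually)
        show "\<forall>\<^sub>F h in at_right 0. poly (pCons 0 r) (inverse h) * exp (- inverse h) = f h / h"
          unfolding eventually_at_filter
          by (rule always_eventually) (simp add: r flat_exp_def inverse_eq_divide)
      qed
      moreover have "((\<lambda>h. f h / h) \<longlongrightarrow> 0) (at_left 0)"
        by (rule Lim_transform_eventually[of "\<lambda>_. 0"])
          (auto simp: r flat_exp_def eventually_at_filter)
      ultimately have "((\<lambda>h. f h / h) \<longlongrightarrow> 0) (at 0)"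
        using filterlim_split_at by blast
      then show ?thesis
        using 3 by (simp add: DERIV_def) (simp add: r flat_exp_def)
    qed
  qed
  then show "\<exists>f'. (\<exists>r. f' = (\<lambda>x. poly r (1 / x) * flat_exp x)) \<and>
       (\<forall>x. (f has_real_derivative f' x) (at x))"
    by blast
qed blast

lemma C_inf_flat_exp: "C_inf flat_exp"
  using C_inf_poly_flat_exp[of 1] by simp

lemma exists_smooth_step:
  "\<exists>\<sigma>::real \<Rightarrow> real. C_inf \<sigma> \<and> (\<forall>x\<le>0. \<sigma> x = 0) \<and> (\<forall>x\<ge>1. \<sigma> x = 1) \<and> (\<forall>x. 0 \<le> \<sigma> x \<and> \<sigma> x \<le> 1)"
proof -
  define h where "h x = flat_exp x * flat_exp (1 - x)" for x
  have Ch: "C_inf h"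
    unfolding h_def
    by (rule C_inf_mult[OF C_inf_flat_exp C_inf_compose[OF C_inf_flat_exp
          C_inf_diff[OF C_inf_const C_inf_linear[OF bounded_linear_ident]]]])
  have ch: "continuous_on S h" for S by (rule C_inf_continuous[OF Ch])
  have h0: "h x \<ge> 0" for x by (simp add: h_def flat_exp_def)
  have hpos: "h x > 0" if "0 < x" "x < 1" for x using that by (simp add: h_def flat_exp_def)
  have hz: "h x = 0" if "x \<le> 0 \<or> x \<ge> 1" for x using that by (auto simp: h_def flat_exp_def)
  \<comment> \<open>Starting at -1, to the left of the support of \<open>h\<close>, makes the
    fundamental theorem applicable at 0 as well; further left the integral is constantly 0.\<close>
  define H where "H x = integral {-1..x} h" for x
  have ih: "h integrable_on {a..b}" for a b by (intro integrable_continuous_real ch)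
  have dH: "(H has_real_derivative h x) (at x)" if "x > -1" for x
  proof -
    have "(H has_real_derivative h x) (at x within {-1..x+1})"
      unfolding H_def by (rule integral_has_real_derivative) (use that ch in auto)
    then show ?thesis using that by (simp add: at_within_Icc_at)
  qed
  have Hz: "H x = 0" if "x \<le> 0" for x
  proof -
    have "integral {-1..x} h = integral {-1..x} (\<lambda>_. 0)"
      by (rule integral_cong) (use that hz in auto)
    then show ?thesis by (simp add: H_def)
  qed
  have dH': "(H has_real_derivative h x) (at x)" for x
  proof (cases "x > -1")
    case False
    have "((\<lambda>_. 0) has_real_derivative h x) (at x)" using False hz by auto
    then show ?thesis
      by (rule has_field_derivative_transform_within_open[where S = "{..<0}"])
        (use False Hz in auto)
  qed (rule dH)
  have CH: "C_inf H" by (rule C_inf_real_step[OF dH' Ch])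
  have mono: "H x \<le> H y" if "x \<le> y" for x y
    by (rule DERIV_nonneg_imp_nondecreasing[OF that]) (use dH' h0 in blast)
  have const: "H x = H 1" if "x \<ge> 1" for x
  proof (rule antisym)
    show "H x \<le> H 1"
      by (rule DERIV_nonpos_imp_nonincreasing[OF that]) (use dH' hz in force)
  qed (rule mono[OF that])
  have pos: "H 1 > 0"
  proof -
    have "H 0 < H 1"
    proof (rule DERIV_pos_imp_increasing_open[of 0 1 H])
      show "\<exists>y. (H has_real_derivative y) (at x) \<and> 0 < y" if "0 < x" "x < 1" for x
        using dH'[of x] hpos[OF that] by blast
    qed (auto intro: C_inf_continuous CH)
    then show ?thesis by (simp add: Hz)
  qed
  show ?thesis
  proof (intro exI[of _ "\<lambda>x. H x * (1 / H 1)"] conjI allI impI)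
    show "C_inf (\<lambda>x. H x * (1 / H 1))" by (intro C_inf_mult CH C_inf_const)
    show "0 \<le> H x * (1 / H 1)" for x using mono[of 0 x] Hz[of 0] Hz[of x] pos by (cases "x \<le> 0") auto
    show "H x * (1 / H 1) \<le> 1" for x using mono[of x 1] const[of x] pos by (cases "x \<le> 1") auto
    show "H x * (1 / H 1) = 0" if "x \<le> 0" for x using Hz[OF that] by simp
    show "H x * (1 / H 1) = 1" if "x \<ge> 1" for x using const[OF that] pos by simp
  qed
qed

text \<open>Instantiated with the identity for functions of x, and with \<open>snd\<close> for the
  same functions read on space-time.\<close>

lemma C_inf_inner_self_linear:
  fixes L :: "'a::euclidean_space \<Rightarrow> 'b::euclidean_space"
  assumes "bounded_linear L"
  shows "C_inf (\<lambda>x. L x \<bullet> L x)"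
proof (rule C_inf_step[of _ "\<lambda>x h. 2 * (L x \<bullet> L h)"])
  fix x
  have "(L has_derivative L) (at x)" by (rule bounded_linear.has_derivative[OF assms]) simp
  from has_derivative_inner[OF this this]
  show "((\<lambda>x. L x \<bullet> L x) has_derivative (\<lambda>h. 2 * (L x \<bullet> L h))) (at x)"
    by (simp add: inner_commute)
next
  fix b
  have "bounded_linear (\<lambda>x. 2 * (L x \<bullet> L b))"
    by (intro bounded_linear_const_mult bounded_linear_inner_left_comp assms)
  then show "C_inf (\<lambda>x. 2 * (L x \<bullet> L b))" by (rule C_inf_linear)
qed

lemma exists_smooth_cutoff:
  fixes A B :: real
  assumes "A < B"
  shows "\<exists>\<eta>. C_inf \<eta> \<and> (\<forall>x\<le>A. \<eta> x = 1) \<and> (\<forall>x\<ge>B. \<eta> x = 0) \<and> (\<forall>x. 0 \<le> \<eta> x \<and> \<eta> x \<le> 1)"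
proof -
  obtain \<sigma> :: "real \<Rightarrow> real" where s: "C_inf \<sigma>" "\<forall>x\<le>0. \<sigma> x = 0" "\<forall>x\<ge>1. \<sigma> x = 1" "\<forall>x. 0 \<le> \<sigma> x \<and> \<sigma> x \<le> 1"
    using exists_smooth_step by blast
  have "C_inf (\<lambda>x. x * (1 / (B - A)))"
    by (rule C_inf_linear) (rule bounded_linear_mult_left)
  from C_inf_compose[OF s(1) C_inf_diff[OF this C_inf_const[of "A / (B - A)"]]]
  have c: "C_inf (\<lambda>x. \<sigma> (x * (1 / (B - A)) - A / (B - A)))" .
  have e: "x * (1 / (B - A)) - A / (B - A) = (x - A) / (B - A)" for x
    by (simp add: diff_divide_distrib)
  show ?thesis
  proof (intro exI[of _ "\<lambda>x. 1 - \<sigma> ((x - A) / (B - A))"] conjI allI impI)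
    show "C_inf (\<lambda>x. 1 - \<sigma> ((x - A) / (B - A)))"
      using C_inf_diff[OF C_inf_const c] by (simp only: e)
    show "1 - \<sigma> ((x - A) / (B - A)) = 1" if "x \<le> A" for x
      using s(2) that assms by (simp add: divide_nonpos_pos)
    show "1 - \<sigma> ((x - A) / (B - A)) = 0" if "B \<le> x" for x
      using s(3) that assms by simp
  qed (use s(4) in auto)
qed

lemma test_functionI:
  fixes f :: "'a::euclidean_space \<Rightarrow> real"
  assumes "C_inf f" "\<And>x. f x \<noteq> 0 \<Longrightarrow> x \<in> K" "compact K"
  shows "test_function f" "closure {x. f x \<noteq> 0} \<subseteq> K"
proof -
  show *: "closure {x. f x \<noteq> 0} \<subseteq> K"
    by (rule closure_minimal) (use assms compact_imp_closed in auto)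
  show "test_function f"
    using assms(1) compact_Int_closed[OF assms(3) closed_closure, of "{x. f x \<noteq> 0}"] *
    by (simp add: test_function_def inf_absorb2)
qed

lemma frechet_derivative_eq_0_outside:
  fixes f :: "'a::euclidean_space \<Rightarrow> real"
  assumes "\<And>x. f x \<noteq> 0 \<Longrightarrow> x \<in> K" "closed K" "x \<notin> K"
  shows "frechet_derivative f (at x) b = 0"
proof -
  have "(f has_derivative (\<lambda>_. 0)) (at x)"
    by (rule has_derivative_transform_within_open[of "\<lambda>_. 0" _ _ UNIV "- K"])
      (use assms in auto)
  from frechet_derivative_at[OF this] show ?thesis by metis
qed

section \<open>Positive radial solutions of Delta phi = phi\<close>

text \<open>In the variable y = |x|^2 the equation \<Delta>\<phi> = \<phi> for \<phi>(x) = F(y)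
  becomes 4 y F'' + 2 n F' = F. Comparing coefficients gives c_j = 2 (j + 1) (n + 2 j) c_(j+1),
  which this product solves with c_0 = 1.\<close>

definition bessel_coeff :: "nat \<Rightarrow> nat \<Rightarrow> real" where
  "bessel_coeff n j = (\<Prod>i<j. 1 / (2 * (real i + 1) * (real n + 2 * real i)))"

text \<open>In dimension \<open>n\<close>, \<open>x \<mapsto> bessel n (\<kappa>\<^sup>2 * (x \<bullet> x))\<close> is the mean of \<open>exp (\<kappa> * (x \<bullet> \<omega>))\<close> over the unit sphere.\<close>
definition bessel :: "nat \<Rightarrow> real \<Rightarrow> real" where
  "bessel n y = (\<Sum>j. bessel_coeff n j * y ^ j)"

lemma bessel_coeff_Suc:
  "n \<ge> 1 \<Longrightarrow> bessel_coeff n (Suc j) * (2 * (real j + 1) * (real n + 2 * real j)) = bessel_coeff n j"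
proof -
  assume "n \<ge> 1"
  then have "real n + 2 * real j > 0" by simp
  then have "2 * (real j + 1) * (real n + 2 * real j) \<noteq> 0" by simp
  then show ?thesis by (simp add: bessel_coeff_def)
qed

lemma bessel_coeff_pos: "n \<ge> 1 \<Longrightarrow> bessel_coeff n j > 0"
  unfolding bessel_coeff_def by (intro prod_pos) (auto intro!: divide_pos_pos mult_pos_pos)

text \<open>Splitting off 1/(2j)!, the coefficient of cosh, leaves a product of ratios that are at
  most 1. Both growth bounds of the mode come from this form: the crude one drops the product, the
  sharp one keeps its decay in j.\<close>

lemma bessel_coeff_eq:
  assumes "n \<ge> 1"
  shows "bessel_coeff n j = (\<Prod>i<j. (1 + 2 * real i) / (real n + 2 * real i)) / fact (2 * j)"
proof (induction j)
  case 0 then show ?case by (simp add: bessel_coeff_def)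
next
  case (Suc j)
  have n: "real n + 2 * real j > 0" using assms by simp
  have "fact (2 * Suc j) = (2 * (real j + 1) * (1 + 2 * real j)) * fact (2 * j)"
    by (simp add: algebra_simps)
  moreover have "bessel_coeff n (Suc j) = bessel_coeff n j / (2 * (real j + 1) * (real n + 2 * real j))"
    by (simp add: bessel_coeff_def)
  ultimately show ?case
    using Suc n by (simp add: divide_simps mult_ac add_ac)
qed

lemma bessel_coeff_le: "n \<ge> 1 \<Longrightarrow> bessel_coeff n j \<le> 1 / fact (2 * j)"
  unfolding bessel_coeff_eq
  by (intro divide_right_mono prod_le_1) auto

lemma summable_bessel:
  assumes "n \<ge> 1" shows "summable (\<lambda>j. bessel_coeff n j * y ^ j)"
proof (rule summable_comparison_test'[OF summable_exp[of "\<bar>y\<bar>"], of 0])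
  fix j :: nat
  have "fact (2 * j) \<ge> (fact j :: real)" by (intro fact_mono) simp
  with bessel_coeff_le[OF assms, of j] have "bessel_coeff n j \<le> inverse (fact j)"
    by (smt (verit, best) frac_le fact_gt_zero inverse_eq_divide)
  then show "norm (bessel_coeff n j * y ^ j) \<le> inverse (fact j) * \<bar>y\<bar> ^ j"
    using bessel_coeff_pos[OF assms, of j] by (auto simp: abs_mult power_abs intro!: mult_right_mono)
qed

lemma C_inf_bessel: "n \<ge> 1 \<Longrightarrow> C_inf (bessel n)"
  unfolding bessel_def by (rule C_inf_power_series) (rule summable_bessel)

lemma bessel_ge_1:
  assumes "n \<ge> 1" "y \<ge> 0" shows "bessel n y \<ge> 1"
proof -
  have "sum (\<lambda>j. bessel_coeff n j * y ^ j) {..<1} \<le> bessel n y"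
    unfolding bessel_def
    by (rule sum_le_suminf[OF summable_bessel[OF assms(1)]])
      (use assms in \<open>auto intro!: mult_nonneg_nonneg less_imp_le[OF bessel_coeff_pos]\<close>)
  then show ?thesis by (simp add: bessel_coeff_def)
qed

lemma bessel_ode:
  assumes "n \<ge> 1"
  obtains F' F'' where "\<And>y. (bessel n has_real_derivative F' y) (at y)"
    "\<And>y. (F' has_real_derivative F'' y) (at y)"
    "\<And>y. 4 * y * F'' y + 2 * real n * F' y = bessel n y"
proof -
  let ?c = "bessel_coeff n"
  have s0: "summable (\<lambda>j. ?c j * y ^ j)" for y by (rule summable_bessel[OF assms])
  have s1: "summable (\<lambda>j. diffs ?c j * y ^ j)" for y by (rule termdiff_converges_all[OF s0])
  have s2: "summable (\<lambda>j. diffs (diffs ?c) j * y ^ j)" for y by (rule termdiff_converges_all[OF s1])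
  have "4 * y * (\<Sum>j. diffs (diffs ?c) j * y ^ j) + 2 * real n * (\<Sum>j. diffs ?c j * y ^ j) = bessel n y" for y
  proof -
    \<comment> \<open>The series of y F'' is shifted by one index so that its powers of y match
      those of F'; the constant term is 0.\<close>
    let ?e = "\<lambda>j. (case j of 0 \<Rightarrow> 0 | Suc i \<Rightarrow> diffs (diffs ?c) i * y ^ Suc i)"
    have "(\<lambda>i. y * (diffs (diffs ?c) i * y ^ i)) sums (y * (\<Sum>j. diffs (diffs ?c) j * y ^ j))"
      by (intro sums_mult summable_sums s2)
    moreover have "(\<lambda>i. y * (diffs (diffs ?c) i * y ^ i)) = (\<lambda>i. ?e (Suc i))"
      by (rule ext) simp
    ultimately have "(\<lambda>i. ?e (Suc i)) sums (y * (\<Sum>j. diffs (diffs ?c) j * y ^ j))"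
      by (simp only:)
    then have "?e sums (y * (\<Sum>j. diffs (diffs ?c) j * y ^ j))"
      using sums_Suc_iff[of ?e] by simp
    then have "(\<lambda>j. 4 * ?e j + 2 * real n * (diffs ?c j * y ^ j)) sums
        (4 * (y * (\<Sum>j. diffs (diffs ?c) j * y ^ j)) + 2 * real n * (\<Sum>j. diffs ?c j * y ^ j))"
      by (intro sums_add sums_mult summable_sums s1)
    moreover have "4 * ?e j + 2 * real n * (diffs ?c j * y ^ j) = ?c j * y ^ j" for j
    proof -
      have "4 * ?e j + 2 * real n * (diffs ?c j * y ^ j)
          = (?c (Suc j) * (2 * (real j + 1) * (real n + 2 * real j))) * y ^ j"
        by (cases j) (simp_all add: diffs_def algebra_simps)
      then show ?thesis using bessel_coeff_Suc[OF assms] by simp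
    qed
    ultimately show ?thesis unfolding bessel_def
      by (simp add: sums_iff mult_ac)
  qed
  moreover have "bessel n = (\<lambda>y. \<Sum>j. ?c j * y ^ j)" by (simp add: bessel_def fun_eq_iff)
  ultimately show ?thesis
    using that[OF _ termdiffs_strong_converges_everywhere[OF s1]]
      termdiffs_strong_converges_everywhere[OF s0] by simp
qed

text \<open>The series is dominated by the even part of the exponential series, and the odd terms
  are nonnegative since r \<ge> 0.\<close>

lemma bessel_le_exp:
  assumes "n \<ge> 1" "r \<ge> 0" shows "bessel n (r\<^sup>2) \<le> exp r"
proof -
  let ?a = "\<lambda>k. r ^ k /\<^sub>R fact k"
  have s: "summable ?a" by (rule summable_exp_generic)
  have i: "inj (\<lambda>j::nat. 2 * j)" by (simp add: inj_on_def)
  have p: "?a k \<ge> 0" for k using assms by simp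
  have s2: "summable (?a \<circ> (\<lambda>j. 2 * j))" by (rule summable_reindex[OF s i p])
  have "bessel n (r\<^sup>2) \<le> suminf (?a \<circ> (\<lambda>j. 2 * j))"
    unfolding bessel_def
  proof (rule suminf_le[OF _ summable_bessel[OF assms(1)] s2])
    fix j
    have "bessel_coeff n j * r\<^sup>2 ^ j \<le> 1 / fact (2 * j) * r\<^sup>2 ^ j"
      by (intro mult_right_mono bessel_coeff_le assms) auto
    then show "bessel_coeff n j * r\<^sup>2 ^ j \<le> (?a \<circ> (\<lambda>j. 2 * j)) j"
      by (simp only: o_def power_mult[of r 2 j]) (simp add: divide_inverse mult.commute)
  qed
  also have "\<dots> \<le> suminf ?a" by (rule suminf_reindex_mono[OF s i p])
  finally show ?thesis by (simp add: exp_def)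
qed

section \<open>Decay of the modes relative to the exponential\<close>

lemma powr_minus_ge_linear:
  fixes x \<alpha> :: real
  assumes "x \<ge> 0" "\<alpha> \<ge> 0"
  shows "1 - \<alpha> * x \<le> (1 + x) powr (- \<alpha>)"
proof -
  have "1 + (- \<alpha> * ln (1 + x)) \<le> exp (- \<alpha> * ln (1 + x))" by (rule exp_ge_add_one_self)
  moreover have "\<alpha> * ln (1 + x) \<le> \<alpha> * x"
    using assms by (intro mult_left_mono ln_add_one_self_le_self)
  ultimately show ?thesis using assms by (simp add: powr_def)
qed

text \<open>With \<alpha> = (n - 1)/2 and c = n + 2 j each factor is 1 - \<alpha> (2/c), hence at
  most ((c + 2)/c)^(-\<alpha>) by the Bernoulli-type bound, and these powers telescope. This is the
  origin of the decay rate (n - 1)/2 of the modes.\<close>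

lemma prod_ratio_le_powr:
  fixes n :: nat
  assumes "n \<ge> 1"
  shows "(\<Prod>i<j. (1 + 2 * real i) / (real n + 2 * real i))
    \<le> real n powr ((real n - 1) / 2) * (real n + 2 * real j) powr (- ((real n - 1) / 2))"
proof (induction j)
  case 0
  then show ?case using assms by (simp add: powr_add[symmetric])
next
  case (Suc j)
  let ?\<alpha> = "(real n - 1) / 2" and ?c = "real n + 2 * real j"
  have c: "?c > 0" using assms by simp
  have "(1 + 2 * real j) / ?c = 1 - ?\<alpha> * (2 / ?c)" using c by (simp add: field_simps)
  also have "\<dots> \<le> (1 + 2 / ?c) powr (- ?\<alpha>)"
    by (rule powr_minus_ge_linear) (use assms c in auto)
  also have "\<dots> = ((?c + 2) / ?c) powr (- ?\<alpha>)" using c by (simp add: field_simps)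
  finally have 1: "(1 + 2 * real j) / ?c \<le> ((?c + 2) / ?c) powr (- ?\<alpha>)" .
  have "(\<Prod>i<Suc j. (1 + 2 * real i) / (real n + 2 * real i))
      = (\<Prod>i<j. (1 + 2 * real i) / (real n + 2 * real i)) * ((1 + 2 * real j) / ?c)" by simp
  also have "\<dots> \<le> (real n powr ?\<alpha> * ?c powr (- ?\<alpha>)) * ((?c + 2) / ?c) powr (- ?\<alpha>)"
    by (rule mult_mono[OF Suc 1]) (use c in auto)
  also have "\<dots> = real n powr ?\<alpha> * ((?c * ((?c + 2) / ?c)) powr (- ?\<alpha>))"
    using c by (subst powr_mult) (auto simp: mult_ac)
  also have "?c * ((?c + 2) / ?c) = real n + 2 * real (Suc j)" using c by simp
  finally show ?case .
qed

text \<open>Converts a factor (1 + k)^(-m) on the k-th term of the exponential series into a shift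
  of the series by m places.\<close>

lemma fact_add_le: "fact (k + m) \<le> (fact m * fact k * (1 + real k) ^ m :: real)"
proof (induction m)
  case 0 then show ?case by simp
next
  case (Suc m)
  have "fact (k + Suc m) = (real k + real m + 1) * (fact (k + m) :: real)" by (simp add: algebra_simps)
  also have "\<dots> \<le> ((real m + 1) * (1 + real k)) * (fact m * fact k * (1 + real k) ^ m)"
    by (rule mult_mono[OF _ Suc]) (auto simp: algebra_simps)
  finally show ?case by (simp add: algebra_simps)
qed

text \<open>For x \<ge> r the summand 1 suffices; for x < r the integer power (r/x)^m dominates
  (r/x)^\<alpha>. The purpose is to trade the summation index x for the fixed radius r.\<close>

lemma powr_minus_le_interpolate:
  fixes r x \<alpha> :: real
  assumes "r > 0" "x > 0" "\<alpha> \<ge> 0" "\<alpha> \<le> real m"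
  shows "x powr (- \<alpha>) \<le> r powr (- \<alpha>) * (1 + (r / x) ^ m)"
proof -
  have "(r / x) powr \<alpha> \<le> 1 + (r / x) ^ m"
  proof (cases "r / x \<le> 1")
    case True
    then have "(r / x) powr \<alpha> \<le> 1" using assms powr_mono2[of \<alpha> "r / x" 1] by simp
    moreover have "(r / x) ^ m \<ge> 0" using assms by simp
    ultimately show ?thesis by linarith
  next
    case False
    then have "(r / x) powr \<alpha> \<le> (r / x) powr real m" using assms by (intro powr_mono) auto
    then show ?thesis using assms by (simp add: powr_realpow)
  qed
  then have "r powr (- \<alpha>) * (r / x) powr \<alpha> \<le> r powr (- \<alpha>) * (1 + (r / x) ^ m)"
    by (intro mult_left_mono) auto
  moreover have "r powr (- \<alpha>) * (r / x) powr \<alpha> = x powr (- \<alpha>)"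
    using assms by (simp add: powr_divide powr_minus field_simps)
  ultimately show ?thesis by simp
qed

text \<open>The coefficients decay in the index k, while decay in r is wanted; heuristically the
  exponential series concentrates at k near r. Interpolation replaces (1 + k)^(-\<alpha>) by
  r^(-\<alpha>) at the price of (r/(1 + k))^n, and this correction is again a shifted exponential
  series, which takes the place of an asymptotic analysis of the sum.\<close>

lemma bessel_le_powr_exp:
  assumes "n \<ge> 1" "r > 0"
  defines "\<alpha> \<equiv> (real n - 1) / 2"
  shows "bessel n (r\<^sup>2) \<le> real n powr \<alpha> * (1 + fact n) * r powr (- \<alpha>) * exp r"
proof -
  let ?C = "real n powr \<alpha> * r powr (- \<alpha>)"
  let ?a = "\<lambda>k. r ^ k /\<^sub>R fact k"
  let ?b = "\<lambda>k. ?C * (?a k + fact n * ?a (k + n))"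
  have s: "summable ?a" by (rule summable_exp_generic)
  have sn: "summable (\<lambda>k. ?a (k + n))" using s by (rule summable_ignore_initial_segment)
  have sb: "summable ?b" by (intro summable_mult summable_add s sn)
  have i: "inj (\<lambda>j::nat. 2 * j)" by (simp add: inj_on_def)
  have p: "?b k \<ge> 0" for k using assms by simp
  have s2: "summable (?b \<circ> (\<lambda>j. 2 * j))" by (rule summable_reindex[OF sb i p])
  have "bessel n (r\<^sup>2) \<le> suminf (?b \<circ> (\<lambda>j. 2 * j))"
    unfolding bessel_def
  proof (rule suminf_le[OF _ summable_bessel[OF assms(1)] s2])
    fix j :: nat
    define k where "k = 2 * j"
    have \<alpha>: "0 \<le> \<alpha>" "\<alpha> \<le> real n" using assms by (auto simp: \<alpha>_def)
    have "(\<Prod>i<j. (1 + 2 * real i) / (real n + 2 * real i)) \<le> real n powr \<alpha> * (real n + real k) powr (- \<alpha>)"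
      using prod_ratio_le_powr[OF assms(1), of j] by (simp add: \<alpha>_def k_def)
    also have "\<dots> \<le> real n powr \<alpha> * (1 + real k) powr (- \<alpha>)"
      by (intro mult_left_mono powr_mono2') (use assms \<alpha> in auto)
    also have "\<dots> \<le> real n powr \<alpha> * (r powr (- \<alpha>) * (1 + (r / (1 + real k)) ^ n))"
      by (intro mult_left_mono powr_minus_le_interpolate) (use assms \<alpha> in auto)
    finally have 1: "(\<Prod>i<j. (1 + 2 * real i) / (real n + 2 * real i)) \<le> ?C * (1 + (r / (1 + real k)) ^ n)"
      by (simp add: mult_ac)
    have 2: "r ^ k * (r / (1 + real k)) ^ n / fact k \<le> fact n * (r ^ (k + n) / fact (k + n))"
    proof -
      have f: "fact (k + n) \<le> (fact n * fact k * (1 + real k) ^ n :: real)" by (rule fact_add_le)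
      have "r ^ (k + n) * fact (k + n) \<le> r ^ (k + n) * (fact n * fact k * (1 + real k) ^ n)"
        by (intro mult_left_mono f) (use assms in simp)
      then show ?thesis by (simp add: power_divide power_add divide_simps mult_ac)
    qed
    have "bessel_coeff n j * r\<^sup>2 ^ j = (\<Prod>i<j. (1 + 2 * real i) / (real n + 2 * real i)) * (r ^ k / fact k)"
      by (simp add: bessel_coeff_eq[OF assms(1)] k_def power_mult)
    also have "\<dots> \<le> (?C * (1 + (r / (1 + real k)) ^ n)) * (r ^ k / fact k)"
      by (rule mult_right_mono[OF 1]) (use assms in simp)
    also have "\<dots> = ?C * (r ^ k / fact k + r ^ k * (r / (1 + real k)) ^ n / fact k)"
      by (simp add: algebra_simps add_divide_distrib)
    also have "\<dots> \<le> ?C * (r ^ k / fact k + fact n * (r ^ (k + n) / fact (k + n)))"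
      by (intro mult_left_mono add_left_mono 2) (use assms in simp)
    finally show "bessel_coeff n j * r\<^sup>2 ^ j \<le> (?b \<circ> (\<lambda>j. 2 * j)) j"
      by (simp add: k_def divide_inverse mult_ac)
  qed
  also have "\<dots> \<le> suminf ?b" by (rule suminf_reindex_mono[OF sb i p])
  also have "\<dots> = ?C * (suminf ?a + fact n * (\<Sum>k. ?a (k + n)))"
    using s sn by (simp add: suminf_mult suminf_add[symmetric] summable_mult summable_add)
  also have "\<dots> \<le> ?C * (exp r + fact n * exp r)"
  proof (intro mult_left_mono add_mono)
    have "(\<Sum>k. ?a (k + n)) \<le> suminf ?a"
      using suminf_reindex_mono[OF s, of "\<lambda>k. k + n"] assms by (simp add: o_def)
    then show "(\<Sum>k. ?a (k + n)) \<le> exp r" by (simp add: exp_def)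
  qed (use assms in \<open>auto simp: exp_def\<close>)
  finally show ?thesis by (simp add: algebra_simps)
qed

lemma powr_le_exp:
  fixes z \<alpha> c :: real
  assumes "z > 0" "\<alpha> > 0" "c > 0"
  shows "z powr \<alpha> \<le> (\<alpha> / c) powr \<alpha> * exp (c * z)"
proof -
  have "ln (c * z / \<alpha>) \<le> c * z / \<alpha>" using ln_le_minus_one[of "c * z / \<alpha>"] assms by simp
  then have "\<alpha> * ln (c * z / \<alpha>) \<le> c * z" using assms by (simp add: field_simps)
  then have "(c * z / \<alpha>) powr \<alpha> \<le> exp (c * z)" using assms by (simp add: powr_def)
  then have "(\<alpha> / c) powr \<alpha> * (c * z / \<alpha>) powr \<alpha> \<le> (\<alpha> / c) powr \<alpha> * exp (c * z)"
    by (intro mult_left_mono) auto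
  moreover have "(\<alpha> / c) powr \<alpha> * (c * z / \<alpha>) powr \<alpha> = z powr \<alpha>"
    using assms by (simp add: powr_mult[symmetric])
  ultimately show ?thesis by simp
qed

text \<open>In the application z = \<kappa> (R + 1 + s) and w = \<kappa> |x|, so z - w is a scaled
  distance to the light cone. For w \<ge> z/2 the power bound at w is also one at z. For w < z/2
  half of the exponent z - w exceeds z/4, and exp (- z/4) pays for z^(-\<alpha>).\<close>

lemma bessel_kernel_bound:
  fixes n :: nat
  assumes "n \<ge> 2"
  defines "\<alpha> \<equiv> (real n - 1) / 2"
  obtains C where "C > 0" "\<And>w z. 0 \<le> w \<Longrightarrow> w < z \<Longrightarrow>
     exp (- z) * bessel n (w\<^sup>2) \<le> C * z powr (- \<alpha>) * exp (- (z - w) / 2)"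
proof -
  define C1 where "C1 = real n powr \<alpha> * (1 + fact n)"
  define C2 where "C2 = (4 * \<alpha>) powr \<alpha>"
  have n: "n \<ge> 1" using assms by simp
  have \<alpha>: "\<alpha> > 0" using assms by (simp add: \<alpha>_def)
  have C1: "C1 > 0" using n by (simp add: C1_def add_pos_pos)
  show thesis
  proof
    show "C1 * 2 powr \<alpha> + C2 > 0" using C1 by (simp add: C2_def add_pos_nonneg)
    fix w z :: real assume w: "0 \<le> w" "w < z"
    have "exp (- z) * bessel n (w\<^sup>2) \<le> C1 * 2 powr \<alpha> * z powr (- \<alpha>) * exp (- (z - w) / 2)
      \<or> exp (- z) * bessel n (w\<^sup>2) \<le> C2 * z powr (- \<alpha>) * exp (- (z - w) / 2)"
    proof (cases "w \<ge> z / 2")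
      case True
      then have w0: "w > 0" using w by linarith
      have "exp (- z) * bessel n (w\<^sup>2) \<le> exp (- z) * (C1 * w powr (- \<alpha>) * exp w)"
        using bessel_le_powr_exp[OF n w0] by (simp add: \<alpha>_def C1_def)
      also have "\<dots> = C1 * w powr (- \<alpha>) * exp (- (z - w))"
        by (simp add: exp_diff exp_minus field_simps)
      also have "\<dots> \<le> C1 * (2 powr \<alpha> * z powr (- \<alpha>)) * exp (- (z - w) / 2)"
      proof (intro mult_mono mult_left_mono)
        have "w powr (- \<alpha>) \<le> (z / 2) powr (- \<alpha>)"
          by (rule powr_mono2') (use True w \<alpha> in auto)
        also have "\<dots> = 2 powr \<alpha> * z powr (- \<alpha>)"
          using w by (simp add: powr_divide powr_minus field_simps)
        finally show "w powr (- \<alpha>) \<le> 2 powr \<alpha> * z powr (- \<alpha>)" .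
      qed (use C1 w in auto)
      finally show ?thesis by (simp add: mult_ac)
    next
      case False
      have z: "z > 0" using w by simp
      have "exp (- z) * bessel n (w\<^sup>2) \<le> exp (- z) * exp w"
        by (intro mult_left_mono bessel_le_exp n w) simp
      also have "\<dots> = exp (- (z - w) / 2) * exp (- (z - w) / 2)"
        by (simp add: exp_add[symmetric])
      also have "\<dots> \<le> exp (- (z - w) / 2) * exp (- (1/4 * z))"
        using False by (intro mult_left_mono) auto
      also have "exp (- (1/4 * z)) \<le> C2 * z powr (- \<alpha>)"
        using powr_le_exp[OF z \<alpha>, of "1/4"] z
        by (simp add: exp_minus powr_minus C2_def field_simps)
      finally have "exp (- z) * bessel n (w\<^sup>2) \<le> exp (- (z - w) / 2) * (C2 * z powr (- \<alpha>))" by simp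
      then show ?thesis by (simp add: mult_ac)
    qed
    moreover have "C1 * 2 powr \<alpha> * z powr (- \<alpha>) * exp (- (z - w) / 2) \<ge> 0"
      "C2 * z powr (- \<alpha>) * exp (- (z - w) / 2) \<ge> 0"
      using C1 by (auto simp: C2_def)
    ultimately show "exp (- z) * bessel n (w\<^sup>2) \<le> (C1 * 2 powr \<alpha> + C2) * z powr (- \<alpha>) * exp (- (z - w) / 2)"
      by (auto simp: algebra_simps)
  qed
qed

text \<open>The summands are small both for small and for large scales. Telescoping treats the two
  ends at once: the increments of the bounded function G(z) = z^a/(1 + z^a) between z/2 and z
  dominate the summands, uniformly in y and in the number of terms.\<close>

lemma dyadic_sum_bound:
  fixes a :: real
  assumes "a > 0"
  obtains C where "C > 0" "\<And>y I. y > 0 \<Longrightarrow>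
     (\<Sum>i<I. (y / 2 ^ i) powr a * exp (- (y / 2 ^ i) / 2)) \<le> C"
proof -
  define G where "G z = z powr a / (1 + z powr a)" for z :: real
  define d where "d = 1 - 2 powr (- a)"
  have d: "0 < d" "d < 1" using assms by (auto simp: d_def powr_less_one)
  \<comment> \<open>From (1 + w)^2 \<le> 2 + 2 w^2 with w = z^a, where w^2 = z^(2a) is absorbed by
    exp (z/2) through \<open>powr_le_exp\<close>.\<close>
  define K where "K = 2 + 2 * (2 * a / (1/2)) powr (2 * a)"
  have K: "K > 0" by (simp add: K_def add_pos_nonneg)
  have dyadic: "z powr a * exp (- z / 2) \<le> K / d * (G z - G (z / 2))" if "z > 0" for z
  proof -
    let ?w = "z powr a" and ?v = "(z / 2) powr a"
    have v: "?v = ?w * 2 powr (- a)" using that by (simp add: powr_divide powr_minus field_simps)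
    have w: "?w > 0" "?v > 0" using that by auto
    have vw: "?v \<le> ?w" by (rule powr_mono2) (use that assms in auto)
    have "G z - G (z / 2) = (?w - ?v) / ((1 + ?w) * (1 + ?v))"
    proof -
      have "w / (1 + w) - v / (1 + v) = (w - v) / ((1 + w) * (1 + v))" if "w > 0" "v > 0" for w v :: real
        using that by (simp add: divide_simps) (simp add: algebra_simps)
      then show ?thesis using w by (simp add: G_def)
    qed
    also have "\<dots> = d * ?w / ((1 + ?w) * (1 + ?v))" by (simp add: d_def v algebra_simps)
    also have "\<dots> \<ge> d * ?w / ((1 + ?w) * (1 + ?w))"
      using w vw d by (intro divide_left_mono mult_left_mono mult_pos_pos add_pos_pos) auto
    finally have 1: "d * ?w / ((1 + ?w) * (1 + ?w)) \<le> G z - G (z / 2)" .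
    have "(1 + ?w) * (1 + ?w) \<le> 2 + 2 * (?w * ?w)"
      using sum_squares_ge_zero[of "1 - ?w" 0] by (simp add: algebra_simps)
    also have "?w * ?w = z powr (2 * a)" by (simp add: powr_add[symmetric])
    also have "\<dots> \<le> (2 * a / (1/2)) powr (2 * a) * exp (1/2 * z)"
      by (rule powr_le_exp) (use assms that in auto)
    also have "2 + 2 * ((2 * a / (1/2)) powr (2 * a) * exp (1/2 * z)) \<le> K * exp (z / 2)"
      using that by (simp add: K_def algebra_simps)
    finally have "(1 + ?w) * (1 + ?w) \<le> K * exp (z / 2)" by simp
    then have "exp (- z / 2) * ((1 + ?w) * (1 + ?w)) \<le> exp (- z / 2) * (K * exp (z / 2))"
      by (intro mult_left_mono) auto
    also have "\<dots> = K" by (simp add: exp_minus)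
    finally have "exp (- z / 2) \<le> K / ((1 + ?w) * (1 + ?w))"
      using w by (simp add: pos_le_divide_eq mult_pos_pos add_pos_pos)
    then have "?w * exp (- z / 2) \<le> ?w * (K / ((1 + ?w) * (1 + ?w)))"
      using w by (intro mult_left_mono) auto
    also have "\<dots> = K / d * (d * ?w / ((1 + ?w) * (1 + ?w)))" using d by simp
    also have "\<dots> \<le> K / d * (G z - G (z / 2))"
      using 1 K d by (intro mult_left_mono) auto
    finally show ?thesis .
  qed
  show thesis
  proof
    show "K / d > 0" using K d by simp
    fix y :: real and I :: nat assume y: "y > 0"
    have "(\<Sum>i<I. (y / 2 ^ i) powr a * exp (- (y / 2 ^ i) / 2))
       \<le> (\<Sum>i<I. K / d * (G (y / 2 ^ i) - G (y / 2 ^ Suc i)))"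
      by (rule sum_mono) (use dyadic[of "y / 2 ^ _"] y in \<open>simp add: mult.commute\<close>)
    also have "\<dots> = K / d * (G y - G (y / 2 ^ I))"
      unfolding sum_distrib_left[symmetric]
      using sum_lessThan_telescope'[of "\<lambda>i. G (y / 2 ^ i)" I] by simp
    also have "\<dots> \<le> K / d * 1"
    proof (intro mult_left_mono)
      have "G y \<le> 1" "G (y / 2 ^ I) \<ge> 0" by (auto simp: G_def divide_le_eq add_pos_nonneg)
      then show "G y - G (y / 2 ^ I) \<le> 1" by linarith
    qed (use K d in auto)
    finally show "(\<Sum>i<I. (y / 2 ^ i) powr a * exp (- (y / 2 ^ i) / 2)) \<le> K / d" by simp
  qed
qed

section \<open>The damped ordinary differential equation of a single mode\<close>

lemma LBINT_Icc_eq_integral: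
  fixes f :: "real \<Rightarrow> real"
  assumes "continuous_on {a..b} f"
  shows "(LBINT s:{a..b}. f s) = integral {a..b} f"
  by (rule set_borel_integral_eq_integral(2)[OF borel_integrable_atLeastAtMost'[OF assms]])

lemma set_integrable_continuous_mult:
  fixes f g :: "real \<Rightarrow> real"
  assumes "continuous_on {a..b} f" "set_integrable lborel {a..b} g"
  shows "set_integrable lborel {a..b} (\<lambda>s. f s * g s)"
proof -
  have "compact (f ` {a..b})" by (rule compact_continuous_image[OF assms(1)]) simp
  then obtain B where B: "\<And>s. s \<in> {a..b} \<Longrightarrow> \<bar>f s\<bar> \<le> B"
    using compact_imp_bounded bounded_iff by (metis imageI real_norm_def)
  have "integrable lborel (\<lambda>s. (indicator {a..b} s * f s) * (indicator {a..b} s *\<^sub>R g s))"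
  proof (rule Bochner_Integration.integrable_bound)
    show "integrable lborel (\<lambda>s. \<bar>B\<bar> * norm (indicator {a..b} s *\<^sub>R g s))"
      using assms(2) unfolding set_integrable_def by (intro integrable_mult_right integrable_norm)
    have "(\<lambda>s. indicator {a..b} s *\<^sub>R f s) \<in> borel_measurable borel"
      by (rule borel_measurable_continuous_on_indicator) (use assms in auto)
    then have [measurable]: "(\<lambda>s. indicator {a..b} s * f s) \<in> borel_measurable lborel" by simp
    have [measurable]: "(\<lambda>s. indicator {a..b} s *\<^sub>R g s) \<in> borel_measurable lborel"
      using assms(2) unfolding set_integrable_def by (rule borel_measurable_integrable)
    show "(\<lambda>s. (indicator {a..b} s * f s) * (indicator {a..b} s *\<^sub>R g s)) \<in> borel_measurable lborel"
      by measurable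
    show "AE s in lborel. norm (indicator {a..b} s * f s * indicator {a..b} s *\<^sub>R g s)
            \<le> norm (\<bar>B\<bar> * norm (indicator {a..b} s *\<^sub>R g s))"
      using B by (intro AE_I2) (force simp: indicator_def abs_mult intro!: mult_right_mono)
  qed
  also have "(\<lambda>s. (indicator {a..b} s * f s) * (indicator {a..b} s *\<^sub>R g s)) =
      (\<lambda>s. indicator {a..b} s *\<^sub>R (f s * g s))"
    by (auto simp: indicator_def)
  finally show ?thesis unfolding set_integrable_def .
qed

text \<open>\<open>N\<close> is only integrable, so its indefinite integral need not be
  differentiable at every point and the product rule cannot be integrated directly. Fubini on the
  triangle 0 \<le> r \<le> s \<le> t replaces it; the inner integral of \<open>w'\<close> over
  [r, t] is classical.\<close>

lemma integration_by_parts_indefinite: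
  fixes N w w' :: "real \<Rightarrow> real"
  assumes t: "0 \<le> t" and N: "set_integrable lborel {0..t} N"
    and w: "\<And>s. s \<in> {0..t} \<Longrightarrow> (w has_real_derivative w' s) (at s within {0..t})"
    and cw': "continuous_on {0..t} w'"
  shows "(LBINT s:{0..t}. w' s * (LBINT r:{0..s}. N r)) =
    w t * (LBINT r:{0..t}. N r) - (LBINT r:{0..t}. w r * N r)"
proof -
  define N0 where "N0 r = indicator {0..t} r * N r" for r
  define v where "v s = indicator {0..t} s * w' s" for s
  define f where "f s r = (if r \<le> s then v s * N0 r else 0)" for s r :: real
  have cw: "continuous_on {0..t} w"
    by (rule DERIV_continuous_on[OF w])
  have iN0: "integrable lborel N0"
    using N by (simp add: set_integrable_def N0_def[abs_def])
  have [measurable]: "N0 \<in> borel_measurable borel" using iN0 by simp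
  have "(\<lambda>s. indicator {0..t} s *\<^sub>R w' s) \<in> borel_measurable borel"
    by (rule borel_measurable_continuous_on_indicator) (use cw' in auto)
  then have [measurable]: "v \<in> borel_measurable borel" by (simp add: v_def[abs_def])
  have iv: "integrable lborel v"
    using borel_integrable_atLeastAtMost'[OF cw'] by (simp add: set_integrable_def v_def[abs_def])
  have int: "integrable (lborel \<Otimes>\<^sub>M lborel) (case_prod f)"
  proof (rule Bochner_Integration.integrable_bound)
    show "integrable (lborel \<Otimes>\<^sub>M lborel) (\<lambda>(s, r). v s * N0 r)"
    proof (rule lborel_pair.Fubini_integrable)
      show "integrable lborel (\<lambda>s. LBINT r. norm (case (s, r) of (s, r) \<Rightarrow> v s * N0 r))"
        using iv iN0 by (simp add: abs_mult)
      show "AE s in lborel. integrable lborel (\<lambda>r. case (s, r) of (s, r) \<Rightarrow> v s * N0 r)"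
        using iN0 by simp
    qed simp
    show "case_prod f \<in> borel_measurable (lborel \<Otimes>\<^sub>M lborel)"
      unfolding f_def[abs_def] by measurable
    show "AE x in lborel \<Otimes>\<^sub>M lborel. norm (case_prod f x) \<le> norm (case x of (s, r) \<Rightarrow> v s * N0 r)"
      by (rule AE_I2) (auto simp: f_def)
  qed
  have "(LBINT s:{0..t}. w' s * (LBINT r:{0..s}. N r)) = (LBINT s. LBINT r. f s r)"
    unfolding set_lebesgue_integral_def
  proof (rule Bochner_Integration.integral_cong[OF refl])
    fix s
    have "(LBINT r. f s r) = (LBINT r. v s * (indicator {0..s} r * N r))"
    proof (rule Bochner_Integration.integral_cong[OF refl])
      show "f s r = v s * (indicator {0..s} r * N r)" for r
        by (auto simp: f_def v_def N0_def indicator_def)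
    qed
    then show "indicator {0..t} s *\<^sub>R (w' s * (LBINT r. indicator {0..s} r *\<^sub>R N r)) = (LBINT r. f s r)"
      by (simp add: v_def)
  qed
  also have "\<dots> = (LBINT r. LBINT s. f s r)"
    by (rule lborel_pair.Fubini_integral[OF int, symmetric])
  also have "\<dots> = (LBINT r. w t * (indicator {0..t} r *\<^sub>R N r) - indicator {0..t} r *\<^sub>R (w r * N r))"
  proof (rule Bochner_Integration.integral_cong[OF refl])
    fix r :: real
    show "(LBINT s. f s r) = w t * (indicator {0..t} r *\<^sub>R N r) - indicator {0..t} r *\<^sub>R (w r * N r)"
    proof (cases "r \<in> {0..t}")
      case True
      have "(LBINT s. f s r) = (LBINT s. (indicator {r..t} s *\<^sub>R w' s) * N r)"
      proof (rule Bochner_Integration.integral_cong[OF refl])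
        show "f s r = (indicator {r..t} s *\<^sub>R w' s) * N r" for s
          using True by (auto simp: f_def v_def N0_def indicator_def)
      qed
      also have "\<dots> = (LBINT s:{r..t}. w' s) * N r"
        by (simp add: set_lebesgue_integral_def)
      also have "(LBINT s:{r..t}. w' s) = integral {r..t} w'"
        by (rule LBINT_Icc_eq_integral) (use True in \<open>auto intro: continuous_on_subset[OF cw']\<close>)
      also have "\<dots> = w t - w r"
      proof (rule integral_unique, rule fundamental_theorem_of_calculus)
        show "r \<le> t" using True by simp
        fix s assume "s \<in> {r..t}"
        then show "(w has_vector_derivative w' s) (at s within {r..t})"
          using w[of s] True unfolding has_real_derivative_iff_has_vector_derivative[symmetric]
          by (auto intro: DERIV_subset)
      qed
      finally show ?thesis using True by (simp add: algebra_simps)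
    next
      case False
      then have "f s r = 0" for s by (auto simp: f_def v_def N0_def indicator_def)
      then show ?thesis using False by simp
    qed
  qed
  also have "\<dots> = w t * (LBINT r:{0..t}. N r) - (LBINT r:{0..t}. w r * N r)"
    unfolding set_lebesgue_integral_def
    using N set_integrable_continuous_mult[OF cw N]
    by (subst Bochner_Integration.integral_diff) (auto simp: set_integrable_def)
  finally show ?thesis .
qed

lemma indefinite_LBINT_continuous:
  fixes N :: "real \<Rightarrow> real"
  assumes "set_integrable lborel {0..T} N"
  shows "continuous_on {0..T} (\<lambda>t. LBINT r:{0..t}. N r)"
proof -
  have "continuous_on {0..T} (\<lambda>t. integral {0..t} N)"
    by (rule indefinite_integral_continuous_1) (rule set_borel_integral_eq_integral(1)[OF assms])
  moreover have "(LBINT r:{0..t}. N r) = integral {0..t} N" if "t \<in> {0..T}" for t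
    by (rule set_borel_integral_eq_integral(2), rule set_integrable_subset[OF assms]) (use that in auto)
  ultimately show ?thesis
    using continuous_on_cong[OF refl, of "{0..T}" "\<lambda>t. LBINT r:{0..t}. N r" "\<lambda>t. integral {0..t} N"] by blast
qed

lemma DERIV_within_mono:
  fixes f :: "real \<Rightarrow> real"
  assumes "a \<le> b" "\<And>s. s \<in> {a..b} \<Longrightarrow> (f has_real_derivative f' s) (at s within {a..b})"
    "\<And>s. s \<in> {a..b} \<Longrightarrow> 0 \<le> f' s"
  shows "f a \<le> f b"
proof (rule DERIV_nonneg_imp_increasing_open[OF assms(1)])
  fix x assume x: "a < x" "x < b"
  then have "(f has_real_derivative f' x) (at x)"
    using assms(2)[of x] by (simp add: at_within_Icc_at)
  then show "\<exists>y. (f has_real_derivative y) (at x) \<and> 0 \<le> y" using assms(3)[of x] x by auto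
qed (rule DERIV_continuous_on[OF assms(2)])

text \<open>\<open>Z\<close> is one mode, \<open>W\<close> its time derivative, \<open>N\<close> the
  forcing and \<open>m\<close> the integrating factor of the damping \<open>b\<close>. An integrable
  forcing gives no pointwise second derivative of \<open>Z\<close>, so the equation Z'' + b Z' -
  \<kappa>^2 Z = N is imposed in the form integrated once in time.\<close>

locale damped_mode =
  fixes \<tau> \<kappa> :: real and b m Z W N :: "real \<Rightarrow> real" and W0 :: real
  assumes tau: "0 < \<tau>" and lam: "0 < \<kappa>"
    and b_cont: "continuous_on {0..\<tau>} b" and b_nonneg: "\<And>s. s \<in> {0..\<tau>} \<Longrightarrow> 0 \<le> b s"
    and m_deriv: "\<And>s. s \<in> {0..\<tau>} \<Longrightarrow> (m has_real_derivative b s * m s) (at s within {0..\<tau>})"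
    and m_0: "m 0 = 1"
    and m_pos: "\<And>s. s \<in> {0..\<tau>} \<Longrightarrow> 0 < m s"
    and Z_deriv: "\<And>s. s \<in> {0..\<tau>} \<Longrightarrow> (Z has_real_derivative W s) (at s within {0..\<tau>})"
    and W_cont: "continuous_on {0..\<tau>} W"
    and N_int: "set_integrable lborel {0..\<tau>} N" and N_nonneg: "\<And>s. 0 \<le> N s"
    and W_eq: "\<And>t. t \<in> {0..\<tau>} \<Longrightarrow>
      W t + (LBINT s:{0..t}. b s * W s - \<kappa>\<^sup>2 * Z s) = W0 + (LBINT s:{0..t}. N s)"
    and Z_0: "0 < Z 0" and W0: "0 \<le> W0"
begin

lemma Z_cont: "continuous_on {0..\<tau>} Z"
  by (rule DERIV_continuous_on[OF Z_deriv])

lemma m_cont: "continuous_on {0..\<tau>} m"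
  by (rule DERIV_continuous_on[OF m_deriv])

lemma m_mono: "0 \<le> s \<Longrightarrow> s \<le> t \<Longrightarrow> t \<le> \<tau> \<Longrightarrow> m s \<le> m t"
  by (rule DERIV_within_mono[of s t m "\<lambda>s. b s * m s"])
    (auto intro!: DERIV_subset[OF m_deriv] mult_nonneg_nonneg b_nonneg less_imp_le[OF m_pos])

lemma N_int': "t \<in> {0..\<tau>} \<Longrightarrow> set_integrable lborel {0..t} N"
  by (rule set_integrable_subset[OF N_int]) auto

text \<open>Variation of constants for the factorization
  \<open>d\<^sup>2 + b d - \<kappa>\<^sup>2 = (d + b - \<kappa>) (d + \<kappa>) - \<kappa> b\<close>, where \<open>d\<close> denotes the time derivative.\<close>
lemma weighted_identity:
  assumes t: "t \<in> {0..\<tau>}"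
  shows "exp (- \<kappa> * t) * m t * (W t + \<kappa> * Z t) = W0 + \<kappa> * Z 0
    + integral {0..t} (\<lambda>s. \<kappa> * b s * (exp (- \<kappa> * s) * m s) * Z s)
    + (LBINT s:{0..t}. exp (- \<kappa> * s) * m s * N s)"
proof -
  let ?w = "\<lambda>s. exp (- \<kappa> * s) * m s" and ?w' = "\<lambda>s. (b s - \<kappa>) * (exp (- \<kappa> * s) * m s)"
  let ?J = "\<lambda>s. LBINT r:{0..s}. N r"
  \<comment> \<open>Removing the indefinite integral of \<open>N\<close> from \<open>W\<close>
    leaves a function that is differentiable in the classical sense.\<close>
  let ?A = "\<lambda>s. W s - ?J s"
  have sub: "{0..t} \<subseteq> {0..\<tau>}" using t by auto
  have cJ: "continuous_on {0..t} ?J"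
    by (rule indefinite_LBINT_continuous[OF N_int'[OF t]])
  have ci: "continuous_on {0..\<tau>} (\<lambda>s. b s * W s - \<kappa>\<^sup>2 * Z s)"
    by (intro continuous_intros b_cont W_cont Z_cont)
  have A_eq: "?A s = W0 - integral {0..s} (\<lambda>s. b s * W s - \<kappa>\<^sup>2 * Z s)" if "s \<in> {0..t}" for s
    using W_eq[of s] LBINT_Icc_eq_integral[OF continuous_on_subset[OF ci], of 0 s] that t by auto
  have dA: "(?A has_real_derivative - (b s * W s - \<kappa>\<^sup>2 * Z s)) (at s within {0..t})" if s: "s \<in> {0..t}" for s
  proof -
    have "((\<lambda>s. W0 - integral {0..s} (\<lambda>s. b s * W s - \<kappa>\<^sup>2 * Z s)) has_real_derivative
        0 - (b s * W s - \<kappa>\<^sup>2 * Z s)) (at s within {0..t})"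
      by (intro DERIV_diff DERIV_const integral_has_real_derivative s continuous_on_subset[OF ci sub])
    then show ?thesis
      using has_field_derivative_transform_within[OF _ zero_less_one s] A_eq by auto
  qed
  have dw: "(?w has_real_derivative ?w' s) (at s within {0..t})" if s: "s \<in> {0..t}" for s
  proof -
    have "(m has_real_derivative b s * m s) (at s within {0..t})"
      by (rule DERIV_subset[OF m_deriv]) (use s sub in auto)
    then show ?thesis
      by (auto intro!: derivative_eq_intros simp: algebra_simps)
  qed
  have dZ: "(Z has_real_derivative W s) (at s within {0..t})" if s: "s \<in> {0..t}" for s
    by (rule DERIV_subset[OF Z_deriv]) (use s sub in auto)
  have cw: "continuous_on {0..t} ?w" by (rule DERIV_continuous_on[OF dw])
  have cw': "continuous_on {0..t} ?w'"
    by (intro continuous_intros continuous_on_subset[OF b_cont sub] continuous_on_subset[OF m_cont sub])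
  have "((\<lambda>s. ?w s * (?A s + \<kappa> * Z s)) has_real_derivative
      \<kappa> * b s * ?w s * Z s - ?w' s * ?J s) (at s within {0..t})" if s: "s \<in> {0..t}" for s
  proof -
    have "((\<lambda>s. ?w s * (?A s + \<kappa> * Z s)) has_real_derivative
      ?w' s * (?A s + \<kappa> * Z s) + (- (b s * W s - \<kappa>\<^sup>2 * Z s) + \<kappa> * W s) * ?w s) (at s within {0..t})"
      by (intro DERIV_mult DERIV_add DERIV_cmult dA dw dZ s)
    also have "?w' s * (?A s + \<kappa> * Z s) + (- (b s * W s - \<kappa>\<^sup>2 * Z s) + \<kappa> * W s) * ?w s
      = \<kappa> * b s * ?w s * Z s - ?w' s * ?J s"
      by (simp add: power2_eq_square algebra_simps)
    finally show ?thesis .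
  qed
  then have "((\<lambda>s. \<kappa> * b s * ?w s * Z s - ?w' s * ?J s) has_integral
      ?w t * (?A t + \<kappa> * Z t) - ?w 0 * (?A 0 + \<kappa> * Z 0)) {0..t}"
    by (intro fundamental_theorem_of_calculus)
      (use t in \<open>auto simp: has_real_derivative_iff_has_vector_derivative\<close>)
  then have 1: "integral {0..t} (\<lambda>s. \<kappa> * b s * ?w s * Z s - ?w' s * ?J s) =
      ?w t * (?A t + \<kappa> * Z t) - ?w 0 * (?A 0 + \<kappa> * Z 0)" by (rule integral_unique)
  have c1: "continuous_on {0..t} (\<lambda>s. \<kappa> * b s * ?w s * Z s)"
    by (intro continuous_intros continuous_on_subset[OF b_cont sub] continuous_on_subset[OF Z_cont sub]
        continuous_on_subset[OF m_cont sub])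
  have c2: "continuous_on {0..t} (\<lambda>s. ?w' s * ?J s)"
    by (rule continuous_on_mult[OF cw' cJ])
  have "integral {0..t} (\<lambda>s. \<kappa> * b s * ?w s * Z s - ?w' s * ?J s) =
     integral {0..t} (\<lambda>s. \<kappa> * b s * ?w s * Z s) - integral {0..t} (\<lambda>s. ?w' s * ?J s)"
    by (rule Henstock_Kurzweil_Integration.integral_diff)
      (intro integrable_continuous_real c1 c2)+
  also have "integral {0..t} (\<lambda>s. ?w' s * ?J s) = (LBINT s:{0..t}. ?w' s * ?J s)"
    by (rule LBINT_Icc_eq_integral[OF c2, symmetric])
  also have "\<dots> = ?w t * ?J t - (LBINT r:{0..t}. ?w r * N r)"
    by (rule integration_by_parts_indefinite[OF _ N_int'[OF t] dw cw']) (use t in auto)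
  finally have "integral {0..t} (\<lambda>s. \<kappa> * b s * ?w s * Z s) + (LBINT r:{0..t}. ?w r * N r) =
     ?w t * (W t + \<kappa> * Z t) - ?w 0 * (?A 0 + \<kappa> * Z 0)"
    unfolding 1 by (simp add: algebra_simps)
  moreover have "?A 0 = W0" using A_eq[of 0] t by simp
  ultimately show ?thesis using m_0 by simp
qed

text \<open>The derivative of exp (\<kappa> s) Z is exp (\<kappa> s) (W + \<kappa> Z). This inverts
  the factor d + \<kappa>, with \<open>r\<close> an explicit function that grows no faster.\<close>

lemma Z_lower_aux:
  assumes a: "0 \<le> a" "a \<le> t" "t \<le> \<tau>"
    and r: "\<And>s. s \<in> {a..t} \<Longrightarrow> (r has_real_derivative r' s) (at s within {a..t})"
    and le: "\<And>s. s \<in> {a..t} \<Longrightarrow> r' s \<le> exp (\<kappa> * s) * (W s + \<kappa> * Z s)"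
  shows "exp (\<kappa> * a) * Z a + r t - r a \<le> exp (\<kappa> * t) * Z t"
proof -
  have "exp (\<kappa> * a) * Z a - r a \<le> exp (\<kappa> * t) * Z t - r t"
  proof (rule DERIV_within_mono[OF a(2)])
    fix s assume s: "s \<in> {a..t}"
    have "(Z has_real_derivative W s) (at s within {a..t})"
      by (rule DERIV_subset[OF Z_deriv]) (use s a in auto)
    then show "((\<lambda>s. exp (\<kappa> * s) * Z s - r s) has_real_derivative
       exp (\<kappa> * s) * (W s + \<kappa> * Z s) - r' s) (at s within {a..t})"
      using r[OF s] by (auto intro!: derivative_eq_intros simp: algebra_simps)
  qed (use le in auto)
  then show ?thesis by simp
qed

text \<open>The integral of \<kappa> b Z is discarded, which requires Z \<ge> 0 on all of [0, t];
  the sign of \<open>Z\<close> has to be bootstrapped before this bound can be used freely.\<close>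

lemma weighted_lower:
  assumes t: "t \<in> {0..\<tau>}" and Z: "\<And>s. s \<in> {0..t} \<Longrightarrow> 0 \<le> Z s"
  shows "W0 + \<kappa> * Z 0 + (LBINT s:{0..t}. exp (- \<kappa> * s) * m s * N s)
    \<le> exp (- \<kappa> * t) * m t * (W t + \<kappa> * Z t)"
proof -
  have "0 \<le> integral {0..t} (\<lambda>s. \<kappa> * b s * (exp (- \<kappa> * s) * m s) * Z s)"
  proof (rule Henstock_Kurzweil_Integration.integral_nonneg)
    show "(\<lambda>s. \<kappa> * b s * (exp (- \<kappa> * s) * m s) * Z s) integrable_on {0..t}"
      by (rule integrable_continuous_real, intro continuous_intros continuous_on_subset[OF b_cont]
          continuous_on_subset[OF Z_cont] continuous_on_subset[OF m_cont]) (use t in auto)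
    fix s assume "s \<in> {0..t}"
    then show "0 \<le> \<kappa> * b s * (exp (- \<kappa> * s) * m s) * Z s"
      using t by (intro mult_nonneg_nonneg Z b_nonneg less_imp_le[OF m_pos] less_imp_le[OF lam]) auto
  qed
  then show ?thesis unfolding weighted_identity[OF t] by simp
qed

lemma LBINT_weighted_nonneg:
  assumes t: "t \<in> {0..\<tau>}"
  shows "0 \<le> (LBINT s:{0..t}. exp (- \<kappa> * s) * m s * N s)"
  unfolding set_lebesgue_integral_def
  by (rule Bochner_Integration.integral_nonneg)
    (use t m_pos N_nonneg in \<open>auto simp: indicator_def intro!: mult_nonneg_nonneg less_imp_le[OF m_pos]\<close>)

lemma weighted_nonneg:
  assumes t: "t \<in> {0..\<tau>}" and Z: "\<And>s. s \<in> {0..t} \<Longrightarrow> 0 \<le> Z s"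
  shows "0 \<le> W t + \<kappa> * Z t"
proof -
  have "0 \<le> W0 + \<kappa> * Z 0" using W0 lam Z_0 by simp
  then have "0 \<le> exp (- \<kappa> * t) * m t * (W t + \<kappa> * Z t)"
    using weighted_lower[OF t Z] LBINT_weighted_nonneg[OF t] by linarith
  moreover have "0 < exp (- \<kappa> * t) * m t" using m_pos[OF t] by simp
  ultimately show ?thesis by (simp only: zero_le_mult_iff) linarith
qed

lemma Z_lower_if_nonneg:
  assumes t: "t \<in> {0..\<tau>}" and Z: "\<And>s. s \<in> {0..t} \<Longrightarrow> 0 \<le> Z s"
  shows "exp (- \<kappa> * t) * Z 0 \<le> Z t"
proof -
  have "exp (\<kappa> * 0) * Z 0 + 0 - 0 \<le> exp (\<kappa> * t) * Z t"
  proof (rule Z_lower_aux[of 0 t "\<lambda>_. 0" "\<lambda>_. 0"])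
    fix s assume s: "s \<in> {0..t}"
    then have s': "s \<in> {0..\<tau>}" using t by auto
    have "0 \<le> W s + \<kappa> * Z s"
      by (rule weighted_nonneg[OF s']) (use Z s in auto)
    then show "0 \<le> exp (\<kappa> * s) * (W s + \<kappa> * Z s)" by simp
  qed (use t in auto)
  then show ?thesis by (simp add: exp_minus field_simps)
qed

text \<open>A first-contact argument: up to the first time at which \<open>Z\<close> falls to the
  level \<open>c\<close> it is nonnegative, so \<open>Z_lower_if_nonneg\<close> applies at that time
  and contradicts the choice of \<open>c\<close>.\<close>

lemma Z_ge_exp:
  assumes t: "t \<in> {0..\<tau>}"
  shows "exp (- \<kappa> * t) * Z 0 \<le> Z t"
proof -
  \<comment> \<open>Half of the least value of the barrier exp (- \<kappa> s) Z(0) on [0, \<tau>],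
    hence strictly below it everywhere.\<close>
  define c where "c = exp (- \<kappa> * \<tau>) * Z 0 / 2"
  have c: "0 < c" using Z_0 by (simp add: c_def)
  have cl: "c < exp (- \<kappa> * s) * Z 0" if "s \<in> {0..\<tau>}" for s
  proof -
    have "exp (- \<kappa> * \<tau>) * Z 0 \<le> exp (- \<kappa> * s) * Z 0"
      using that lam Z_0 by simp
    then show ?thesis using c by (simp add: c_def)
  qed
  have "Z s > c" if "s \<in> {0..\<tau>}" for s
  proof (rule ccontr)
    assume "\<not> Z s > c"
    let ?S = "{s \<in> {0..\<tau>}. Z s \<le> c}"
    have "closed ?S" by (rule continuous_on_closed_Collect_le[OF Z_cont continuous_on_const]) simp
    moreover have "bounded ?S" by (rule bounded_subset[of "{0..\<tau>}"]) auto
    ultimately have "compact ?S" by (simp add: compact_eq_bounded_closed)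
    moreover have "?S \<noteq> {}" using that \<open>\<not> Z s > c\<close> by auto
    ultimately have "\<exists>t\<in>?S. \<forall>r\<in>?S. t \<le> r" by (rule compact_attains_inf)
    then obtain t where t: "t \<in> ?S" "\<And>r. r \<in> ?S \<Longrightarrow> t \<le> r" by (elim bexE) simp
    have gt: "Z r > c" if "r \<in> {0..<t}" for r
      using t(2)[of r] that t(1) by force
    have "c < Z 0" using cl[of 0] tau by simp
    then obtain r where r: "0 \<le> r" "r \<le> t" "Z r = c"
      using IVT2'[of Z t c 0] t(1) continuous_on_subset[OF Z_cont, of "{0..t}"] by auto
    then have "r = t" using gt[of r] by (cases "r = t") auto
    with r have "Z t = c" by simp
    with gt have "0 \<le> Z r" if "r \<in> {0..t}" for r
      using that c gt[of r] by (cases "r = t") (auto intro: less_imp_le[OF less_trans[OF c]])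
    then have "exp (- \<kappa> * t) * Z 0 \<le> Z t" using Z_lower_if_nonneg[of t] t by auto
    then show False using \<open>Z t = c\<close> cl[of t] t by auto
  qed
  then have "0 \<le> Z s" if "s \<in> {0..\<tau>}" for s using that c by (meson less_imp_le less_trans)
  then show ?thesis using t by (intro Z_lower_if_nonneg) auto
qed

lemma Z_pos:
  assumes "t \<in> {0..\<tau>}" shows "0 < Z t"
proof -
  have "0 < exp (- \<kappa> * t) * Z 0" using Z_0 by simp
  then show ?thesis using Z_ge_exp[OF assms] by (rule less_le_trans)
qed

text \<open>Keeping only the data term, W + \<kappa> Z is at least exp (\<kappa> s)/m(s) times W0 +
  \<kappa> Z(0). Replacing m(s) by the larger m(t) makes the integration explicit and costs the
  factor 1/m(t).\<close>

lemma Z_ge_sinh: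
  assumes t: "t \<in> {0..\<tau>}"
  shows "(W0 + \<kappa> * Z 0) * sinh (\<kappa> * t) / (\<kappa> * m t) \<le> Z t"
proof -
  let ?P = "W0 + \<kappa> * Z 0" and ?r = "\<lambda>s. (W0 + \<kappa> * Z 0) / (2 * \<kappa> * m t) * exp (2 * \<kappa> * s)"
  have P: "0 \<le> ?P" using W0 lam Z_0 by simp
  have mt: "0 < m t" using m_pos t by simp
  have "exp (\<kappa> * 0) * Z 0 + ?r t - ?r 0 \<le> exp (\<kappa> * t) * Z t"
  proof (rule Z_lower_aux)
    fix s assume s: "s \<in> {0..t}"
    then have s': "s \<in> {0..\<tau>}" using t by auto
    have Z0s: "0 \<le> Z r" if "r \<in> {0..s}" for r
      using Z_pos[of r] that s' by auto
    show "(?r has_real_derivative ?P / m t * exp (2 * \<kappa> * s)) (at s within {0..t})"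
      using mt lam by (auto intro!: derivative_eq_intros simp: field_simps)
    have "?P \<le> exp (- \<kappa> * s) * m s * (W s + \<kappa> * Z s)"
      using weighted_lower[OF s' Z0s] LBINT_weighted_nonneg[OF s'] by linarith
    then have "?P / m s * exp (\<kappa> * s) \<le> W s + \<kappa> * Z s"
      using m_pos[OF s'] by (simp add: exp_minus field_simps)
    moreover have "?P / m t \<le> ?P / m s"
      using P m_pos[OF s'] m_mono[of s t] s t by (intro divide_left_mono) auto
    then have "?P / m t * exp (\<kappa> * s) \<le> ?P / m s * exp (\<kappa> * s)" by (intro mult_right_mono) auto
    ultimately have "exp (\<kappa> * s) * (?P / m t * exp (\<kappa> * s)) \<le> exp (\<kappa> * s) * (W s + \<kappa> * Z s)"
      by (intro mult_left_mono) auto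
    moreover have "exp (2 * \<kappa> * s) = exp (\<kappa> * s) * exp (\<kappa> * s)" by (simp add: exp_add[symmetric])
    ultimately show "?P / m t * exp (2 * \<kappa> * s) \<le> exp (\<kappa> * s) * (W s + \<kappa> * Z s)"
      by (simp add: mult_ac)
  qed (use t in auto)
  then have "?r t - ?r 0 \<le> exp (\<kappa> * t) * Z t" using Z_0 by simp
  then have "exp (- \<kappa> * t) * (?r t - ?r 0) \<le> exp (- \<kappa> * t) * (exp (\<kappa> * t) * Z t)"
    by (intro mult_left_mono) auto
  also have "\<dots> = Z t" by (simp add: exp_minus)
  also have "exp (- \<kappa> * t) * (?r t - ?r 0) = ?P * sinh (\<kappa> * t) / (\<kappa> * m t)"
  proof -
    have "exp (2 * \<kappa> * t) = exp (\<kappa> * t) * exp (\<kappa> * t)" by (simp add: exp_add[symmetric])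
    then show ?thesis
      using mt lam by (simp add: sinh_def exp_minus field_simps)
  qed
  finally show ?thesis .
qed

text \<open>Here the data term is dropped and the forcing kept. For r \<le> s in [a, t] the ratio of
  weights m(r)/m(s) is at least \<theta>, so on this window the damping costs a constant rather than
  a power of m. The minorant \<open>w\<close> is continuous so that the remaining integrals can be
  differentiated at every point.\<close>

lemma Z_ge_Duhamel:
  assumes a: "0 \<le> a" "a \<le> t" "t \<le> \<tau>" and \<theta>: "0 \<le> \<theta>"
    and m: "\<And>s. s \<in> {a..t} \<Longrightarrow> \<theta> * m t \<le> m s"
    and w_cont: "continuous_on {a..t} w" and w_nonneg: "\<And>s. s \<in> {a..t} \<Longrightarrow> 0 \<le> w s"
    and w_le: "AE s in lborel. s \<in> {a..t} \<longrightarrow> w s \<le> N s"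
  shows "\<theta> * integral {a..t} (\<lambda>s. w s * sinh (\<kappa> * (t - s)) / \<kappa>) \<le> Z t"
proof -
  let ?A = "\<lambda>s. integral {a..s} (\<lambda>s. exp (- \<kappa> * s) * w s)"
  let ?B = "\<lambda>s. integral {a..s} (\<lambda>s. exp (\<kappa> * s) * w s)"
  \<comment> \<open>This is \<theta> exp (\<kappa> s) times the convolution of \<open>w\<close> with
    sinh (\<kappa> s)/\<kappa>, expanded into its two exponentials; on differentiation the terms in
    \<open>w s\<close> cancel.\<close>
  let ?r = "\<lambda>s. \<theta> / (2 * \<kappa>) * (exp (2 * \<kappa> * s) * ?A s - ?B s)"
  have t': "t \<in> {0..\<tau>}" using a by auto
  have mt: "0 < m t" using m_pos[OF t'] .
  have cA: "continuous_on {a..t} (\<lambda>s. exp (- \<kappa> * s) * w s)"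
    by (intro continuous_intros w_cont)
  have cB: "continuous_on {a..t} (\<lambda>s. exp (\<kappa> * s) * w s)"
    by (intro continuous_intros w_cont)
  have "exp (\<kappa> * a) * Z a + ?r t - ?r a \<le> exp (\<kappa> * t) * Z t"
  proof (rule Z_lower_aux[OF a])
    fix s assume s: "s \<in> {a..t}"
    then have s': "s \<in> {0..\<tau>}" using a by auto
    have Z0s: "0 \<le> Z r" if "r \<in> {0..s}" for r
      using Z_pos[of r] that s' by auto
    have dA: "(?A has_real_derivative exp (- \<kappa> * s) * w s) (at s within {a..t})"
      by (rule integral_has_real_derivative[OF cA s])
    have dB: "(?B has_real_derivative exp (\<kappa> * s) * w s) (at s within {a..t})"
      by (rule integral_has_real_derivative[OF cB s])
    have "(?r has_real_derivative \<theta> / (2 * \<kappa>) * ((2 * \<kappa> * exp (2 * \<kappa> * s)) * ?A s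
       + (exp (- \<kappa> * s) * w s) * exp (2 * \<kappa> * s) - exp (\<kappa> * s) * w s)) (at s within {a..t})"
      by (rule DERIV_cmult, rule DERIV_diff[OF DERIV_mult[OF _ dA] dB])
        (auto intro!: derivative_eq_intros)
    moreover have "(exp (- \<kappa> * s) * w s) * exp (2 * \<kappa> * s) = exp (\<kappa> * s) * w s"
      by (simp add: exp_add[symmetric])
    then have "\<theta> / (2 * \<kappa>) * ((2 * \<kappa> * exp (2 * \<kappa> * s)) * ?A s
       + (exp (- \<kappa> * s) * w s) * exp (2 * \<kappa> * s) - exp (\<kappa> * s) * w s) = \<theta> * exp (2 * \<kappa> * s) * ?A s"
      using lam by (simp only:) simp
    ultimately show "(?r has_real_derivative \<theta> * exp (2 * \<kappa> * s) * ?A s) (at s within {a..t})"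
      by (simp only:)
    have w0: "0 \<le> exp (- \<kappa> * r) * w r" if "r \<in> {a..s}" for r
      using w_nonneg[of r] that s by auto
    have A0: "0 \<le> ?A s"
      by (rule Henstock_Kurzweil_Integration.integral_nonneg[OF integrable_continuous_real w0],
          rule continuous_on_subset[OF cA]) (use s in auto)
    have "\<theta> * m t * ?A s = (LBINT r:{a..s}. \<theta> * m t * (exp (- \<kappa> * r) * w r))"
      using s by (subst LBINT_Icc_eq_integral)
        (auto intro!: continuous_intros continuous_on_subset[OF w_cont])
    also have "\<dots> = (LBINT r:{0..s}. indicator {a..s} r * (\<theta> * m t * (exp (- \<kappa> * r) * w r)))"
      unfolding set_lebesgue_integral_def using a
      by (intro Bochner_Integration.integral_cong) (auto simp: indicator_def)
    also have "\<dots> \<le> (LBINT r:{0..s}. exp (- \<kappa> * r) * m r * N r)"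
    proof -
      have "continuous_on {a..s} (\<lambda>r. \<theta> * m t * (exp (- \<kappa> * r) * w r))"
        using s by (auto intro!: continuous_intros continuous_on_subset[OF w_cont])
      then have i1: "integrable lborel (\<lambda>r. indicator {a..s} r *\<^sub>R (\<theta> * m t * (exp (- \<kappa> * r) * w r)))"
        by (intro borel_integrable_compact) auto
      have i1': "(\<lambda>r. indicator {0..s} r *\<^sub>R (indicator {a..s} r * (\<theta> * m t * (exp (- \<kappa> * r) * w r))))
        = (\<lambda>r. indicator {a..s} r *\<^sub>R (\<theta> * m t * (exp (- \<kappa> * r) * w r)))"
        using a by (auto simp: indicator_def)
      have "continuous_on {0..s} (\<lambda>r. exp (- \<kappa> * r) * m r)"
        using s' by (auto intro!: continuous_intros continuous_on_subset[OF m_cont])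
      from set_integrable_continuous_mult[OF this N_int'[OF s']]
      have i2: "integrable lborel (\<lambda>r. indicator {0..s} r *\<^sub>R (exp (- \<kappa> * r) * m r * N r))"
        by (simp add: set_integrable_def)
      show ?thesis
        unfolding set_lebesgue_integral_def
      proof (rule integral_mono_AE)
        show "AE r in lborel. indicator {0..s} r *\<^sub>R (indicator {a..s} r * (\<theta> * m t * (exp (- \<kappa> * r) * w r)))
          \<le> indicator {0..s} r *\<^sub>R (exp (- \<kappa> * r) * m r * N r)"
          using w_le
        proof eventually_elim
          case (elim r)
          show ?case
          proof (cases "r \<in> {a..s}")
            case True
            then have r: "r \<in> {a..t}" using s by auto
            have "(\<theta> * m t) * w r \<le> m r * N r"
              using m[OF r] w_nonneg[OF r] elim r m_pos[of r] a by (intro mult_mono) auto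
            then have "exp (- \<kappa> * r) * ((\<theta> * m t) * w r) \<le> exp (- \<kappa> * r) * (m r * N r)"
              by (intro mult_left_mono) auto
            then show ?thesis using True a by (auto simp: mult_ac)
          next
            case False
            then show ?thesis using N_nonneg[of r] m_pos[of r] s' by (auto simp: indicator_def)
          qed
        qed
      qed (use i1 i2 i1' in auto)
    qed
    also have "\<dots> \<le> exp (- \<kappa> * s) * m s * (W s + \<kappa> * Z s)"
      using weighted_lower[OF s' Z0s] mult_pos_pos[OF lam Z_0] W0 by linarith
    also have "\<dots> \<le> exp (- \<kappa> * s) * m t * (W s + \<kappa> * Z s)"
    proof (intro mult_right_mono mult_left_mono)
      show "m s \<le> m t" using m_mono[of s t] s a by auto
      show "0 \<le> W s + \<kappa> * Z s" by (rule weighted_nonneg[OF s' Z0s])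
    qed simp
    finally have "m t * (\<theta> * ?A s) \<le> m t * (exp (- \<kappa> * s) * (W s + \<kappa> * Z s))"
      by (simp add: mult_ac)
    then have "\<theta> * ?A s \<le> exp (- \<kappa> * s) * (W s + \<kappa> * Z s)" using mt by simp
    then have "exp (2 * \<kappa> * s) * (\<theta> * ?A s) \<le> exp (2 * \<kappa> * s) * (exp (- \<kappa> * s) * (W s + \<kappa> * Z s))"
      by (intro mult_left_mono) auto
    also have "\<dots> = exp (\<kappa> * s) * (W s + \<kappa> * Z s)"
      by (simp add: exp_add[symmetric] mult.assoc[symmetric])
    finally show "\<theta> * exp (2 * \<kappa> * s) * ?A s \<le> exp (\<kappa> * s) * (W s + \<kappa> * Z s)"
      by (simp add: mult_ac)
  qed
  moreover have "?r a = 0" by simp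
  moreover have "0 < exp (\<kappa> * a) * Z a" using Z_pos[of a] a by simp
  ultimately have "?r t \<le> exp (\<kappa> * t) * Z t" by linarith
  then have "exp (- \<kappa> * t) * ?r t \<le> exp (- \<kappa> * t) * (exp (\<kappa> * t) * Z t)"
    by (intro mult_left_mono) auto
  also have "\<dots> = Z t" by (simp add: exp_minus)
  also have "exp (- \<kappa> * t) * ?r t = \<theta> * (exp (\<kappa> * t) / (2 * \<kappa>) * ?A t - exp (- \<kappa> * t) / (2 * \<kappa>) * ?B t)"
  proof -
    have "exp (2 * \<kappa> * t) = exp (\<kappa> * t) * exp (\<kappa> * t)" by (simp add: exp_add[symmetric])
    then show ?thesis using lam by (simp add: exp_minus field_simps)
  qed
  also have "exp (\<kappa> * t) / (2 * \<kappa>) * ?A t - exp (- \<kappa> * t) / (2 * \<kappa>) * ?B t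
    = integral {a..t} (\<lambda>s. exp (\<kappa> * t) / (2 * \<kappa>) * (exp (- \<kappa> * s) * w s) - exp (- \<kappa> * t) / (2 * \<kappa>) * (exp (\<kappa> * s) * w s))"
    by (subst Henstock_Kurzweil_Integration.integral_diff)
      (use lam in \<open>auto intro!: integrable_continuous_real continuous_intros w_cont\<close>)
  also have "\<dots> = integral {a..t} (\<lambda>s. w s * sinh (\<kappa> * (t - s)) / \<kappa>)"
  proof (rule Henstock_Kurzweil_Integration.integral_cong)
    fix s
    have "sinh (\<kappa> * (t - s)) = (exp (\<kappa> * t) * exp (- \<kappa> * s) - exp (- \<kappa> * t) * exp (\<kappa> * s)) / 2"
      by (simp add: sinh_def exp_add[symmetric] algebra_simps)
    then show "exp (\<kappa> * t) / (2 * \<kappa>) * (exp (- \<kappa> * s) * w s) - exp (- \<kappa> * t) / (2 * \<kappa>) * (exp (\<kappa> * s) * w s)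
      = w s * sinh (\<kappa> * (t - s)) / \<kappa>"
      using lam by (simp only:) (simp add: field_simps)
  qed
  finally show ?thesis .
qed

end

section \<open>Localized modes and calculus in local Lebesgue spaces\<close>

lemma gradient_inner_Basis:
  "b \<in> Basis \<Longrightarrow> gradient f x \<bullet> b = frechet_derivative f (at x) b"
  by (simp add: gradient_def inner_sum_left inner_Basis if_distrib sum.delta' cong: if_cong)

text \<open>The mode grows exponentially and is not a test function, so it is cut off outside a
  ball. The cutoff acts in the variable x \<bullet> x, which keeps the product a smooth function of
  x \<bullet> x, and it leaves both mode and Laplacian exact inside the ball.\<close>

lemma exists_localized_mode:
  fixes \<kappa> r :: real
  assumes r: "0 < r"
  shows "\<exists>g :: 'a::euclidean_space \<Rightarrow> real. C_inf g \<and> C_inf (\<lambda>z :: real \<times> 'a. g (snd z)) \<and>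
    (\<forall>x. 0 \<le> g x) \<and> (\<forall>x. g x \<noteq> 0 \<longrightarrow> x \<in> cball 0 (r + 1)) \<and>
    (\<forall>x\<in>ball 0 r. g x = bessel DIM('a) (\<kappa>\<^sup>2 * (x \<bullet> x))) \<and>
    (\<forall>x\<in>ball 0 r. (\<Sum>b\<in>Basis. frechet_derivative (\<lambda>x. frechet_derivative g (at x) b) (at x) b) = \<kappa>\<^sup>2 * g x)"
proof -
  let ?n = "DIM('a)"
  have n: "?n \<ge> 1" using DIM_positive[where 'a = 'a] by linarith
  have "r\<^sup>2 < (r + 1)\<^sup>2" using r by (intro power_strict_mono) auto
  then obtain \<eta> where \<eta>: "C_inf \<eta>" "\<forall>x\<le>r\<^sup>2. \<eta> x = 1" "\<forall>x\<ge>(r + 1)\<^sup>2. \<eta> x = 0"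
      "\<forall>x. 0 \<le> \<eta> x \<and> \<eta> x \<le> (1::real)"
    using exists_smooth_cutoff by blast
  define H where "H y = \<eta> y * bessel ?n (y * \<kappa>\<^sup>2)" for y
  define g where "g x = H (x \<bullet> x)" for x :: 'a
  have CH: "C_inf H"
    unfolding H_def
    by (rule C_inf_mult[OF \<eta>(1) C_inf_compose[OF C_inf_bessel[OF n] C_inf_linear[OF bounded_linear_mult_left]]])
  obtain F' F'' where F: "\<And>y. (bessel ?n has_real_derivative F' y) (at y)"
    "\<And>y. (F' has_real_derivative F'' y) (at y)"
    "\<And>y. 4 * y * F'' y + 2 * real ?n * F' y = bessel ?n y"
    using bessel_ode[OF n] by blast
  have Cg: "C_inf g" unfolding g_def
    by (rule C_inf_compose[OF CH C_inf_inner_self_linear[OF bounded_linear_ident]])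
  have Cg2: "C_inf (\<lambda>z :: real \<times> 'a. g (snd z))" unfolding g_def
    by (rule C_inf_compose[OF CH C_inf_inner_self_linear[OF bounded_linear_snd]])
  have in_ball: "x \<bullet> x \<le> r\<^sup>2" if "x \<in> ball 0 r" for x :: 'a
    using that r by (simp add: power2_norm_eq_inner[symmetric] power_mono)
  have geq: "g x = bessel ?n (\<kappa>\<^sup>2 * (x \<bullet> x))" if "x \<in> ball 0 r" for x :: 'a
    using \<eta>(2) in_ball[OF that] by (simp add: g_def H_def mult.commute)
  have dq: "((\<lambda>x::'a. \<kappa>\<^sup>2 * (x \<bullet> x)) has_derivative (\<lambda>h. \<kappa>\<^sup>2 * (2 * (x \<bullet> h)))) (at x)" for x
    by (auto intro!: derivative_eq_intros simp: inner_commute)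
  have d1: "frechet_derivative g (at x) = (\<lambda>h. F' (\<kappa>\<^sup>2 * (x \<bullet> x)) * (\<kappa>\<^sup>2 * (2 * (x \<bullet> h))))"
    if x: "x \<in> ball 0 r" for x :: 'a
  proof -
    have "((\<lambda>x. bessel ?n (\<kappa>\<^sup>2 * (x \<bullet> x))) has_derivative
        (\<lambda>h. F' (\<kappa>\<^sup>2 * (x \<bullet> x)) * (\<kappa>\<^sup>2 * (2 * (x \<bullet> h))))) (at x)"
      by (rule has_derivative_compose[OF dq F(1)[unfolded has_field_derivative_def]])
    then have "(g has_derivative (\<lambda>h. F' (\<kappa>\<^sup>2 * (x \<bullet> x)) * (\<kappa>\<^sup>2 * (2 * (x \<bullet> h))))) (at x)"
      by (rule has_derivative_transform_within_open[of _ _ _ UNIV "ball 0 r"]) (use x geq in auto)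
    from frechet_derivative_at[OF this] show ?thesis by simp
  qed
  have d2: "frechet_derivative (\<lambda>x. frechet_derivative g (at x) b) (at x) b =
      4 * \<kappa>\<^sup>2 * \<kappa>\<^sup>2 * F'' (\<kappa>\<^sup>2 * (x \<bullet> x)) * (x \<bullet> b)\<^sup>2 + 2 * \<kappa>\<^sup>2 * F' (\<kappa>\<^sup>2 * (x \<bullet> x))"
    if x: "x \<in> ball 0 r" and b: "b \<in> Basis" for x b :: 'a
  proof -
    have "((\<lambda>x. F' (\<kappa>\<^sup>2 * (x \<bullet> x))) has_derivative
        (\<lambda>h. F'' (\<kappa>\<^sup>2 * (x \<bullet> x)) * (\<kappa>\<^sup>2 * (2 * (x \<bullet> h))))) (at x)"
      by (rule has_derivative_compose[OF dq F(2)[unfolded has_field_derivative_def]])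
    moreover have "((\<lambda>x. \<kappa>\<^sup>2 * (2 * (x \<bullet> b))) has_derivative (\<lambda>h. \<kappa>\<^sup>2 * (2 * (h \<bullet> b)))) (at x)"
      by (auto intro!: derivative_eq_intros)
    ultimately have "((\<lambda>x. F' (\<kappa>\<^sup>2 * (x \<bullet> x)) * (\<kappa>\<^sup>2 * (2 * (x \<bullet> b)))) has_derivative
      (\<lambda>h. F' (\<kappa>\<^sup>2 * (x \<bullet> x)) * (\<kappa>\<^sup>2 * (2 * (h \<bullet> b))) +
        F'' (\<kappa>\<^sup>2 * (x \<bullet> x)) * (\<kappa>\<^sup>2 * (2 * (x \<bullet> h))) * (\<kappa>\<^sup>2 * (2 * (x \<bullet> b))))) (at x)"
      by (rule has_derivative_mult)
    then have "((\<lambda>x. frechet_derivative g (at x) b) has_derivative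
      (\<lambda>h. F' (\<kappa>\<^sup>2 * (x \<bullet> x)) * (\<kappa>\<^sup>2 * (2 * (h \<bullet> b))) +
        F'' (\<kappa>\<^sup>2 * (x \<bullet> x)) * (\<kappa>\<^sup>2 * (2 * (x \<bullet> h))) * (\<kappa>\<^sup>2 * (2 * (x \<bullet> b))))) (at x)"
      by (rule has_derivative_transform_within_open[of _ _ _ UNIV "ball 0 r"]) (use x d1 in auto)
    from fun_cong[OF frechet_derivative_at[OF this], of b] b
    have "frechet_derivative (\<lambda>x. frechet_derivative g (at x) b) (at x) b =
      F' (\<kappa>\<^sup>2 * (x \<bullet> x)) * (\<kappa>\<^sup>2 * (2 * 1)) +
        F'' (\<kappa>\<^sup>2 * (x \<bullet> x)) * (\<kappa>\<^sup>2 * (2 * (x \<bullet> b))) * (\<kappa>\<^sup>2 * (2 * (x \<bullet> b)))"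
      by (simp add: inner_same_Basis)
    then show ?thesis by (simp only:) (simp add: power2_eq_square)
  qed
  have lap: "(\<Sum>b\<in>Basis. frechet_derivative (\<lambda>x. frechet_derivative g (at x) b) (at x) b) = \<kappa>\<^sup>2 * g x"
    if x: "x \<in> ball 0 r" for x :: 'a
  proof -
    let ?y = "\<kappa>\<^sup>2 * (x \<bullet> x)"
    have "(\<Sum>b\<in>Basis. frechet_derivative (\<lambda>x. frechet_derivative g (at x) b) (at x) b)
      = (\<Sum>b\<in>Basis. 4 * \<kappa>\<^sup>2 * \<kappa>\<^sup>2 * F'' ?y * (x \<bullet> b)\<^sup>2 + 2 * \<kappa>\<^sup>2 * F' ?y)"
      by (rule sum.cong[OF refl d2[OF x]])
    also have "\<dots> = 4 * \<kappa>\<^sup>2 * \<kappa>\<^sup>2 * F'' ?y * (\<Sum>b\<in>Basis. (x \<bullet> b)\<^sup>2) + real ?n * (2 * \<kappa>\<^sup>2 * F' ?y)"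
      by (simp add: sum.distrib sum_distrib_left)
    also have "(\<Sum>b\<in>Basis. (x \<bullet> b)\<^sup>2) = x \<bullet> x"
      by (simp add: euclidean_inner[of x x] power2_eq_square)
    also have "4 * \<kappa>\<^sup>2 * \<kappa>\<^sup>2 * F'' ?y * (x \<bullet> x) + real ?n * (2 * \<kappa>\<^sup>2 * F' ?y)
      = \<kappa>\<^sup>2 * (4 * ?y * F'' ?y + 2 * real ?n * F' ?y)" by (simp add: algebra_simps)
    finally show ?thesis using F(3)[of ?y] geq[OF x] by simp
  qed
  have supp: "x \<in> cball 0 (r + 1)" if "g x \<noteq> 0" for x :: 'a
  proof (rule ccontr)
    assume "x \<notin> cball 0 (r + 1)"
    then have "(r + 1)\<^sup>2 \<le> (norm x)\<^sup>2" using r by (intro power_mono) auto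
    then have "\<eta> (x \<bullet> x) = 0" using \<eta>(3) by (simp add: power2_norm_eq_inner)
    then show False using that by (simp add: g_def H_def)
  qed
  have "0 \<le> g x" for x
  proof -
    have "1 \<le> bessel ?n (x \<bullet> x * \<kappa>\<^sup>2)" by (rule bessel_ge_1[OF n]) simp
    then show ?thesis using \<eta>(4) by (simp add: g_def H_def)
  qed
  with Cg Cg2 supp geq lap show ?thesis by (intro exI[of _ g]) auto
qed

text \<open>The union that defines \<open>ess_supp\<close> may be uncountable; Lindelof's theorem
  selects countably many of its open sets, and countably many null sets have a null union.\<close>

lemma AE_outside_ess_supp: "AE x in lebesgue. x \<notin> ess_supp f \<longrightarrow> f x = 0"
proof -
  let ?\<U> = "{U. open U \<and> (AE x in lebesgue. x \<in> U \<longrightarrow> f x = 0)}"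
  obtain \<V> where V: "\<V> \<subseteq> ?\<U>" "countable \<V>" "\<Union>\<V> = \<Union>?\<U>"
    using Lindelof[of ?\<U>] by blast
  have "AE x in lebesgue. \<forall>U\<in>\<V>. x \<in> U \<longrightarrow> f x = 0"
    by (subst AE_ball_countable[OF V(2)]) (use V(1) in auto)
  then show ?thesis
  proof eventually_elim
    case (elim x)
    then show ?case unfolding ess_supp_def using V(3) by auto
  qed
qed

section \<open>Pairing local L1 functions with compactly supported continuous functions\<close>

lemma integrable_loc_mult:
  fixes f c :: "'a::euclidean_space \<Rightarrow> real"
  assumes f: "loc_integrable_on f UNIV" and c: "continuous_on UNIV c"
    and K: "compact K" and supp: "\<And>x. c x \<noteq> 0 \<Longrightarrow> x \<in> K"
  shows "integrable lebesgue (\<lambda>x. f x * c x)"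
    and "\<bar>LINT x|lebesgue. f x * c x\<bar> \<le> (SUP x\<in>K. \<bar>c x\<bar>) * (LINT x:K|lebesgue. \<bar>f x\<bar>)"
proof -
  let ?B = "SUP x\<in>K. \<bar>c x\<bar>"
  have cK: "compact ((\<lambda>x. \<bar>c x\<bar>) ` K)"
    by (rule compact_continuous_image[OF _ K])
      (intro continuous_intros continuous_on_subset[OF c] subset_UNIV)
  then have B: "\<bar>c x\<bar> \<le> ?B" if "x \<in> K" for x
    by (intro cSUP_upper that bounded_imp_bdd_above compact_imp_bounded)
  have fK: "integrable lebesgue (\<lambda>x. indicator K x *\<^sub>R f x)"
    using f K by (auto simp: loc_integrable_on_def set_integrable_def)
  have fK': "integrable lebesgue (\<lambda>x. indicator K x *\<^sub>R \<bar>f x\<bar>)"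
    using integrable_abs[OF fK] by (simp add: abs_mult)
  have eq: "f x * c x = (indicator K x *\<^sub>R f x) * c x" for x
    using supp[of x] by (auto simp: indicator_def)
  have le: "\<bar>f x * c x\<bar> \<le> ?B * (indicator K x *\<^sub>R \<bar>f x\<bar>)" for x
  proof (cases "x \<in> K")
    case True
    then show ?thesis using mult_right_mono[OF B[OF True], of "\<bar>f x\<bar>"] by (simp add: abs_mult mult.commute)
  qed (use supp[of x] in auto)
  have [measurable]: "c \<in> borel_measurable lebesgue"
    using borel_measurable_continuous_onI[OF c] by (simp add: measurable_completion)
  have meas: "(\<lambda>x. f x * c x) \<in> borel_measurable lebesgue"
    unfolding eq[abs_def] using borel_measurable_integrable[OF fK] by measurable
  show int: "integrable lebesgue (\<lambda>x. f x * c x)"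
    by (rule Bochner_Integration.integrable_bound[OF integrable_mult_right[OF fK', of ?B] meas])
      (use le order_trans[OF _ abs_ge_self] in \<open>auto intro!: AE_I2\<close>)
  have "\<bar>LINT x|lebesgue. f x * c x\<bar> \<le> (LINT x|lebesgue. \<bar>f x * c x\<bar>)"
    by (rule integral_abs_bound)
  also have "\<dots> \<le> (LINT x|lebesgue. ?B * (indicator K x *\<^sub>R \<bar>f x\<bar>))"
    by (intro integral_mono integrable_abs int integrable_mult_right fK' le)
  finally show "\<bar>LINT x|lebesgue. f x * c x\<bar> \<le> ?B * (LINT x:K|lebesgue. \<bar>f x\<bar>)"
    by (simp add: set_lebesgue_integral_def)
qed

lemma tendsto_integral_loc_mult:
  fixes f :: "'b \<Rightarrow> 'a::euclidean_space \<Rightarrow> real"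
  assumes f: "\<forall>\<^sub>F s in F. loc_integrable_on (f s) UNIV" and c: "continuous_on UNIV c"
    and K: "compact K" and supp: "\<And>x. c x \<noteq> 0 \<Longrightarrow> x \<in> K"
    and lim: "((\<lambda>s. LINT x:K|lebesgue. \<bar>f s x\<bar>) \<longlongrightarrow> 0) F"
  shows "((\<lambda>s. LINT x|lebesgue. f s x * c x) \<longlongrightarrow> 0) F"
proof (rule Lim_null_comparison)
  show "\<forall>\<^sub>F s in F. norm (LINT x|lebesgue. f s x * c x) \<le> (SUP x\<in>K. \<bar>c x\<bar>) * (LINT x:K|lebesgue. \<bar>f s x\<bar>)"
    using f by eventually_elim (simp add: integrable_loc_mult(2)[OF _ c K supp])
  show "((\<lambda>s. (SUP x\<in>K. \<bar>c x\<bar>) * (LINT x:K|lebesgue. \<bar>f s x\<bar>)) \<longlongrightarrow> 0) F"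
    using tendsto_mult_right_zero[OF lim] .
qed

lemma loc_integrable_on_diff:
  "loc_integrable_on f S \<Longrightarrow> loc_integrable_on g S \<Longrightarrow> loc_integrable_on (\<lambda>x. f x - g x) S"
  by (auto simp: loc_integrable_on_def intro!: set_integral_diff)

lemma loc_integrable_on_cmult:
  fixes f :: "'a::euclidean_space \<Rightarrow> real"
  shows "loc_integrable_on f S \<Longrightarrow> loc_integrable_on (\<lambda>x. f x * c) S"
  unfolding loc_integrable_on_def using set_integrable_mult_left by blast

lemma loc_integrable_on_inner:
  "loc_integrable_on f S \<Longrightarrow> loc_integrable_on (\<lambda>x. f x \<bullet> c) S"
  unfolding loc_integrable_on_def set_integrable_def
  using integrable_inner_left[of c lebesgue] by (simp add: inner_scaleR_left[symmetric] del: inner_scaleR_left)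

lemma cont_L1_loc_imp_continuous_on:
  fixes f :: "real \<Rightarrow> 'a::euclidean_space \<Rightarrow> real"
  assumes f: "cont_L1_loc I f" and c: "continuous_on UNIV c"
    and K: "compact K" and supp: "\<And>x. c x \<noteq> 0 \<Longrightarrow> x \<in> K"
  shows "continuous_on I (\<lambda>t. LINT x|lebesgue. f t x * c x)"
  unfolding continuous_on_def
proof
  fix t assume t: "t \<in> I"
  have loc: "loc_integrable_on (f s) UNIV" if "s \<in> I" for s using f that by (simp add: cont_L1_loc_def)
  have ev: "\<forall>\<^sub>F s in at t within I. s \<in> I" by (simp add: eventually_at_filter)
  have "((\<lambda>s. LINT x|lebesgue. (f s x - f t x) * c x) \<longlongrightarrow> 0) (at t within I)"
    by (rule tendsto_integral_loc_mult[OF eventually_mono[OF ev] c K supp])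
      (use f t K loc in \<open>auto simp: cont_L1_loc_def intro!: loc_integrable_on_diff\<close>)
  moreover have "\<forall>\<^sub>F s in at t within I. (LINT x|lebesgue. (f s x - f t x) * c x) =
     (LINT x|lebesgue. f s x * c x) - (LINT x|lebesgue. f t x * c x)"
    using ev
  proof eventually_elim
    case (elim s)
    then show ?case
      using integrable_loc_mult(1)[OF loc[OF elim] c K supp] integrable_loc_mult(1)[OF loc[OF t] c K supp]
      by (simp add: left_diff_distrib)
  qed
  ultimately have "((\<lambda>s. (LINT x|lebesgue. f s x * c x) - (LINT x|lebesgue. f t x * c x)) \<longlongrightarrow> 0) (at t within I)"
    by (rule Lim_transform_eventually)
  then show "((\<lambda>s. LINT x|lebesgue. f s x * c x) \<longlongrightarrow> (LINT x|lebesgue. f t x * c x)) (at t within I)"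
    by (rule LIM_zero_cancel)
qed

text \<open>On the compact \<open>K\<close> the factor \<open>c\<close> is bounded, so L1
  convergence of the difference quotients becomes convergence of scalar difference
  quotients.\<close>

lemma C1_L1_loc_imp_has_derivative:
  fixes u :: "real \<Rightarrow> 'a::euclidean_space \<Rightarrow> real"
  assumes u: "C1_L1_loc I u v" and c: "continuous_on UNIV c"
    and K: "compact K" and supp: "\<And>x. c x \<noteq> 0 \<Longrightarrow> x \<in> K" and t: "t \<in> I"
  shows "((\<lambda>t. LINT x|lebesgue. u t x * c x) has_real_derivative (LINT x|lebesgue. v t x * c x)) (at t within I)"
proof -
  have locu: "loc_integrable_on (u s) UNIV" and locv: "loc_integrable_on (v s) UNIV" if "s \<in> I" for s
    using u that by (simp_all add: C1_L1_loc_def cont_L1_loc_def)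
  have ev: "\<forall>\<^sub>F s in at t within I. s \<in> I \<and> s \<noteq> t" by (simp add: eventually_at_filter)
  have locd: "loc_integrable_on (\<lambda>x. (u s x - u t x) / (s - t) - v t x) UNIV" if "s \<in> I" for s
    using loc_integrable_on_diff[OF loc_integrable_on_cmult[OF loc_integrable_on_diff[OF locu[OF that] locu[OF t]],
        of "1 / (s - t)"] locv[OF t]] by simp
  have "((\<lambda>s. LINT x|lebesgue. ((u s x - u t x) / (s - t) - v t x) * c x) \<longlongrightarrow> 0) (at t within I)"
    by (rule tendsto_integral_loc_mult[OF eventually_mono[OF ev] c K supp])
      (use u t K locd in \<open>auto simp: C1_L1_loc_def\<close>)
  moreover have "\<forall>\<^sub>F s in at t within I. (LINT x|lebesgue. ((u s x - u t x) / (s - t) - v t x) * c x) =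
     ((LINT x|lebesgue. u s x * c x) - (LINT x|lebesgue. u t x * c x)) / (s - t) - (LINT x|lebesgue. v t x * c x)"
    using ev
  proof eventually_elim
    case (elim s)
    have iu: "integrable lebesgue (\<lambda>x. u s x * c x)" "integrable lebesgue (\<lambda>x. u t x * c x)"
      "integrable lebesgue (\<lambda>x. v t x * c x)"
      using elim t by (auto intro!: integrable_loc_mult(1)[OF _ c K supp] locu locv)
    have "(LINT x|lebesgue. ((u s x - u t x) / (s - t) - v t x) * c x) =
      (LINT x|lebesgue. (u s x * c x - u t x * c x) / (s - t) - v t x * c x)"
      by (simp add: left_diff_distrib diff_divide_distrib)
    then show ?case using iu by simp
  qed
  ultimately have "((\<lambda>s. ((LINT x|lebesgue. u s x * c x) - (LINT x|lebesgue. u t x * c x)) / (s - t)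
       - (LINT x|lebesgue. v t x * c x)) \<longlongrightarrow> 0) (at t within I)"
    by (rule Lim_transform_eventually)
  then have "((\<lambda>s. ((LINT x|lebesgue. u s x * c x) - (LINT x|lebesgue. u t x * c x)) / (s - t))
      \<longlongrightarrow> (LINT x|lebesgue. v t x * c x)) (at t within I)"
    by (rule LIM_zero_cancel)
  then show ?thesis by (simp add: has_field_derivative_iff)
qed

lemma set_LINT_lebesgue_eq_LBINT:
  fixes F N :: "real \<Rightarrow> real"
  assumes N: "set_integrable lborel {a..b} N"
    and eq: "AE s in lebesgue. s \<in> {a..b} \<longrightarrow> F s = N s"
  shows "(LINT s:{a..b}|lebesgue. F s) = (LBINT s:{a..b}. N s)"
proof -
  have N': "N absolutely_integrable_on {a..b}"
    using N unfolding set_integrable_def by (rule integrable_completion[THEN iffD2, rotated])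
      (use N in \<open>simp add: set_integrable_def borel_measurable_integrable\<close>)
  from eq have "\<exists>S\<in>null_sets lebesgue. {s \<in> space lebesgue. \<not> (s \<in> {a..b} \<longrightarrow> F s = N s)} \<subseteq> S"
    unfolding eventually_ae_filter .
  then obtain S where S': "S \<in> null_sets lebesgue" "{s \<in> space lebesgue. \<not> (s \<in> {a..b} \<longrightarrow> F s = N s)} \<subseteq> S"
    by (elim bexE)
  have S: "negligible S" using S'(1) by (simp add: negligible_iff_null_sets)
  have eqS: "F s = N s" if "s \<in> {a..b} - S" for s using S'(2) that by auto
  have F': "F absolutely_integrable_on {a..b}"
    by (rule absolutely_integrable_spike[OF N' S eqS])
  have "(LINT s:{a..b}|lebesgue. F s) = integral {a..b} F"
    by (rule set_lebesgue_integral_eq_integral(2)[OF F'])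
  also have "\<dots> = integral {a..b} N"
    by (rule integral_spike[OF S]) (use eqS in auto)
  also have "\<dots> = (LBINT s:{a..b}. N s)"
    by (rule set_borel_integral_eq_integral(2)[OF N, symmetric])
  finally show ?thesis .
qed

section \<open>Modes of a weak solution\<close>

text \<open>Fubini for the product of Borel measures requires a Borel function, while local
  integrability refers to the completed measure. \<open>H\<close> is a Borel version on a compact
  cylinder; taking an absolute value makes it nonnegative everywhere, not just almost
  everywhere.\<close>

lemma loc_integrable_prod_representative:
  fixes f :: "real \<Rightarrow> 'a::euclidean_space \<Rightarrow> real"
  assumes f: "loc_integrable_on (\<lambda>(t, x). f t x) (I \<times> UNIV)" and I: "{0..\<tau>} \<subseteq> I"
    and K: "compact K" and f0: "\<And>t x. 0 \<le> f t x"
  obtains H :: "real \<times> 'a \<Rightarrow> real" where "integrable (lborel \<Otimes>\<^sub>M lborel) H" "\<And>z. 0 \<le> H z"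
    "AE s in lborel. AE x in lborel. indicator ({0..\<tau>} \<times> K) (s, x) * f s x = H (s, x)"
proof -
  let ?h = "\<lambda>z. indicator ({0..\<tau>} \<times> K) z *\<^sub>R (case z of (t, x) \<Rightarrow> f t x)"
  have "compact ({0..\<tau>} \<times> K)" by (intro compact_Times compact_Icc K)
  moreover have "{0..\<tau>} \<times> K \<subseteq> I \<times> UNIV" using I by auto
  ultimately have "set_integrable lebesgue ({0..\<tau>} \<times> K) (\<lambda>(t, x). f t x)"
    using f unfolding loc_integrable_on_def by blast
  then have h: "integrable lebesgue ?h" by (simp add: set_integrable_def)
  obtain H where H: "H \<in> borel_measurable lborel" "AE z in lborel. ?h z = H z"
    using completion_ex_borel_measurable_real[OF borel_measurable_integrable[OF h]] by blast
  have H': "(\<lambda>z. \<bar>H z\<bar>) \<in> borel_measurable lborel" using H(1) by measurable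
  have ae: "AE z in lborel. ?h z = \<bar>H z\<bar>"
    using H(2)
  proof eventually_elim
    case (elim z)
    have "0 \<le> ?h z" using f0 by (auto simp: indicator_def split: prod.splits)
    then show ?case using elim by simp
  qed
  have "integrable lebesgue (\<lambda>z. \<bar>H z\<bar>)"
    by (rule integrable_cong_AE_imp[OF h]) (use H' AE_completion[OF ae] in \<open>auto simp: measurable_completion\<close>)
  then have int: "integrable lborel (\<lambda>z. \<bar>H z\<bar>)" using integrable_completion[OF H'] by blast
  show thesis
  proof
    show "integrable (lborel \<Otimes>\<^sub>M lborel) (\<lambda>z. \<bar>H z\<bar>)" using int by (simp only: lborel_prod)
    have "AE z in (lborel \<Otimes>\<^sub>M lborel). ?h z = \<bar>H z\<bar>" using ae by (simp only: lborel_prod)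
    from lborel_pair.AE_pair[OF this]
    show "AE s in lborel. AE x in lborel. indicator ({0..\<tau>} \<times> K) (s, x) * f s x = \<bar>H (s, x)\<bar>"
      by simp
  qed simp
qed

text \<open>A weak solution with time derivative \<open>v\<close> and gradient \<open>G\<close>
  fixed, studied on a closed window [0, \<tau>] strictly inside [0, T). The damping enters through
  \<open>b\<close> and an integrating factor \<open>m\<close>, so the iterated logarithms stay out
  of this part.\<close>

locale damped_wave_solution =
  fixes u v :: "real \<Rightarrow> 'a::euclidean_space \<Rightarrow> real" and G :: "real \<Rightarrow> 'a \<Rightarrow> 'a"
    and b m :: "real \<Rightarrow> real" and u0 u1 :: "'a \<Rightarrow> real" and p \<epsilon> R \<tau> :: real and T :: ereal
  assumes tau: "0 < \<tau>" "ereal \<tau> < T" and R: "0 < R" and eps: "0 < \<epsilon>" and p: "1 < p"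
    and cW: "cont_W11_loc (time_interval T) u G"
    and cC: "C1_L1_loc (time_interval T) u v"
    and locf: "loc_integrable_on (\<lambda>(t, x). \<bar>u t x\<bar> powr p) (time_interval T \<times> UNIV)"
    and supp: "\<And>t. 0 < t \<Longrightarrow> ereal t < T \<Longrightarrow> ess_supp (u t) \<subseteq> cball 0 (R + t)"
    and init: "AE x in lebesgue. u 0 x = \<epsilon> * u0 x"
    and weak: "\<And>t \<psi>. 0 < t \<Longrightarrow> ereal t < T \<Longrightarrow> spacetime_test_function T \<psi> \<Longrightarrow>
           (LINT s:{0..t}|lebesgue. (LINT x|lebesgue.
               - v s x * deriv (\<lambda>r. \<psi> (r, x)) s
               + G s x \<bullet> gradient (\<lambda>y. \<psi> (s, y)) x
               + b s * v s x * \<psi> (s, x)))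
           + (LINT x|lebesgue. v t x * \<psi> (t, x))
           = \<epsilon> * (LINT x|lebesgue. u1 x * \<psi> (0, x))
           + (LINT s:{0..t}|lebesgue. (LINT x|lebesgue. \<bar>u s x\<bar> powr p * \<psi> (s, x)))"
    and u0_loc: "loc_integrable_on u0 UNIV"
    and u0_nonneg: "AE x in lebesgue. 0 \<le> u0 x" and u1_nonneg: "AE x in lebesgue. 0 \<le> u1 x"
    and u0_nonzero: "\<not> (AE x in lebesgue. u0 x = 0)"
    and supp0: "ess_supp u0 \<subseteq> cball 0 R"
    and b_cont: "continuous_on {0..\<tau>} b" and b_nonneg: "\<And>s. s \<in> {0..\<tau>} \<Longrightarrow> 0 \<le> b s"
    and m_deriv: "\<And>s. s \<in> {0..\<tau>} \<Longrightarrow> (m has_real_derivative b s * m s) (at s within {0..\<tau>})"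
    and m_0: "m 0 = 1" and m_pos: "\<And>s. s \<in> {0..\<tau>} \<Longrightarrow> 0 < m s"
begin

definition "K = cball (0::'a) (R + \<tau> + 2)"

text \<open>The radius R + \<tau> + 1 puts every support ball of \<open>u t\<close> with t \<le>
  \<tau> inside the open ball where the mode and its Laplacian are exact.\<close>

definition cutoff_mode :: "real \<Rightarrow> 'a \<Rightarrow> real" where
  "cutoff_mode \<kappa> = (SOME g. C_inf g \<and> C_inf (\<lambda>z :: real \<times> 'a. g (snd z)) \<and>
    (\<forall>x. 0 \<le> g x) \<and> (\<forall>x. g x \<noteq> 0 \<longrightarrow> x \<in> cball 0 (R + \<tau> + 1 + 1)) \<and>
    (\<forall>x\<in>ball 0 (R + \<tau> + 1). g x = bessel DIM('a) (\<kappa>\<^sup>2 * (x \<bullet> x))) \<and>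
    (\<forall>x\<in>ball 0 (R + \<tau> + 1). (\<Sum>b\<in>Basis. frechet_derivative (\<lambda>x. frechet_derivative g (at x) b) (at x) b) = \<kappa>\<^sup>2 * g x))"

lemma K_compact: "compact K" by (simp add: K_def)

lemma
  shows g_smooth: "C_inf (cutoff_mode \<kappa>)" and g_smooth_snd: "C_inf (\<lambda>z :: real \<times> 'a. cutoff_mode \<kappa> (snd z))"
    and g_nonneg: "0 \<le> cutoff_mode \<kappa> x" and g_supp: "cutoff_mode \<kappa> x \<noteq> 0 \<Longrightarrow> x \<in> K"
    and g_eq: "x \<in> ball 0 (R + \<tau> + 1) \<Longrightarrow> cutoff_mode \<kappa> x = bessel DIM('a) (\<kappa>\<^sup>2 * (x \<bullet> x))"
    and g_laplace: "x \<in> ball 0 (R + \<tau> + 1) \<Longrightarrow>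
      (\<Sum>b\<in>Basis. frechet_derivative (\<lambda>x. frechet_derivative (cutoff_mode \<kappa>) (at x) b) (at x) b) = \<kappa>\<^sup>2 * cutoff_mode \<kappa> x"
proof -
  have "0 < R + \<tau> + 1" using R tau by simp
  note * = someI_ex[OF exists_localized_mode[OF this, of \<kappa>, where 'a = 'a], folded cutoff_mode_def]
  show "C_inf (cutoff_mode \<kappa>)" "C_inf (\<lambda>z :: real \<times> 'a. cutoff_mode \<kappa> (snd z))"
    "0 \<le> cutoff_mode \<kappa> x" using * by blast+
  show "cutoff_mode \<kappa> x \<noteq> 0 \<Longrightarrow> x \<in> K" using * by (simp add: K_def add.assoc)
  show "x \<in> ball 0 (R + \<tau> + 1) \<Longrightarrow> cutoff_mode \<kappa> x = bessel DIM('a) (\<kappa>\<^sup>2 * (x \<bullet> x))" using * by blast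
  show "x \<in> ball 0 (R + \<tau> + 1) \<Longrightarrow>
      (\<Sum>b\<in>Basis. frechet_derivative (\<lambda>x. frechet_derivative (cutoff_mode \<kappa>) (at x) b) (at x) b) = \<kappa>\<^sup>2 * cutoff_mode \<kappa> x"
    using * by blast
qed

lemma g_cont: "continuous_on UNIV (cutoff_mode \<kappa>)"
  by (rule C_inf_continuous[OF g_smooth])

lemma g_bounded:
  obtains B where "\<And>x. \<bar>cutoff_mode \<kappa> x\<bar> \<le> \<bar>B\<bar>"
proof -
  have "compact (cutoff_mode \<kappa> ` K)"
    by (rule compact_continuous_image[OF continuous_on_subset[OF g_cont] K_compact]) simp
  then obtain B where B: "\<And>y. y \<in> cutoff_mode \<kappa> ` K \<Longrightarrow> norm y \<le> B"
    using compact_imp_bounded bounded_iff by metis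
  have "\<bar>cutoff_mode \<kappa> x\<bar> \<le> \<bar>B\<bar>" for x
    using B[of "cutoff_mode \<kappa> x"] g_supp[of \<kappa> x] by (cases "cutoff_mode \<kappa> x = 0") auto
  then show thesis by (rule that)
qed

lemma g_ge_1: "x \<in> ball 0 (R + \<tau> + 1) \<Longrightarrow> 1 \<le> cutoff_mode \<kappa> x"
  using bessel_ge_1[of "DIM('a)" "\<kappa>\<^sup>2 * (x \<bullet> x)"] DIM_positive[where 'a = 'a] by (simp add: g_eq Suc_le_eq)

definition Z :: "real \<Rightarrow> real \<Rightarrow> real" where
  "Z \<kappa> t = (LINT x|lebesgue. u t x * cutoff_mode \<kappa> x)"

definition W :: "real \<Rightarrow> real \<Rightarrow> real" where
  "W \<kappa> t = (LINT x|lebesgue. v t x * cutoff_mode \<kappa> x)"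

lemma in_time: "t \<in> {0..\<tau>} \<Longrightarrow> t \<in> time_interval T"
  using tau by (auto simp: time_interval_def intro: le_less_trans[of "ereal t" "ereal \<tau>"])

lemma u_loc: "t \<in> {0..\<tau>} \<Longrightarrow> loc_integrable_on (u t) UNIV"
  and v_loc: "t \<in> {0..\<tau>} \<Longrightarrow> loc_integrable_on (v t) UNIV"
  and G_loc: "t \<in> {0..\<tau>} \<Longrightarrow> loc_integrable_on (G t) UNIV"
  using cC cW in_time by (auto simp: C1_L1_loc_def cont_W11_loc_def cont_L1_loc_def)

lemma u_zero:
  assumes "t \<in> {0..\<tau>}"
  shows "AE x in lebesgue. x \<notin> cball 0 (R + t) \<longrightarrow> u t x = 0"
proof (cases "t = 0")
  case True
  show ?thesis
    using AE_outside_ess_supp[of u0] init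
    by eventually_elim (use supp0 True in auto)
next
  case False
  then have "ess_supp (u t) \<subseteq> cball 0 (R + t)"
    using assms in_time[OF assms] by (intro supp) (auto simp: time_interval_def)
  then show ?thesis
    using AE_outside_ess_supp[of "u t"] by (auto elim!: eventually_mono)
qed

lemma Z_deriv: "t \<in> {0..\<tau>} \<Longrightarrow> (Z \<kappa> has_real_derivative W \<kappa> t) (at t within {0..\<tau>})"
  unfolding Z_def[abs_def] W_def
  by (rule DERIV_subset[OF C1_L1_loc_imp_has_derivative[OF cC g_cont K_compact g_supp]])
    (use in_time in auto)

lemma W_cont: "continuous_on {0..\<tau>} (W \<kappa>)"
  unfolding W_def[abs_def]
  by (rule continuous_on_subset[OF cont_L1_loc_imp_continuous_on[OF _ g_cont K_compact g_supp]])
    (use cC in_time in \<open>auto simp: C1_L1_loc_def\<close>)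

text \<open>The weak gradient is tested with each partial derivative of the cut mode, which is again
  a test function. The resulting Laplacian equals \<kappa>^2 times the mode on the support ball of
  \<open>u t\<close>, and outside it \<open>u t\<close> vanishes almost everywhere.\<close>

lemma elliptic_term:
  assumes t: "t \<in> {0..\<tau>}"
  shows "integrable lebesgue (\<lambda>x. G t x \<bullet> gradient (cutoff_mode \<kappa>) x)"
    and "(LINT x|lebesgue. G t x \<bullet> gradient (cutoff_mode \<kappa>) x) = - \<kappa>\<^sup>2 * Z \<kappa> t"
proof -
  let ?g = "cutoff_mode \<kappa>"
  let ?d = "\<lambda>b x. frechet_derivative ?g (at x) b"
  let ?dd = "\<lambda>b x. frechet_derivative (?d b) (at x) b"
  have Cd: "C_inf (?d b)" and Cdd: "C_inf (?dd b)" if "b \<in> Basis" for b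
    using that by (auto intro: C_inf_frechet g_smooth)
  have sd: "x \<in> K" if "?d b x \<noteq> 0" for b x
    using frechet_derivative_eq_0_outside[of ?g K x b] g_supp that compact_imp_closed[OF K_compact] by blast
  have sdd: "x \<in> K" if "?dd b x \<noteq> 0" for b x
    using frechet_derivative_eq_0_outside[of "?d b" K x b] sd that compact_imp_closed[OF K_compact] by blast
  have intG: "integrable lebesgue (\<lambda>x. (G t x \<bullet> b) * ?d b x)" if "b \<in> Basis" for b
    by (rule integrable_loc_mult(1)[OF loc_integrable_on_inner[OF G_loc[OF t]] C_inf_continuous[OF Cd[OF that]] K_compact sd])
  have intu: "integrable lebesgue (\<lambda>x. u t x * ?dd b x)" if "b \<in> Basis" for b
    by (rule integrable_loc_mult(1)[OF u_loc[OF t] C_inf_continuous[OF Cdd[OF that]] K_compact sdd])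
  have eq: "G t x \<bullet> gradient ?g x = (\<Sum>b\<in>Basis. (G t x \<bullet> b) * ?d b x)" for x
    by (simp add: gradient_def inner_sum_right mult.commute)
  show "integrable lebesgue (\<lambda>x. G t x \<bullet> gradient ?g x)"
    unfolding eq by (rule Bochner_Integration.integrable_sum) (rule intG)
  have wg: "weak_gradient (u t) (G t)" using cW in_time[OF t] by (simp add: cont_W11_loc_def)
  have "(LINT x|lebesgue. G t x \<bullet> gradient ?g x) = (\<Sum>b\<in>Basis. LINT x|lebesgue. (G t x \<bullet> b) * ?d b x)"
    unfolding eq by (rule Bochner_Integration.integral_sum) (rule intG)
  also have "\<dots> = (\<Sum>b\<in>Basis. - (LINT x|lebesgue. u t x * ?dd b x))"
  proof (rule sum.cong[OF refl])
    fix b :: 'a assume b: "b \<in> Basis"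
    have "test_function (?d b)" by (rule test_functionI(1)[OF Cd[OF b] sd K_compact])
    then have "(LINT x|lebesgue. u t x * (gradient (?d b) x \<bullet> b)) = - (LINT x|lebesgue. (G t x \<bullet> b) * ?d b x)"
      using wg b unfolding weak_gradient_def by blast
    then show "(LINT x|lebesgue. (G t x \<bullet> b) * ?d b x) = - (LINT x|lebesgue. u t x * ?dd b x)"
      using b by (simp add: gradient_inner_Basis)
  qed
  also have "\<dots> = - (LINT x|lebesgue. (\<Sum>b\<in>Basis. u t x * ?dd b x))"
    by (subst Bochner_Integration.integral_sum) (auto intro: intu simp: sum_negf)
  also have "(LINT x|lebesgue. (\<Sum>b\<in>Basis. u t x * ?dd b x)) = (LINT x|lebesgue. \<kappa>\<^sup>2 * (u t x * ?g x))"
  proof (rule integral_cong_AE)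
    show "(\<lambda>x. \<Sum>b\<in>Basis. u t x * ?dd b x) \<in> borel_measurable lebesgue"
      by (intro borel_measurable_sum borel_measurable_integrable intu)
    have "integrable lebesgue (\<lambda>x. u t x * ?g x)"
      by (rule integrable_loc_mult(1)[OF u_loc[OF t] g_cont K_compact g_supp])
    then show "(\<lambda>x. \<kappa>\<^sup>2 * (u t x * ?g x)) \<in> borel_measurable lebesgue"
      by (intro borel_measurable_times borel_measurable_integrable) auto
    show "AE x in lebesgue. (\<Sum>b\<in>Basis. u t x * ?dd b x) = \<kappa>\<^sup>2 * (u t x * ?g x)"
      using u_zero[OF t]
    proof eventually_elim
      case (elim x)
      show ?case
      proof (cases "x \<in> cball 0 (R + t)")
        case True
        then have "x \<in> ball 0 (R + \<tau> + 1)" using t by auto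
        from g_laplace[OF this, of \<kappa>] show ?thesis by (simp add: sum_distrib_left[symmetric])
      qed (use elim in simp)
    qed
  qed
  finally show "(LINT x|lebesgue. G t x \<bullet> gradient ?g x) = - \<kappa>\<^sup>2 * Z \<kappa> t"
    by (simp add: Z_def)
qed

text \<open>The mode is independent of time, whereas test functions need compact support in time
  below T. Time cutoffs that equal 1 near [0, \<tau>] keep \<psi> stationary there, so the term with
  the time derivative of \<psi> disappears.\<close>

lemma mode_identity:
  assumes t: "t \<in> {0<..\<tau>}"
  shows "W \<kappa> t + (LBINT s:{0..t}. b s * W \<kappa> s - \<kappa>\<^sup>2 * Z \<kappa> s) = \<epsilon> * (LINT x|lebesgue. u1 x * cutoff_mode \<kappa> x)
    + (LINT s:{0..t}|lebesgue. (LINT x|lebesgue. \<bar>u s x\<bar> powr p * cutoff_mode \<kappa> x))"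
proof -
  let ?g = "cutoff_mode \<kappa>"
  obtain z where z: "ereal \<tau> < ereal z" "ereal z < T" using ereal_dense2[OF tau(2)] by blast
  then have z': "\<tau> < z" by simp
  define \<delta> where "\<delta> = (z - \<tau>) / 2"
  have \<delta>: "0 < \<delta>" "\<tau> + \<delta> < z" using z' by (auto simp: \<delta>_def field_simps)
  obtain \<eta>1 where e1: "C_inf \<eta>1" "\<forall>x\<le>\<tau> + \<delta>. \<eta>1 x = 1" "\<forall>x\<ge>z. \<eta>1 x = (0::real)"
    using exists_smooth_cutoff[OF \<delta>(2)] by blast
  obtain \<eta>2 :: "real \<Rightarrow> real" where e2: "C_inf \<eta>2" "\<forall>x\<le>1. \<eta>2 x = 1" "\<forall>x\<ge>2. \<eta>2 x = (0::real)"
    using exists_smooth_cutoff[of 1 2] by auto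
  \<comment> \<open>\<open>\<eta>1\<close> ends the support before T. \<open>\<eta>2\<close>,
    applied to the reflected time, ends it at time -2 and equals 1 after -1, so the derivative of
    \<psi> at time 0 is not affected.\<close>
  define \<psi> where "\<psi> z = \<eta>1 (fst z) * \<eta>2 (- fst z) * ?g (snd z)" for z :: "real \<times> 'a"
  have C\<psi>: "C_inf \<psi>" unfolding \<psi>_def
    by (rule C_inf_mult[OF C_inf_mult[OF C_inf_compose[OF e1(1) C_inf_linear[OF bounded_linear_fst]]
        C_inf_compose[OF e2(1) C_inf_linear[OF bounded_linear_minus[OF bounded_linear_fst]]]] g_smooth_snd])
  have s\<psi>: "y \<in> {-2..z} \<times> K" if "\<psi> y \<noteq> 0" for y
  proof -
    have "\<eta>1 (fst y) \<noteq> 0" "\<eta>2 (- fst y) \<noteq> 0" "?g (snd y) \<noteq> 0" using that by (auto simp: \<psi>_def)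
    then have "fst y < z" "- fst y < 2" "snd y \<in> K"
      using e1(3) e2(3) g_supp by (meson not_less)+
    then show ?thesis by (cases y) auto
  qed
  have cK: "compact ({-2..z} \<times> K)" by (intro compact_Times compact_Icc K_compact)
  have "spacetime_test_function T \<psi>"
    unfolding spacetime_test_function_def
  proof
    show "test_function \<psi>" by (rule test_functionI(1)[OF C\<psi> s\<psi> cK])
    have "closure {z. \<psi> z \<noteq> 0} \<subseteq> {-2..z} \<times> K" by (rule test_functionI(2)[OF C\<psi> s\<psi> cK])
    also have "\<dots> \<subseteq> {(s, x). ereal s < T}"
      using z(2) by (auto intro: le_less_trans[of "ereal _" "ereal z"])
    finally show "closure {z. \<psi> z \<noteq> 0} \<subseteq> {(s, x). ereal s < T}" .
  qed
  note id = weak[OF _ _ this, of t]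
  have \<psi>1: "\<psi> (s, x) = ?g x" if "s \<in> {-1..\<tau> + \<delta>}" for s x
    using that e1(2) e2(2) by (simp add: \<psi>_def)
  have \<psi>d: "deriv (\<lambda>r. \<psi> (r, x)) s = 0" if "s \<in> {0..\<tau>}" for s x
  proof (rule DERIV_imp_deriv, rule has_field_derivative_transform_within_open[of "\<lambda>_. ?g x" 0 s "{-1<..<\<tau> + \<delta>}"])
    show "?g x = \<psi> (y, x)" if "y \<in> {-1<..<\<tau> + \<delta>}" for y using \<psi>1[of y x] that by auto
  qed (use that \<delta> in auto)
  have inner: "(LINT x|lebesgue. - v s x * deriv (\<lambda>r. \<psi> (r, x)) s + G s x \<bullet> gradient (\<lambda>y. \<psi> (s, y)) x
               + b s * v s x * \<psi> (s, x)) = b s * W \<kappa> s - \<kappa>\<^sup>2 * Z \<kappa> s" if s: "s \<in> {0..t}" for s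
  proof -
    have s': "s \<in> {0..\<tau>}" "s \<in> {-1..\<tau> + \<delta>}" using s t \<delta> by auto
    have "(\<lambda>y. \<psi> (s, y)) = ?g" using \<psi>1[OF s'(2)] by auto
    then have "(LINT x|lebesgue. - v s x * deriv (\<lambda>r. \<psi> (r, x)) s + G s x \<bullet> gradient (\<lambda>y. \<psi> (s, y)) x
               + b s * v s x * \<psi> (s, x)) = (LINT x|lebesgue. G s x \<bullet> gradient ?g x + b s * (v s x * ?g x))"
      using \<psi>1[OF s'(2)] \<psi>d[OF s'(1)] by (simp add: mult.assoc)
    also have "\<dots> = - \<kappa>\<^sup>2 * Z \<kappa> s + b s * W \<kappa> s"
      using elliptic_term[OF s'(1), of \<kappa>] integrable_loc_mult(1)[OF v_loc[OF s'(1)] g_cont[of \<kappa>] K_compact g_supp[of \<kappa>]]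
      by (simp add: W_def)
    finally show ?thesis by simp
  qed
  have cont: "continuous_on {0..t} (\<lambda>s. b s * W \<kappa> s - \<kappa>\<^sup>2 * Z \<kappa> s)"
    by (rule continuous_on_subset[of "{0..\<tau>}"], intro continuous_intros b_cont W_cont DERIV_continuous_on[OF Z_deriv])
      (use t in auto)
  have "ereal t < T" using in_time[of t] t by (simp add: time_interval_def)
  have "(LINT s:{0..t}|lebesgue. (LINT x|lebesgue. - v s x * deriv (\<lambda>r. \<psi> (r, x)) s
      + G s x \<bullet> gradient (\<lambda>y. \<psi> (s, y)) x + b s * v s x * \<psi> (s, x)))
      = (LBINT s:{0..t}. b s * W \<kappa> s - \<kappa>\<^sup>2 * Z \<kappa> s)"
    by (rule set_LINT_lebesgue_eq_LBINT[OF borel_integrable_atLeastAtMost'[OF cont]]) (use inner in simp)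
  moreover have "(LINT s:{0..t}|lebesgue. (LINT x|lebesgue. \<bar>u s x\<bar> powr p * \<psi> (s, x)))
     = (LINT s:{0..t}|lebesgue. (LINT x|lebesgue. \<bar>u s x\<bar> powr p * ?g x))"
    by (rule set_lebesgue_integral_cong) (use \<psi>1 t \<delta> in auto)
  moreover have "\<psi> (t, x) = ?g x" "\<psi> (0, x) = ?g x" for x using \<psi>1 t \<delta> by auto
  ultimately show ?thesis using id t \<open>ereal t < T\<close> by (simp add: W_def)
qed

section \<open>Initial data and the differential equation of each mode\<close>

definition initial_mass :: real where
  "initial_mass = (LINT x:cball 0 R|lebesgue. u0 x)"

lemma u0_ball: "integrable lebesgue (\<lambda>x. indicator (cball 0 R) x *\<^sub>R u0 x)"
  using u0_loc by (auto simp: loc_integrable_on_def set_integrable_def)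

lemma u0_zero: "AE x in lebesgue. x \<notin> cball 0 R \<longrightarrow> u0 x = 0"
  using AE_outside_ess_supp[of u0] by eventually_elim (use supp0 in auto)

lemma initial_mass_pos: "0 < initial_mass"
proof -
  have ae: "AE x in lebesgue. 0 \<le> indicator (cball 0 R) x *\<^sub>R u0 x"
    using u0_nonneg by eventually_elim (auto simp: indicator_def)
  have "initial_mass \<noteq> 0"
  proof
    assume "initial_mass = 0"
    then have "AE x in lebesgue. indicator (cball 0 R) x *\<^sub>R u0 x = 0"
      unfolding initial_mass_def set_lebesgue_integral_def
      using integral_nonneg_eq_0_iff_AE[OF u0_ball ae] by blast
    then have "AE x in lebesgue. u0 x = 0"
      using u0_zero by eventually_elim (auto simp: indicator_def split: if_splits)
    then show False using u0_nonzero by blast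
  qed
  moreover have "0 \<le> initial_mass"
    unfolding initial_mass_def set_lebesgue_integral_def using ae by (rule integral_nonneg_AE)
  ultimately show ?thesis by simp
qed

text \<open>Every mode is at least 1 on the support of the data, so one constant bounds all
  \<open>Z \<kappa> 0\<close> from below, whatever \<kappa>.\<close>

lemma Z_0: "\<epsilon> * initial_mass \<le> Z \<kappa> 0"
proof -
  have iu: "integrable lebesgue (\<lambda>x. u 0 x * cutoff_mode \<kappa> x)"
    using integrable_loc_mult(1)[OF u_loc g_cont K_compact g_supp, of 0] tau by simp
  have "\<epsilon> * initial_mass = (LINT x|lebesgue. \<epsilon> * (indicator (cball 0 R) x *\<^sub>R u0 x))"
    by (simp add: initial_mass_def set_lebesgue_integral_def)
  also have "\<dots> \<le> Z \<kappa> 0"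
    unfolding Z_def
  proof (rule integral_mono_AE[OF integrable_mult_right[OF u0_ball] iu])
    show "AE x in lebesgue. \<epsilon> * (indicator (cball 0 R) x *\<^sub>R u0 x) \<le> u 0 x * cutoff_mode \<kappa> x"
      using init u0_nonneg
    proof eventually_elim
      case (elim x)
      show ?case
      proof (cases "x \<in> cball 0 R")
        case True
        then have "1 \<le> cutoff_mode \<kappa> x" using tau R by (intro g_ge_1) auto
        then have "\<epsilon> * u0 x * 1 \<le> \<epsilon> * u0 x * cutoff_mode \<kappa> x"
          using elim eps by (intro mult_left_mono) auto
        then show ?thesis using True elim by simp
      qed (use elim eps g_nonneg[of \<kappa> x] in auto)
    qed
  qed
  finally show ?thesis .
qed

definition W_init :: "real \<Rightarrow> real" where
  "W_init \<kappa> = \<epsilon> * (LINT x|lebesgue. u1 x * cutoff_mode \<kappa> x)"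

lemma W_init_nonneg: "0 \<le> W_init \<kappa>"
proof -
  have "0 \<le> (LINT x|lebesgue. u1 x * cutoff_mode \<kappa> x)"
    by (rule integral_nonneg_AE)
      (use u1_nonneg in eventually_elim, simp add: g_nonneg)
  then show ?thesis using eps by (simp add: W_init_def)
qed

text \<open>The inner Lebesgue integrals of the weak form are replaced by integrals of the Borel
  version \<open>H\<close>; by Fubini these form an integrable function of time, which can serve as
  the forcing.\<close>

lemma damped_modeI:
  fixes H :: "real \<times> 'a \<Rightarrow> real"
  assumes k: "0 < \<kappa>" and H: "integrable (lborel \<Otimes>\<^sub>M lborel) H" and H0: "\<And>z. 0 \<le> H z"
    and HN: "AE s in lborel. AE x in lborel. indicator ({0..\<tau>} \<times> K) (s, x) * \<bar>u s x\<bar> powr p = H (s, x)"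
  shows "damped_mode \<tau> \<kappa> b m (Z \<kappa>) (W \<kappa>) (\<lambda>s. LBINT x. H (s, x) * cutoff_mode \<kappa> x) (W_init \<kappa>)"
proof
  let ?g = "cutoff_mode \<kappa>"
  let ?N = "\<lambda>s. LBINT x. H (s, x) * ?g x"
  have gb[measurable]: "?g \<in> borel_measurable borel" using g_cont by (rule borel_measurable_continuous_onI)
  have [measurable]: "H \<in> borel_measurable (borel \<Otimes>\<^sub>M borel)" using borel_measurable_integrable[OF H] by simp
  obtain B where gB: "\<And>x. \<bar>?g x\<bar> \<le> \<bar>B\<bar>" using g_bounded[of \<kappa>] by blast
  have "integrable (lborel \<Otimes>\<^sub>M lborel) (\<lambda>z. H z * ?g (snd z))"
  proof (rule Bochner_Integration.integrable_bound[OF integrable_mult_right[OF H, of "\<bar>B\<bar>"]])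
    show "(\<lambda>z. H z * ?g (snd z)) \<in> borel_measurable (lborel \<Otimes>\<^sub>M lborel)" by measurable
    have "\<bar>H z\<bar> * \<bar>?g (snd z)\<bar> \<le> \<bar>H z\<bar> * \<bar>B\<bar>" for z by (intro mult_left_mono gB) simp
    then show "AE z in lborel \<Otimes>\<^sub>M lborel. norm (H z * ?g (snd z)) \<le> norm (\<bar>B\<bar> * H z)"
      by (intro AE_I2) (simp add: abs_mult mult.commute)
  qed
  from lborel_pair.integrable_fst'[OF this] have N_int: "integrable lborel ?N" by simp
  then show N_set: "set_integrable lborel {0..\<tau>} ?N"
    unfolding set_integrable_def by (intro integrable_mult_indicator) auto
  show "0 \<le> ?N s" for s
    by (rule Bochner_Integration.integral_nonneg) (simp add: H0 g_nonneg)
  have Neq: "AE s in lborel. s \<in> {0..\<tau>} \<longrightarrow> (LINT x|lebesgue. \<bar>u s x\<bar> powr p * ?g x) = ?N s"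
    using HN
  proof eventually_elim
    case (elim s)
    show ?case
    proof
      assume s: "s \<in> {0..\<tau>}"
      have [measurable]: "(\<lambda>x. indicator K x *\<^sub>R u s x) \<in> borel_measurable lebesgue"
        using u_loc[OF s] K_compact by (auto simp: loc_integrable_on_def set_integrable_def)
      have [measurable]: "?g \<in> borel_measurable lebesgue" using gb by (simp add: measurable_completion)
      have "(\<lambda>x. \<bar>indicator K x *\<^sub>R u s x\<bar> powr p * ?g x) \<in> borel_measurable lebesgue" by measurable
      also have "(\<lambda>x. \<bar>indicator K x *\<^sub>R u s x\<bar> powr p * ?g x) = (\<lambda>x. \<bar>u s x\<bar> powr p * ?g x)"
        using g_supp by (auto simp: indicator_def fun_eq_iff)
      finally have m1: "(\<lambda>x. \<bar>u s x\<bar> powr p * ?g x) \<in> borel_measurable lebesgue" .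
      have m2: "(\<lambda>x. H (s, x) * ?g x) \<in> borel_measurable lborel" by measurable
      have "(LINT x|lebesgue. \<bar>u s x\<bar> powr p * ?g x) = (LINT x|lebesgue. H (s, x) * ?g x)"
      proof (rule integral_cong_AE[OF m1])
        show "(\<lambda>x. H (s, x) * ?g x) \<in> borel_measurable lebesgue" using m2 by (rule measurable_completion)
        show "AE x in lebesgue. \<bar>u s x\<bar> powr p * ?g x = H (s, x) * ?g x"
          using AE_completion[OF elim]
        proof eventually_elim
          case (elim x)
          then show ?case using g_supp[of \<kappa> x] s by (cases "?g x = 0") (auto simp: indicator_def)
        qed
      qed
      also have "\<dots> = ?N s" by (rule integral_completion[OF m2])
      finally show "(LINT x|lebesgue. \<bar>u s x\<bar> powr p * ?g x) = ?N s" .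
    qed
  qed
  \<comment> \<open>The weak identity is available for t > 0 only. The defect \<open>?L\<close> is
    continuous on [0, \<tau>] and vanishes on (0, \<tau>], hence also at 0; this identifies the
    initial velocity of the mode.\<close>
  let ?L = "\<lambda>t. W \<kappa> t + (LBINT s:{0..t}. b s * W \<kappa> s - \<kappa>\<^sup>2 * Z \<kappa> s) - (W_init \<kappa> + (LBINT s:{0..t}. ?N s))"
  have L0: "?L t = 0" if t: "t \<in> {0<..\<tau>}" for t
  proof -
    have "(LINT s:{0..t}|lebesgue. (LINT x|lebesgue. \<bar>u s x\<bar> powr p * ?g x)) = (LBINT s:{0..t}. ?N s)"
    proof (rule set_LINT_lebesgue_eq_LBINT)
      show "set_integrable lborel {0..t} ?N" by (rule set_integrable_subset[OF N_set]) (use t in auto)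
      show "AE s in lebesgue. s \<in> {0..t} \<longrightarrow> (LINT x|lebesgue. \<bar>u s x\<bar> powr p * ?g x) = ?N s"
        using AE_completion[OF Neq] by eventually_elim (use t in auto)
    qed
    then show ?thesis using mode_identity[OF t, of \<kappa>] by (simp add: W_init_def)
  qed
  have cZ: "continuous_on {0..\<tau>} (Z \<kappa>)" by (rule DERIV_continuous_on[OF Z_deriv])
  have "continuous_on {0..\<tau>} (\<lambda>s. b s * W \<kappa> s - \<kappa>\<^sup>2 * Z \<kappa> s)"
    by (intro continuous_intros b_cont W_cont cZ)
  then have "set_integrable lborel {0..\<tau>} (\<lambda>s. b s * W \<kappa> s - \<kappa>\<^sup>2 * Z \<kappa> s)"
    by (rule borel_integrable_atLeastAtMost')
  then have "continuous_on {0..\<tau>} ?L"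
    by (intro continuous_intros W_cont indefinite_LBINT_continuous N_set)
  then have "continuous_on (closure {0<..\<tau>}) ?L" using tau by simp
  then have "?L t = 0" if "t \<in> closure {0<..\<tau>}" for t
    by (rule continuous_constant_on_closure) (use L0 that in auto)
  then show "W \<kappa> t + (LBINT s:{0..t}. b s * W \<kappa> s - \<kappa>\<^sup>2 * Z \<kappa> s) = W_init \<kappa> + (LBINT s:{0..t}. ?N s)"
    if "t \<in> {0..\<tau>}" for t
    using that tau by simp
  show "0 < Z \<kappa> 0" using Z_0[of \<kappa>] initial_mass_pos eps by (smt (verit) mult_pos_pos)
qed (use k tau b_cont b_nonneg m_deriv m_0 m_pos Z_deriv W_cont W_init_nonneg in auto)

text \<open>Hoelder's inequality in the form of Young's inequality with a parameter \<delta>: the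
  lower bound \<open>D\<close> of the weighted sum of modes is split between the integral of
  \<open>w\<close> and the energy \<open>E\<close> of a pointwise majorant \<open>h\<close> of the
  weights.\<close>

lemma Hoelder_lower_bound:
  fixes w :: "'a \<Rightarrow> real" and c k :: "nat \<Rightarrow> real" and h :: "'a \<Rightarrow> real"
  assumes s: "s \<in> {0..\<tau>}" and w: "integrable lborel w"
    and wu: "AE x in lborel. indicator K x * \<bar>u s x\<bar> powr p = w x"
    and J: "finite J" and c: "\<And>j. j \<in> J \<Longrightarrow> 0 \<le> c j"
    and le: "\<And>x. x \<in> cball 0 (R + s) \<Longrightarrow> (\<Sum>j\<in>J. c j * bessel DIM('a) ((k j)\<^sup>2 * (x \<bullet> x))) \<le> h x"
    and h: "h \<in> borel_measurable borel"
    and E: "(\<integral>\<^sup>+x. ennreal (h x powr (p / (p - 1))) * indicator (cball 0 (R + s)) x \<partial>lborel) \<le> ennreal E"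
      "0 < E"
    and D: "0 < D" "D \<le> (\<Sum>j\<in>J. c j * Z (k j) s)"
  shows "(D / 2) powr p * E powr (- (p - 1)) \<le> (LBINT x. w x)"
proof -
  define q where "q = p / (p - 1)"
  have q: "1 < q" "1 / p + 1 / q = 1" using p by (auto simp: q_def field_simps)
  let ?B = "cball (0::'a) (R + s)"
  let ?e = "\<lambda>x. \<Sum>j\<in>J. c j * cutoff_mode (k j) x"
  \<comment> \<open>Chosen so that \<delta>^(-q) E = D/2: the energy term takes exactly half of
    \<open>D\<close>, and the other half bounds the integral of \<open>w\<close>.\<close>
  define \<delta> where "\<delta> = (2 * E / D) powr (1 / q)"
  have \<delta>: "0 < \<delta>" using E D by (simp add: \<delta>_def)
  have \<delta>q: "\<delta> powr (- q) = D / (2 * E)"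
    using E D q by (simp add: \<delta>_def powr_powr powr_minus field_simps)
  have \<delta>p: "\<delta> powr p = (2 * E / D) powr (p - 1)"
    using p by (simp add: \<delta>_def powr_powr q_def)
  note [measurable] = h
  have [measurable]: "?B \<in> sets borel" by simp
  have iE: "integrable lborel (\<lambda>x. indicator ?B x * h x powr q)"
  proof (rule integrableI_nonneg)
    have "(\<integral>\<^sup>+x. ennreal (indicator ?B x * h x powr q) \<partial>lborel)
        = (\<integral>\<^sup>+x. ennreal (h x powr (p / (p - 1))) * indicator ?B x \<partial>lborel)"
      by (rule nn_integral_cong) (simp add: q_def indicator_def)
    then show "(\<integral>\<^sup>+x. ennreal (indicator ?B x * h x powr q) \<partial>lborel) < \<infinity>"
      using E(1) by (simp add: order.strict_trans1)
    show "(\<lambda>x. indicator ?B x * h x powr q) \<in> borel_measurable lborel" by measurable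
  qed auto
  have leE: "(LBINT x. indicator ?B x * h x powr q) \<le> E"
  proof -
    have "ennreal (LBINT x. indicator ?B x * h x powr q) = (\<integral>\<^sup>+x. ennreal (indicator ?B x * h x powr q) \<partial>lborel)"
      by (rule nn_integral_eq_integral[OF iE, symmetric]) auto
    also have "\<dots> = (\<integral>\<^sup>+x. ennreal (h x powr (p / (p - 1))) * indicator ?B x \<partial>lborel)"
      by (rule nn_integral_cong) (simp add: q_def indicator_def)
    also have "\<dots> \<le> ennreal E" by (rule E(1))
    finally show ?thesis using E(2) by simp
  qed
  have iu: "integrable lebesgue (\<lambda>x. u s x * cutoff_mode (k j) x)" for j
    by (rule integrable_loc_mult(1)[OF u_loc[OF s] g_cont K_compact g_supp])
  have ie: "integrable lebesgue (\<lambda>x. u s x * ?e x)"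
  proof -
    have "integrable lebesgue (\<lambda>x. \<Sum>j\<in>J. c j * (u s x * cutoff_mode (k j) x))"
      by (intro Bochner_Integration.integrable_sum integrable_mult_right iu)
    then show ?thesis by (simp add: sum_distrib_left mult_ac)
  qed
  have "(\<Sum>j\<in>J. c j * Z (k j) s) = (LINT x|lebesgue. (\<Sum>j\<in>J. c j * (u s x * cutoff_mode (k j) x)))"
    unfolding Z_def by (subst Bochner_Integration.integral_sum) (auto intro: iu)
  also have "\<dots> = (LINT x|lebesgue. u s x * ?e x)" by (simp add: sum_distrib_left mult_ac)
  also have "\<dots> \<le> (LINT x|lebesgue. \<delta> powr p * w x + \<delta> powr (- q) * (indicator ?B x * h x powr q))"
  proof (rule integral_mono_AE[OF ie])
    have "integrable lborel (\<lambda>x. \<delta> powr p * w x + \<delta> powr (- q) * (indicator ?B x * h x powr q))"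
      using w iE by (intro Bochner_Integration.integrable_add integrable_mult_right)
    then show "integrable lebesgue (\<lambda>x. \<delta> powr p * w x + \<delta> powr (- q) * (indicator ?B x * h x powr q))"
      by (subst integrable_completion) auto
    show "AE x in lebesgue. u s x * ?e x \<le> \<delta> powr p * w x + \<delta> powr (- q) * (indicator ?B x * h x powr q)"
      using u_zero[OF s] AE_completion[OF wu]
    proof eventually_elim
      case (elim x)
      show ?case
      proof (cases "x \<in> ?B")
        case True
        then have xb: "x \<in> ball 0 (R + \<tau> + 1)" and xK: "x \<in> K" using s by (auto simp: K_def)
        have e0: "0 \<le> ?e x" by (intro sum_nonneg mult_nonneg_nonneg c g_nonneg)
        have eh: "?e x \<le> h x" using le[OF True] by (simp add: g_eq[OF xb])
        have "u s x * ?e x \<le> \<bar>u s x\<bar> * ?e x" using e0 by (intro mult_right_mono) auto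
        also have "\<dots> \<le> \<bar>u s x\<bar> * h x" using eh by (intro mult_left_mono) auto
        also have "\<dots> = (\<delta> * \<bar>u s x\<bar>) * (h x / \<delta>)" using \<delta> by simp
        also have "\<dots> \<le> (\<delta> * \<bar>u s x\<bar>) powr p / p + (h x / \<delta>) powr q / q"
          by (rule Youngs_inequality) (use p q \<delta> e0 eh in auto)
        also have "\<dots> \<le> (\<delta> * \<bar>u s x\<bar>) powr p + (h x / \<delta>) powr q"
        proof (rule add_mono)
          have "a / r \<le> a" if "0 \<le> a" "1 < r" for a r :: real
            using divide_left_mono[of 1 r a] that by simp
          then show "(\<delta> * \<bar>u s x\<bar>) powr p / p \<le> (\<delta> * \<bar>u s x\<bar>) powr p" "(h x / \<delta>) powr q / q \<le> (h x / \<delta>) powr q"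
            using p q by auto
        qed
        also have "\<dots> = \<delta> powr p * \<bar>u s x\<bar> powr p + \<delta> powr (- q) * h x powr q"
          using \<delta> e0 eh by (simp add: powr_mult powr_divide powr_minus field_simps)
        also have "\<bar>u s x\<bar> powr p = w x" using elim(2) xK by simp
        finally show ?thesis using True by simp
      next
        case False
        have "0 \<le> w x" using elim(2)[symmetric] by simp
        then show ?thesis using False elim(1) by simp
      qed
    qed
  qed
  also have "\<dots> = (LBINT x. \<delta> powr p * w x + \<delta> powr (- q) * (indicator ?B x * h x powr q))"
    by (rule integral_completion) (use borel_measurable_integrable[OF w] in measurable)
  also have "\<dots> = \<delta> powr p * (LBINT x. w x) + \<delta> powr (- q) * (LBINT x. indicator ?B x * h x powr q)"
    using w iE by simp
  also have "\<dots> \<le> \<delta> powr p * (LBINT x. w x) + \<delta> powr (- q) * E"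
    using leE by (intro add_left_mono mult_left_mono) auto
  also have "\<delta> powr (- q) * E = D / 2" using \<delta>q E by simp
  finally have "D / 2 \<le> \<delta> powr p * (LBINT x. w x)" using D by simp
  then have "\<delta> powr (- p) * (D / 2) \<le> \<delta> powr (- p) * (\<delta> powr p * (LBINT x. w x))"
    by (intro mult_left_mono) auto
  also have "\<dots> = (LBINT x. w x)" using \<delta> by (simp add: powr_minus)
  also have "\<delta> powr (- p) * (D / 2) = (D / 2) powr p * E powr (- (p - 1))"
  proof -
    have "(2 * E / D) powr (p - 1) * (D / 2 / E) powr (p - 1) = 1"
      using E D by (simp add: powr_mult[symmetric])
    then have "\<delta> powr (- p) = (D / 2 / E) powr (p - 1)"
      using \<delta> \<delta>p by (simp add: powr_minus inverse_unique)
    also have "\<dots> * (D / 2) = (D / 2) powr (p - 1) * (D / 2) powr 1 * E powr (- (p - 1))"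
    proof -
      have "(D / 2 / E) powr (p - 1) = (D / 2) powr (p - 1) * E powr (- (p - 1))"
        unfolding powr_minus divide_inverse[symmetric] by (rule powr_divide)
      then show ?thesis using D by simp
    qed
    also have "\<dots> = (D / 2) powr p * E powr (- (p - 1))" by (simp only: powr_add[symmetric]) simp
    finally show ?thesis .
  qed
  finally show ?thesis .
qed

end

section \<open>Polar coordinates and the abstract system of modes\<close>

text \<open>The half lines {..a} generate the Borel sets and are stable under intersection, so it
  suffices to compare volumes of balls; the density is the derivative of the ball volume with
  respect to the radius.\<close>

lemma distr_norm_lborel:
  "distr lborel borel (norm :: 'a::euclidean_space \<Rightarrow> real) =
    density lborel (\<lambda>r. ennreal (real DIM('a) * unit_ball_vol (real DIM('a)) * r ^ (DIM('a) - 1)) * indicator {0..} r)"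
    (is "?M = ?N")
proof (rule measure_eqI_generator_eq[where E = "range atMost" and \<Omega> = UNIV and A = "\<lambda>i::nat. {..real i}"])
  let ?n = "DIM('a)"
  let ?c = "real ?n * unit_ball_vol (real ?n)"
  have v: "0 \<le> unit_ball_vol (real ?n)" by simp
  show "Int_stable (range (atMost :: real \<Rightarrow> real set))"
    by (auto simp: Int_stable_def)
  have M: "emeasure ?M {..a} = (if a \<ge> 0 then ennreal (unit_ball_vol (real ?n) * a ^ ?n) else 0)" for a
  proof -
    have "emeasure ?M {..a} = emeasure lborel (cball (0::'a) a)"
      by (subst emeasure_distr) (auto intro!: arg_cong[where f = "emeasure lborel"])
    then show ?thesis by (simp add: emeasure_cball)
  qed
  have N: "emeasure ?N {..a} = (if a \<ge> 0 then ennreal (unit_ball_vol (real ?n) * a ^ ?n) else 0)" for a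
  proof -
    have "emeasure ?N {..a} = (\<integral>\<^sup>+r. ennreal (?c * r ^ (?n - 1)) * indicator {0..a} r \<partial>lborel)"
      by (subst emeasure_density) (auto intro!: nn_integral_cong simp: indicator_def)
    also have "\<dots> = (if a \<ge> 0 then ennreal (unit_ball_vol (real ?n) * a ^ ?n) else 0)"
    proof (cases "a \<ge> 0")
      case True
      have "(\<integral>\<^sup>+r. ennreal (?c * r ^ (?n - 1)) * indicator {0..a} r \<partial>lborel)
          = ennreal (unit_ball_vol (real ?n) * a ^ ?n - unit_ball_vol (real ?n) * 0 ^ ?n)"
      proof (rule nn_integral_FTC_Icc[OF _ _ _ True])
        show "((\<lambda>r. unit_ball_vol (real ?n) * r ^ ?n) has_real_derivative ?c * x ^ (?n - 1)) (at x)" for x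
          by (auto intro!: derivative_eq_intros)
        show "(\<lambda>r. ?c * r ^ (?n - 1)) \<in> borel_measurable borel" by measurable
      qed (use v in auto)
      then show ?thesis using True by simp
    qed simp
    finally show ?thesis .
  qed
  show "emeasure ?M X = emeasure ?N X" if "X \<in> range atMost" for X
    using that M N by auto
  show "emeasure ?M {..real i} \<noteq> \<infinity>" for i by (simp add: M)
  show "sets ?M = sigma_sets UNIV (range atMost)" "sets ?N = sigma_sets UNIV (range atMost)"
    by (simp_all add: borel_eq_atMost)
  show "(\<Union>i. {..real i}) = UNIV" using real_arch_simple by auto
qed auto

text \<open>The variable y = t - |x| \<ge> 1 is the distance to the cone |x| = t. The surface
  factor, a power of the radius, is bounded by its value at t, which leaves an integral in y
  alone.\<close>

lemma nn_integral_radial_le: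
  fixes k :: "real \<Rightarrow> real"
  assumes t: "1 \<le> t" and k: "continuous_on {1..t} k" and k0: "\<And>y. y \<in> {1..t} \<Longrightarrow> 0 \<le> k y"
    and h: "h \<in> borel_measurable borel"
    and le: "\<And>x. x \<in> cball (0::'a::euclidean_space) (t - 1) \<Longrightarrow> h x \<le> k (t - norm x)"
  shows "(\<integral>\<^sup>+x. ennreal (h x) * indicator (cball 0 (t - 1)) x \<partial>lborel)
    \<le> ennreal (real DIM('a) * unit_ball_vol (real DIM('a)) * t ^ (DIM('a) - 1) * integral {1..t} k)"
proof -
  let ?c = "real DIM('a) * unit_ball_vol (real DIM('a))"
  let ?f = "\<lambda>r. ennreal (indicator {0..t - 1} r *\<^sub>R k (t - r))"
  have ck: "continuous_on {0..t - 1} (\<lambda>r. k (t - r))"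
    by (rule continuous_on_compose2[OF k]) (auto intro!: continuous_intros)
  then have "(\<lambda>r. indicator {0..t - 1} r *\<^sub>R k (t - r)) \<in> borel_measurable borel"
    by (intro borel_measurable_continuous_on_indicator) auto
  then have [measurable]: "(\<lambda>r. indicator {0..t - 1} r * k (t - r)) \<in> borel_measurable borel"
    by simp
  have "(\<integral>\<^sup>+x. ennreal (h x) * indicator (cball 0 (t - 1)) x \<partial>lborel) \<le> (\<integral>\<^sup>+x. ?f (norm x) \<partial>(lborel :: 'a measure))"
    by (rule nn_integral_mono) (use le in \<open>auto simp: indicator_def intro!: ennreal_leI\<close>)
  also have "\<dots> = (\<integral>\<^sup>+r. ?f r \<partial>distr lborel borel (norm :: 'a \<Rightarrow> real))"
    by (subst nn_integral_distr) auto
  also have "\<dots> = (\<integral>\<^sup>+r. ennreal (?c * r ^ (DIM('a) - 1)) * indicator {0..} r * ?f r \<partial>lborel)"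
    unfolding distr_norm_lborel by (subst nn_integral_density) auto
  also have "\<dots> \<le> (\<integral>\<^sup>+r. ennreal (?c * t ^ (DIM('a) - 1) * (indicator {0..t - 1} r *\<^sub>R k (t - r))) \<partial>lborel)"
  proof (rule nn_integral_mono)
    fix r :: real
    show "ennreal (?c * r ^ (DIM('a) - 1)) * indicator {0..} r * ?f r
       \<le> ennreal (?c * t ^ (DIM('a) - 1) * (indicator {0..t - 1} r *\<^sub>R k (t - r)))"
    proof (cases "r \<in> {0..t - 1}")
      case True
      then have "?c * r ^ (DIM('a) - 1) * k (t - r) \<le> ?c * t ^ (DIM('a) - 1) * k (t - r)"
        using k0[of "t - r"] by (intro mult_right_mono mult_left_mono power_mono) auto
      then show ?thesis using True k0[of "t - r"]
        by (simp add: ennreal_mult''[symmetric] ennreal_leI)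
    qed (auto simp: indicator_def)
  qed
  also have "\<dots> = ennreal (LBINT r. ?c * t ^ (DIM('a) - 1) * (indicator {0..t - 1} r *\<^sub>R k (t - r)))"
  proof (rule nn_integral_eq_integral)
    show "integrable lborel (\<lambda>r. ?c * t ^ (DIM('a) - 1) * (indicator {0..t - 1} r *\<^sub>R k (t - r)))"
      by (intro integrable_mult_right borel_integrable_compact ck) auto
    show "AE r in lborel. 0 \<le> ?c * t ^ (DIM('a) - 1) * (indicator {0..t - 1} r *\<^sub>R k (t - r))"
      by (rule AE_I2) (use k0 t in \<open>auto simp: indicator_def intro!: mult_nonneg_nonneg\<close>)
  qed
  also have "(LBINT r. ?c * t ^ (DIM('a) - 1) * (indicator {0..t - 1} r *\<^sub>R k (t - r)))
     = ?c * t ^ (DIM('a) - 1) * (LBINT r:{0..t - 1}. k (t - r))"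
    by (simp add: set_lebesgue_integral_def)
  also have "(LBINT r:{0..t - 1}. k (t - r)) = integral {0..t - 1} (\<lambda>r. k (t - r))"
    by (rule LBINT_Icc_eq_integral[OF ck])
  also have "\<dots> = integral {1..t} k"
  proof -
    have "(k has_integral integral {1..t} k) (cbox 1 t)"
      using integrable_integral[OF integrable_continuous_real[OF k]] by simp
    from has_integral_affinity[OF this, of "-1" t]
    have "((\<lambda>r. k (t - r)) has_integral integral {1..t} k) ((\<lambda>x. t - x) ` {1..t})"
      by (simp add: image_iff algebra_simps)
    also have "(\<lambda>x. t - x) ` {1..t} = {0..t - 1}" by simp
    finally show ?thesis by (rule integral_unique)
  qed
  finally show ?thesis .
qed

text \<open>What the blow-up argument retains of the solution: \<open>Z \<kappa>\<close> is the component of \<open>u\<close> along the mode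
  \<open>bessel n (\<kappa>\<^sup>2 * (x \<bullet> x))\<close>, \<open>Q\<close> is the spatial integral of the nonlinearity and \<open>A\<close> bounds the
  size of the data from below.\<close>
locale mode_system =
  fixes n :: nat and p R \<omega> \<tau> A :: real and m :: "real \<Rightarrow> real" and Z :: "real \<Rightarrow> real \<Rightarrow> real"
    and Q :: "real \<Rightarrow> real"
  assumes A: "0 < A" and tau: "0 < \<tau>"
    and m_pos: "\<And>s. s \<in> {0..\<tau>} \<Longrightarrow> 0 < m s"
    and m_mono: "\<And>s t. 0 \<le> s \<Longrightarrow> s \<le> t \<Longrightarrow> t \<le> \<tau> \<Longrightarrow> m s \<le> m t"
    and Z_exp: "\<And>\<kappa> t. 0 < \<kappa> \<Longrightarrow> t \<in> {0..\<tau>} \<Longrightarrow> A * exp (- \<kappa> * t) \<le> Z \<kappa> t"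
    and Z_sinh: "\<And>\<kappa> t. 0 < \<kappa> \<Longrightarrow> t \<in> {0..\<tau>} \<Longrightarrow> A * sinh (\<kappa> * t) / m t \<le> Z \<kappa> t"
    and Z_Duhamel: "\<And>\<kappa> a t \<theta> w. 0 < \<kappa> \<Longrightarrow> 0 \<le> a \<Longrightarrow> a \<le> t \<Longrightarrow> t \<le> \<tau> \<Longrightarrow> 0 \<le> \<theta> \<Longrightarrow>
      (\<And>s. s \<in> {a..t} \<Longrightarrow> \<theta> * m t \<le> m s) \<Longrightarrow> continuous_on {a..t} w \<Longrightarrow>
      (\<And>s. s \<in> {a..t} \<Longrightarrow> 0 \<le> w s) \<Longrightarrow> (AE s in lborel. s \<in> {a..t} \<longrightarrow> w s \<le> Q s) \<Longrightarrow>
      \<theta> * integral {a..t} (\<lambda>s. w s * sinh (\<kappa> * (t - s)) / \<kappa>) \<le> Z \<kappa> t"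
    and Q_lower: "AE s in lborel. s \<in> {0..\<tau>} \<longrightarrow> (\<forall>(J :: nat set) c k f D E.
      finite J \<longrightarrow> (\<forall>j\<in>J. 0 \<le> c j) \<longrightarrow> continuous_on {1..R + 1 + s} f \<longrightarrow>
      (\<forall>r\<in>{0..R + s}. (\<Sum>j\<in>J. c j * bessel n ((k j * r)\<^sup>2)) powr (p / (p - 1)) \<le> f (R + 1 + s - r)) \<longrightarrow>
      \<omega> * (R + 1 + s) ^ (n - 1) * integral {1..R + 1 + s} f \<le> E \<longrightarrow> 0 < E \<longrightarrow> 0 < D \<longrightarrow>
      D \<le> (\<Sum>j\<in>J. c j * Z (k j) s) \<longrightarrow> (D / 2) powr p * E powr (- (p - 1)) \<le> Q s)"

context damped_wave_solution
begin

text \<open>All modes are at least 1 on the support of \<open>u s\<close>, so the single function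
  \<open>?Q\<close>, free of \<kappa>, bounds every forcing \<open>?N \<kappa>\<close> from below.
  The exceptional null set of times must not depend on the weights in the Hoelder bound; hence the
  quantifiers over weights stand inside the almost-everywhere statement.\<close>

lemma ex_mode_system:
  "\<exists>Q. mode_system DIM('a) p R (real DIM('a) * unit_ball_vol (real DIM('a))) \<tau> (\<epsilon> * initial_mass) m Z Q"
proof -
  have I: "{0..\<tau>} \<subseteq> time_interval T" using in_time by blast
  obtain H where H: "integrable (lborel \<Otimes>\<^sub>M lborel) H" "\<And>z. 0 \<le> H z"
    "AE s in lborel. AE x in lborel. indicator ({0..\<tau>} \<times> K) (s, x) * \<bar>u s x\<bar> powr p = H (s, x)"
    by (rule loc_integrable_prod_representative[OF locf I K_compact]) auto
  let ?N = "\<lambda>\<kappa> s. LBINT x. H (s, x) * cutoff_mode \<kappa> x"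
  let ?Q = "\<lambda>s. LBINT x. H (s, x)"
  have mode: "damped_mode \<tau> \<kappa> b m (Z \<kappa>) (W \<kappa>) (?N \<kappa>) (W_init \<kappa>)" if "0 < \<kappa>" for \<kappa>
    by (rule damped_modeI[OF that H])
  have Hint: "AE s in lborel. integrable lborel (\<lambda>x. H (s, x))"
    by (rule lborel_pair.AE_integrable_fst'[OF H(1)])
  have QN: "AE s in lborel. s \<in> {0..\<tau>} \<longrightarrow> ?Q s \<le> ?N \<kappa> s" for \<kappa>
    using Hint H(3)
  proof eventually_elim
    case (elim s)
    show ?case
    proof
      assume s: "s \<in> {0..\<tau>}"
      have uz: "AE x in lborel. x \<notin> cball 0 (R + s) \<longrightarrow> u s x = 0"
        using u_zero[OF s] by (simp only: AE_completion_iff)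
      have le: "AE x in lborel. H (s, x) \<le> H (s, x) * cutoff_mode \<kappa> x"
        using uz elim(2)
      proof eventually_elim
        case (elim x)
        show ?case
        proof (cases "x \<in> cball 0 (R + s)")
          case True
          then have "1 \<le> cutoff_mode \<kappa> x" using s by (intro g_ge_1) auto
          then show ?thesis using mult_left_mono[of 1 "cutoff_mode \<kappa> x" "H (s, x)"] H(2) by simp
        next
          case False
          then show ?thesis using elim p by simp
        qed
      qed
      have "continuous_on UNIV (cutoff_mode \<kappa>)" by (rule g_cont)
      then have [measurable]: "cutoff_mode \<kappa> \<in> borel_measurable borel" by (rule borel_measurable_continuous_onI)
      obtain B where gB: "\<And>x. \<bar>cutoff_mode \<kappa> x\<bar> \<le> \<bar>B\<bar>" using g_bounded[of \<kappa>] by blast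
      have int: "integrable lborel (\<lambda>x. H (s, x) * cutoff_mode \<kappa> x)"
      proof (rule Bochner_Integration.integrable_bound[OF integrable_mult_right[OF elim(1), of "\<bar>B\<bar>"]])
        show "(\<lambda>x. H (s, x) * cutoff_mode \<kappa> x) \<in> borel_measurable lborel"
          using borel_measurable_integrable[OF elim(1)] by measurable
        have "\<bar>H (s, x)\<bar> * \<bar>cutoff_mode \<kappa> x\<bar> \<le> \<bar>H (s, x)\<bar> * \<bar>B\<bar>" for x by (intro mult_left_mono gB) simp
        then show "AE x in lborel. norm (H (s, x) * cutoff_mode \<kappa> x) \<le> norm (\<bar>B\<bar> * H (s, x))"
          by (intro AE_I2) (simp add: abs_mult mult.commute)
      qed
      show "?Q s \<le> ?N \<kappa> s" by (rule integral_mono_AE[OF elim(1) int le])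
    qed
  qed
  have ang: "0 < \<epsilon> * initial_mass" using eps initial_mass_pos by simp
  have "mode_system DIM('a) p R (real DIM('a) * unit_ball_vol (real DIM('a))) \<tau> (\<epsilon> * initial_mass) m Z ?Q"
  proof
    show "0 < \<epsilon> * initial_mass" by (rule ang)
    interpret d: damped_mode \<tau> 1 b m "Z 1" "W 1" "?N 1" "W_init 1" by (rule mode) simp
    show "m s \<le> m t" if "0 \<le> s" "s \<le> t" "t \<le> \<tau>" for s t by (rule d.m_mono[OF that])
  next
    fix \<kappa> t :: real assume k: "0 < \<kappa>" and t: "t \<in> {0..\<tau>}"
    interpret d: damped_mode \<tau> \<kappa> b m "Z \<kappa>" "W \<kappa>" "?N \<kappa>" "W_init \<kappa>" by (rule mode[OF k])
    show "\<epsilon> * initial_mass * exp (- \<kappa> * t) \<le> Z \<kappa> t"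
    proof -
      have "exp (- \<kappa> * t) * (\<epsilon> * initial_mass) \<le> exp (- \<kappa> * t) * Z \<kappa> 0"
        by (rule mult_left_mono[OF Z_0]) simp
      also have "\<dots> \<le> Z \<kappa> t" by (rule d.Z_ge_exp[OF t])
      finally show ?thesis by (simp only: mult.commute[of "\<epsilon> * initial_mass"])
    qed
    show "\<epsilon> * initial_mass * sinh (\<kappa> * t) / m t \<le> Z \<kappa> t"
    proof -
      have "\<epsilon> * initial_mass * sinh (\<kappa> * t) / m t = (\<kappa> * (\<epsilon> * initial_mass)) * sinh (\<kappa> * t) / (\<kappa> * m t)"
        using k by simp
      also have "\<dots> \<le> (W_init \<kappa> + \<kappa> * Z \<kappa> 0) * sinh (\<kappa> * t) / (\<kappa> * m t)"
      proof (intro divide_right_mono mult_right_mono)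
        have "\<kappa> * (\<epsilon> * initial_mass) \<le> \<kappa> * Z \<kappa> 0" using k by (intro mult_left_mono[OF Z_0]) simp
        then show "\<kappa> * (\<epsilon> * initial_mass) \<le> W_init \<kappa> + \<kappa> * Z \<kappa> 0" using W_init_nonneg[of \<kappa>] by simp
        show "0 \<le> sinh (\<kappa> * t)" using k t by simp
        show "0 \<le> \<kappa> * m t" using k m_pos[OF t] by simp
      qed
      also have "\<dots> \<le> Z \<kappa> t" by (rule d.Z_ge_sinh[OF t])
      finally show ?thesis .
    qed
  next
    fix \<kappa> a t \<theta> :: real and w :: "real \<Rightarrow> real"
    assume *: "0 < \<kappa>" "0 \<le> a" "a \<le> t" "t \<le> \<tau>" "0 \<le> \<theta>"
      "\<And>s. s \<in> {a..t} \<Longrightarrow> \<theta> * m t \<le> m s" "continuous_on {a..t} w"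
      "\<And>s. s \<in> {a..t} \<Longrightarrow> 0 \<le> w s" "AE s in lborel. s \<in> {a..t} \<longrightarrow> w s \<le> ?Q s"
    interpret d: damped_mode \<tau> \<kappa> b m "Z \<kappa>" "W \<kappa>" "?N \<kappa>" "W_init \<kappa>" by (rule mode[OF *(1)])
    have "AE s in lborel. s \<in> {a..t} \<longrightarrow> w s \<le> ?N \<kappa> s"
      using *(9) QN[of \<kappa>] by eventually_elim (use * in force)
    then show "\<theta> * integral {a..t} (\<lambda>s. w s * sinh (\<kappa> * (t - s)) / \<kappa>) \<le> Z \<kappa> t"
      using * by (intro d.Z_ge_Duhamel[where a = a and t = t and \<theta> = \<theta> and w = w]) blast+
  next
    show "AE s in lborel. s \<in> {0..\<tau>} \<longrightarrow> (\<forall>(J :: nat set) c k f D E.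
      finite J \<longrightarrow> (\<forall>j\<in>J. 0 \<le> c j) \<longrightarrow> continuous_on {1..R + 1 + s} f \<longrightarrow>
      (\<forall>r\<in>{0..R + s}. (\<Sum>j\<in>J. c j * bessel DIM('a) ((k j * r)\<^sup>2)) powr (p / (p - 1)) \<le> f (R + 1 + s - r)) \<longrightarrow>
      (real DIM('a) * unit_ball_vol (real DIM('a))) * (R + 1 + s) ^ (DIM('a) - 1) * integral {1..R + 1 + s} f \<le> E
      \<longrightarrow> 0 < E \<longrightarrow> 0 < D \<longrightarrow>
      D \<le> (\<Sum>j\<in>J. c j * Z (k j) s) \<longrightarrow> (D / 2) powr p * E powr (- (p - 1)) \<le> ?Q s)"
      using Hint H(3)
    proof eventually_elim
      case (elim s)
      show ?case
      proof (intro impI allI)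
        fix J :: "nat set" and c k :: "nat \<Rightarrow> real" and f D E
        assume s: "s \<in> {0..\<tau>}" and J: "finite J" and c: "\<forall>j\<in>J. 0 \<le> c j"
          and f: "continuous_on {1..R + 1 + s} f"
          and le: "\<forall>r\<in>{0..R + s}. (\<Sum>j\<in>J. c j * bessel DIM('a) ((k j * r)\<^sup>2)) powr (p / (p - 1)) \<le> f (R + 1 + s - r)"
          and E: "(real DIM('a) * unit_ball_vol (real DIM('a))) * (R + 1 + s) ^ (DIM('a) - 1) * integral {1..R + 1 + s} f \<le> E"
            "0 < E" and D: "0 < D" "D \<le> (\<Sum>j\<in>J. c j * Z (k j) s)"
        let ?h = "\<lambda>x::'a. \<Sum>j\<in>J. c j * bessel DIM('a) ((k j)\<^sup>2 * (x \<bullet> x))"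
        have "1 \<le> DIM('a)" using DIM_positive[where 'a = 'a] by linarith
        note cb = C_inf_continuous[OF C_inf_bessel[OF this]]
        have "continuous_on UNIV ?h"
          by (intro continuous_intros continuous_on_compose2[OF cb[of UNIV]]) auto
        then have h[measurable]: "?h \<in> borel_measurable borel" by (rule borel_measurable_continuous_onI)
        have hr: "?h x = (\<Sum>j\<in>J. c j * bessel DIM('a) ((k j * norm x)\<^sup>2))" for x
          by (simp add: power_mult_distrib power2_norm_eq_inner)
        have f0: "0 \<le> f y" if "y \<in> {1..R + 1 + s}" for y
        proof -
          have "R + 1 + s - y \<in> {0..R + s}" using that by auto
          from le[rule_format, OF this] have "0 \<le> f (R + 1 + s - (R + 1 + s - y))"
            by (rule order_trans[rotated]) simp
          then show ?thesis by simp
        qed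
        have "(\<integral>\<^sup>+x. ennreal (?h x powr (p / (p - 1))) * indicator (cball 0 (R + 1 + s - 1)) x \<partial>lborel)
          \<le> ennreal (real DIM('a) * unit_ball_vol (real DIM('a)) * (R + 1 + s) ^ (DIM('a) - 1) * integral {1..R + 1 + s} f)"
        proof (rule nn_integral_radial_le[OF _ f f0])
          show "1 \<le> R + 1 + s" using R s by simp
          show "(\<lambda>x. ?h x powr (p / (p - 1))) \<in> borel_measurable borel" by measurable
          show "?h x powr (p / (p - 1)) \<le> f (R + 1 + s - norm x)" if "x \<in> cball 0 (R + 1 + s - 1)" for x
            unfolding hr by (rule le[rule_format]) (use that in auto)
        qed
        also have "\<dots> \<le> ennreal E" by (rule ennreal_leI[OF E(1)])
        finally have *: "(\<integral>\<^sup>+x. ennreal (?h x powr (p / (p - 1))) * indicator (cball 0 (R + s)) x \<partial>lborel) \<le> ennreal E"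
          by simp
        have wu: "AE x in lborel. indicator K x * \<bar>u s x\<bar> powr p = H (s, x)"
          using elim(2) by eventually_elim (use s in \<open>simp add: indicator_def\<close>)
        show "(D / 2) powr p * E powr (- (p - 1)) \<le> ?Q s"
          by (rule Hoelder_lower_bound[OF s elim(1) wu J _ order_refl h * E(2) D]) (use c in auto)
      qed
    qed
  qed (use tau m_pos in auto)
  then show ?thesis by blast
qed

end

section \<open>Critical frame estimates and the doubling argument\<close>

lemma energy_powr:
  fixes p \<omega> B X t \<alpha> :: real
  assumes "1 < p" "0 < \<omega>" "0 < B" "0 < X" "0 < t" "\<alpha> = (real n - 1) / 2" "1 \<le> n"
  shows "(\<omega> * t ^ (n - 1) * (B * t powr (- \<alpha> * (p / (p - 1))) * X)) powr (- (p - 1))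
    = (\<omega> * B) powr (- (p - 1)) * t powr (\<alpha> * (2 - p)) * X powr (- (p - 1))"
proof -
  have "2 * \<alpha> = real (n - 1)" using assms by (simp add: of_nat_diff)
  then have "t ^ (n - 1) = t powr (2 * \<alpha>)" using assms by (simp only: powr_realpow)
  then have "\<omega> * t ^ (n - 1) * (B * t powr (- \<alpha> * (p / (p - 1))) * X)
     = (\<omega> * B) * t powr (2 * \<alpha> + - \<alpha> * (p / (p - 1))) * X"
    by (simp only: powr_add mult_ac)
  also have "\<dots> powr (- (p - 1)) = (\<omega> * B) powr (- (p - 1)) *
      t powr ((2 * \<alpha> + - \<alpha> * (p / (p - 1))) * (- (p - 1))) * X powr (- (p - 1))"
    using assms by (simp only: powr_mult powr_powr)
  also have "(2 * \<alpha> + - \<alpha> * (p / (p - 1))) * (- (p - 1)) = \<alpha> * (2 - p)"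
    using assms(1) by (simp add: field_simps)
  finally show ?thesis .
qed

lemma powr_p_div_2: "0 \<le> D \<Longrightarrow> (D / 2) powr p = 2 powr (- p) * D powr p" for D p :: real
  by (simp add: powr_divide powr_minus field_simps)

text \<open>The weight \<kappa>^(\<alpha> - 1/p + 1) is dictated by the Hoelder energy. With t = R +
  1 + s and y = t - |x|, the kernel bound turns each term into t^(-\<alpha>) \<kappa>^(1 - 1/p) exp
  (- \<kappa> y/2) up to a constant, and the dyadic sum of these is at most of size t^(-\<alpha>)
  y^(-(1 - 1/p)). Raised to the conjugate exponent p/(p - 1) the y-dependence is 1/y, with integral
  ln t over [1, t]; the margin 1 in t keeps y away from 0.\<close>

lemma Q_lower_of_dyadic_sum:
  fixes n :: nat and p R \<omega> \<alpha> :: real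
  assumes n: "2 \<le> n" and p: "1 < p" and R: "0 < R" and \<omega>: "0 < \<omega>" and \<alpha>: "\<alpha> = (real n - 1) / 2"
  obtains c where "0 < c" "\<And>\<tau> A m Z Q. mode_system n p R \<omega> \<tau> A m Z Q \<Longrightarrow>
    AE s in lborel. s \<in> {0..\<tau>} \<longrightarrow> (\<forall>I D. 0 < D \<longrightarrow>
      D \<le> (\<Sum>i<I. (1 / 2 ^ i) powr (\<alpha> - 1 / p + 1) * exp (- ((R + 1 + s) / 2 ^ i)) * Z (1 / 2 ^ i) s) \<longrightarrow>
      c * D powr p * (R + 1 + s) powr (\<alpha> * (2 - p)) * ln (R + 1 + s) powr (- (p - 1)) \<le> Q s)"
proof -
  define a where "a = 1 - 1 / p"
  define q where "q = p / (p - 1)"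
  have a: "0 < a" and q: "1 < q" and aq: "a * q = 1" using p by (auto simp: a_def q_def field_simps)
  obtain C1 where C1: "0 < C1" "\<And>w z. 0 \<le> w \<Longrightarrow> w < z \<Longrightarrow>
     exp (- z) * bessel n (w\<^sup>2) \<le> C1 * z powr (- ((real n - 1) / 2)) * exp (- (z - w) / 2)"
    using bessel_kernel_bound[OF n] by blast
  obtain C2 where C2: "0 < C2" "\<And>y I. y > 0 \<Longrightarrow>
     (\<Sum>i<I. (y / 2 ^ i) powr a * exp (- (y / 2 ^ i) / 2)) \<le> C2"
    using dyadic_sum_bound[OF a] by blast
  define B where "B = (C1 * C2) powr q"
  have B: "0 < B" using C1 C2 by (simp add: B_def)
  show thesis
  proof
    show "0 < 2 powr (- p) * (\<omega> * B) powr (- (p - 1))" using \<omega> B by simp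
    fix \<tau> A m Z Q assume "mode_system n p R \<omega> \<tau> A m Z Q"
    then interpret mode_system n p R \<omega> \<tau> A m Z Q .
    show "AE s in lborel. s \<in> {0..\<tau>} \<longrightarrow> (\<forall>I D. 0 < D \<longrightarrow>
      D \<le> (\<Sum>i<I. (1 / 2 ^ i) powr (\<alpha> - 1 / p + 1) * exp (- ((R + 1 + s) / 2 ^ i)) * Z (1 / 2 ^ i) s) \<longrightarrow>
      2 powr (- p) * (\<omega> * B) powr (- (p - 1)) * D powr p * (R + 1 + s) powr (\<alpha> * (2 - p)) * ln (R + 1 + s) powr (- (p - 1)) \<le> Q s)"
      using Q_lower
    proof eventually_elim
      case (elim s)
      show ?case
      proof (intro impI allI)
        fix I :: nat and D :: real
        assume s: "s \<in> {0..\<tau>}" and D: "0 < D"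
          "D \<le> (\<Sum>i<I. (1 / 2 ^ i) powr (\<alpha> - 1 / p + 1) * exp (- ((R + 1 + s) / 2 ^ i)) * Z (1 / 2 ^ i) s)"
        let ?t = "R + 1 + s"
        let ?c = "\<lambda>i::nat. (1 / 2 ^ i) powr (\<alpha> - 1 / p + 1) * exp (- (?t / 2 ^ i))"
        let ?f = "\<lambda>y. B * ?t powr (- \<alpha> * q) * (1 / y)"
        have t: "1 < ?t" using s R by auto
        have bound: "(\<Sum>i<I. ?c i * bessel n ((1 / 2 ^ i * r)\<^sup>2)) powr q \<le> ?f (?t - r)" if r: "r \<in> {0..R + s}" for r
        proof -
          let ?y = "?t - r"
          have y: "0 < ?y" using r by auto
          have "?c i * bessel n ((1 / 2 ^ i * r)\<^sup>2)
            \<le> C1 * ?t powr (- \<alpha>) * ?y powr (- a) * ((?y / 2 ^ i) powr a * exp (- (?y / 2 ^ i) / 2))" for i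
          proof -
            let ?l = "1 / 2 ^ i :: real"
            have l: "0 < ?l" by simp
            have "exp (- (?l * ?t)) * bessel n ((?l * r)\<^sup>2) \<le> C1 * (?l * ?t) powr (- \<alpha>) * exp (- (?l * ?t - ?l * r) / 2)"
              unfolding \<alpha> by (rule C1(2)) (use r l mult_strict_left_mono[of r ?t ?l] in auto)
            then have "?l powr (\<alpha> - 1 / p + 1) * (exp (- (?l * ?t)) * bessel n ((?l * r)\<^sup>2))
              \<le> ?l powr (\<alpha> - 1 / p + 1) * (C1 * (?l * ?t) powr (- \<alpha>) * exp (- (?l * ?t - ?l * r) / 2))"
              by (intro mult_left_mono) auto
            also have "\<dots> = C1 * ?t powr (- \<alpha>) * (?l powr (\<alpha> - 1 / p + 1) * ?l powr (- \<alpha>)) * exp (- (?l * ?y) / 2)"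
            proof -
              have "?l * ?t - ?l * r = ?l * ?y" by (simp only: right_diff_distrib)
              then show ?thesis by (simp only: powr_mult mult_ac)
            qed
            also have "?l powr (\<alpha> - 1 / p + 1) * ?l powr (- \<alpha>) = ?l powr a"
              by (simp only: powr_add[symmetric]) (simp add: a_def)
            \<comment> \<open>The scale-free combination y/2^i is formed at the cost of y^(-a), so
              that \<open>dyadic_sum_bound\<close> applies uniformly in y.\<close>
            also have "?l powr a = ?y powr (- a) * (?l * ?y) powr a"
              using y l by (simp only: powr_mult) (simp add: powr_minus)
            finally show ?thesis by (simp add: mult_ac)
          qed
          then have "(\<Sum>i<I. ?c i * bessel n ((1 / 2 ^ i * r)\<^sup>2))
            \<le> (\<Sum>i<I. C1 * ?t powr (- \<alpha>) * ?y powr (- a) * ((?y / 2 ^ i) powr a * exp (- (?y / 2 ^ i) / 2)))"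
            by (rule sum_mono)
          also have "\<dots> \<le> C1 * ?t powr (- \<alpha>) * ?y powr (- a) * C2"
            unfolding sum_distrib_left[symmetric] using C1 by (intro mult_left_mono C2(2) y) auto
          finally have le: "(\<Sum>i<I. ?c i * bessel n ((1 / 2 ^ i * r)\<^sup>2)) \<le> (C1 * C2) * ?t powr (- \<alpha>) * ?y powr (- a)"
            by (simp add: mult_ac)
          have "0 \<le> (\<Sum>i<I. ?c i * bessel n ((1 / 2 ^ i * r)\<^sup>2))"
          proof (intro sum_nonneg mult_nonneg_nonneg)
            fix i show "0 \<le> bessel n ((1 / 2 ^ i * r)\<^sup>2)" using bessel_ge_1[of n "(1 / 2 ^ i * r)\<^sup>2"] n by simp
          qed auto
          then have "(\<Sum>i<I. ?c i * bessel n ((1 / 2 ^ i * r)\<^sup>2)) powr q \<le> ((C1 * C2) * ?t powr (- \<alpha>) * ?y powr (- a)) powr q"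
            using q by (intro powr_mono2 le) auto
          also have "\<dots> = B * ?t powr (- \<alpha> * q) * ?y powr (- a * q)"
            by (simp only: powr_mult powr_powr B_def)
          also have "- a * q = - 1" using aq by simp
          also have "?y powr (- 1) = 1 / ?y" using y by (simp add: powr_minus_divide)
          finally show ?thesis .
        qed
        have cf: "continuous_on {1..?t} ?f" by (auto intro!: continuous_intros)
        have int: "integral {1..?t} ?f = B * ?t powr (- \<alpha> * q) * ln ?t"
        proof (rule integral_unique)
          have "((\<lambda>y. B * ?t powr (- \<alpha> * q) * (1 / y)) has_integral
             (B * ?t powr (- \<alpha> * q) * ln ?t - B * ?t powr (- \<alpha> * q) * ln 1)) {1..?t}"
            using t by (intro fundamental_theorem_of_calculus)
              (auto simp: has_real_derivative_iff_has_vector_derivative[symmetric] intro!: derivative_eq_intros)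
          then show "(?f has_integral B * ?t powr (- \<alpha> * q) * ln ?t) {1..?t}" by simp
        qed
        let ?E = "\<omega> * ?t ^ (n - 1) * (B * ?t powr (- \<alpha> * q) * ln ?t)"
        have E: "0 < ?E" using \<omega> B t by simp
        have "(D / 2) powr p * ?E powr (- (p - 1)) \<le> Q s"
        proof (rule elim[rule_format, of "{..<I}" ?c ?f "\<lambda>i. 1 / 2 ^ i" ?E D])
          show "s \<in> {0..\<tau>}" by (rule s)
          show "0 \<le> ?c j" for j by simp
          show "continuous_on {1..?t} ?f" by (rule cf)
          show "\<omega> * ?t ^ (n - 1) * integral {1..?t} ?f \<le> ?E" by (simp only: int order_refl)
          show "(\<Sum>j<I. ?c j * bessel n ((1 / 2 ^ j * r)\<^sup>2)) powr (p / (p - 1)) \<le> ?f (?t - r)"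
            if "r \<in> {0..R + s}" for r using bound[OF that] by (simp add: q_def)
        qed (use D E in auto)
        also have "?E powr (- (p - 1)) = (\<omega> * B) powr (- (p - 1)) * ?t powr (\<alpha> * (2 - p)) * ln ?t powr (- (p - 1))"
          unfolding q_def by (rule energy_powr) (use p \<omega> B t \<alpha> n in auto)
        finally show "2 powr (- p) * (\<omega> * B) powr (- (p - 1)) * D powr p * ?t powr (\<alpha> * (2 - p)) * ln ?t powr (- (p - 1)) \<le> Q s"
          using D by (simp add: powr_p_div_2 mult_ac)
      qed
    qed
  qed
qed

text \<open>Uses the single mode \<kappa> = 1 and the sinh bound for the data. With one mode the
  energy density decays like exp (- y/2) and has a bounded integral, so no logarithm is lost.
  Evaluating the loss 1/m at the end time \<tau> makes it uniform in s.\<close>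

lemma Q_lower_initial:
  fixes n :: nat and p R \<omega> \<alpha> :: real
  assumes n: "2 \<le> n" and p: "1 < p" and R: "0 < R" and \<omega>: "0 < \<omega>" and \<alpha>: "\<alpha> = (real n - 1) / 2"
  obtains c where "0 < c" "\<And>\<tau> A m Z Q. mode_system n p R \<omega> \<tau> A m Z Q \<Longrightarrow>
    AE s in lborel. s \<in> {1..\<tau>} \<longrightarrow>
      c * (A / m \<tau>) powr p * (R + 1 + s) powr (\<alpha> * (2 - p)) \<le> Q s"
proof -
  define q where "q = p / (p - 1)"
  have q: "1 < q" using p by (auto simp: q_def field_simps)
  obtain C1 where C1: "0 < C1" "\<And>w z. 0 \<le> w \<Longrightarrow> w < z \<Longrightarrow>
     exp (- z) * bessel n (w\<^sup>2) \<le> C1 * z powr (- ((real n - 1) / 2)) * exp (- (z - w) / 2)"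
    using bessel_kernel_bound[OF n] by blast
  define B where "B = C1 powr q"
  have B: "0 < B" using C1 by (simp add: B_def)
  define c where "c = (exp (- (R + 1)) / 8) powr p * ((\<omega> * B) powr (- (p - 1)) * 2 powr (- (p - 1)))"
  show thesis
  proof
    show "0 < c" using \<omega> B by (simp add: c_def)
    fix \<tau> A m Z Q assume "mode_system n p R \<omega> \<tau> A m Z Q"
    then interpret mode_system n p R \<omega> \<tau> A m Z Q .
    show "AE s in lborel. s \<in> {1..\<tau>} \<longrightarrow> c * (A / m \<tau>) powr p * (R + 1 + s) powr (\<alpha> * (2 - p)) \<le> Q s"
      using Q_lower
    proof eventually_elim
      case (elim s)
      show ?case
      proof
        assume s1: "s \<in> {1..\<tau>}"
        then have s: "s \<in> {0..\<tau>}" by auto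
        let ?t = "R + 1 + s"
        let ?c = "\<lambda>i::nat. exp (- ?t)"
        let ?f = "\<lambda>y. B * ?t powr (- \<alpha> * q) * exp (- y / 2)"
        \<comment> \<open>For s \<ge> 1 one has sinh s \<ge> exp s/4; multiplied by exp (- (R + 1 +
          s)) this leaves exp (- (R + 1))/4.\<close>
        let ?D = "exp (- (R + 1)) / 4 * (A / m \<tau>)"
        have t: "1 < ?t" using s R by auto
        have mt: "0 < m s" "0 < m \<tau>" "m s \<le> m \<tau>" using m_pos[OF s] m_pos[of \<tau>] m_mono[of s \<tau>] s tau by auto
        have D: "0 < ?D" using A mt by simp
        have "?D \<le> exp (- ?t) * Z 1 s"
        proof -
          have "exp s / 4 \<le> sinh s"
          proof -
            have "exp (- s) \<le> exp s / 2"
            proof -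
              have "2 * s + 1 \<le> exp (2 * s)" using exp_ge_add_one_self[of "2 * s"] by linarith
              then have "2 \<le> exp s * exp s" using s1 by (simp add: exp_add[symmetric])
              then show ?thesis by (simp add: exp_minus field_simps)
            qed
            then show ?thesis by (simp add: sinh_def)
          qed
          then have "A * (exp s / 4) / m \<tau> \<le> A * sinh (1 * s) / m s"
            using A mt s1 by (intro frac_le mult_left_mono) auto
          also have "\<dots> \<le> Z 1 s" by (rule Z_sinh[OF _ s]) simp
          finally have "exp (- ?t) * (A * (exp s / 4) / m \<tau>) \<le> exp (- ?t) * Z 1 s"
            by (intro mult_left_mono) auto
          moreover have "exp (- ?t) * exp s = exp (- (R + 1))" by (simp add: exp_add[symmetric])
          moreover have "exp (- ?t) * (A * (exp s / 4) / m \<tau>) = (exp (- ?t) * exp s) / 4 * (A / m \<tau>)"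
            by simp
          ultimately show ?thesis by (simp only:)
        qed
        then have D2: "?D \<le> (\<Sum>j\<in>{0}. ?c j * Z 1 s)" by simp
        have bound: "(\<Sum>j\<in>{0}. ?c j * bessel n ((1 * r)\<^sup>2)) powr q \<le> ?f (?t - r)" if r: "r \<in> {0..R + s}" for r
        proof -
          let ?y = "?t - r"
          have y: "0 < ?y" using r by auto
          have le: "exp (- ?t) * bessel n (r\<^sup>2) \<le> C1 * ?t powr (- \<alpha>) * exp (- ?y / 2)"
            unfolding \<alpha> by (rule C1(2)) (use r in auto)
          have "0 \<le> bessel n (r\<^sup>2)" using bessel_ge_1[of n "r\<^sup>2"] n by simp
          then have "(exp (- ?t) * bessel n (r\<^sup>2)) powr q \<le> (C1 * ?t powr (- \<alpha>) * exp (- ?y / 2)) powr q"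
            using q by (intro powr_mono2 le) auto
          also have "\<dots> = B * ?t powr (- \<alpha> * q) * exp (- ?y / 2) powr q"
            by (simp only: powr_mult powr_powr B_def)
          also have "\<dots> \<le> ?f ?y"
          proof (intro mult_left_mono)
            have *: "1 * ?y \<le> q * ?y" using y q by (intro mult_right_mono) auto
            have "exp (- ?y / 2) powr q = exp (q * (- ?y / 2))" by (simp add: powr_def)
            also have "\<dots> \<le> exp (- ?y / 2)"
              unfolding exp_le_cancel_iff using * by linarith
            finally show "exp (- ?y / 2) powr q \<le> exp (- ?y / 2)" .
          qed (use B in auto)
          finally show ?thesis by simp
        qed
        have cf: "continuous_on {1..?t} ?f" by (auto intro!: continuous_intros)
        have "integral {1..?t} ?f = B * ?t powr (- \<alpha> * q) * (2 * exp (- 1 / 2) - 2 * exp (- ?t / 2))"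
        proof (rule integral_unique)
          have "(?f has_integral
             (B * ?t powr (- \<alpha> * q) * (- 2 * exp (- ?t / 2)) - B * ?t powr (- \<alpha> * q) * (- 2 * exp (- 1 / 2)))) {1..?t}"
            using t by (intro fundamental_theorem_of_calculus)
              (auto simp: has_real_derivative_iff_has_vector_derivative[symmetric] intro!: derivative_eq_intros)
          then show "(?f has_integral B * ?t powr (- \<alpha> * q) * (2 * exp (- 1 / 2) - 2 * exp (- ?t / 2))) {1..?t}"
            by (simp add: algebra_simps)
        qed
        also have "\<dots> \<le> B * ?t powr (- \<alpha> * q) * 2"
        proof (intro mult_left_mono)
          have "exp (- 1 / 2 :: real) \<le> 1" by simp
          then show "2 * exp (- 1 / 2) - 2 * exp (- ?t / 2) \<le> (2::real)"
            using exp_gt_zero[of "- ?t / 2"] by linarith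
        qed (use B in auto)
        finally have int: "integral {1..?t} ?f \<le> B * ?t powr (- \<alpha> * q) * 2" .
        let ?E = "\<omega> * ?t ^ (n - 1) * (B * ?t powr (- \<alpha> * q) * 2)"
        have E: "0 < ?E" using \<omega> B t by simp
        have "(?D / 2) powr p * ?E powr (- (p - 1)) \<le> Q s"
        proof (rule elim[rule_format, of "{0}" ?c ?f "\<lambda>i. 1" ?E ?D])
          show "s \<in> {0..\<tau>}" by (rule s)
          show "continuous_on {1..?t} ?f" by (rule cf)
          show "\<omega> * ?t ^ (n - 1) * integral {1..?t} ?f \<le> ?E"
            using \<omega> t by (intro mult_left_mono int) auto
          show "(\<Sum>j\<in>{0}. ?c j * bessel n ((1 * r)\<^sup>2)) powr (p / (p - 1)) \<le> ?f (?t - r)"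
            if "r \<in> {0..R + s}" for r using bound[OF that] by (simp only: q_def)
          show "?D \<le> (\<Sum>j\<in>{0}. ?c j * Z 1 s)" by (rule D2)
        qed (use D E in auto)
        also have "?E powr (- (p - 1)) = (\<omega> * B) powr (- (p - 1)) * ?t powr (\<alpha> * (2 - p)) * 2 powr (- (p - 1))"
          unfolding q_def by (rule energy_powr) (use p \<omega> B t \<alpha> n in auto)
        also have "?D / 2 = exp (- (R + 1)) / 8 * (A / m \<tau>)" by simp
        also have "\<dots> powr p = (exp (- (R + 1)) / 8) powr p * (A / m \<tau>) powr p" by (rule powr_mult)
        finally show "c * (A / m \<tau>) powr p * ?t powr (\<alpha> * (2 - p)) \<le> Q s"
          by (simp add: c_def mult_ac)
      qed
    qed
  qed
qed

section \<open>Feedback of the nonlinearity on the dyadic sum\<close>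

lemma ex_dyadic_scale:
  fixes s :: real
  assumes "1 \<le> s"
  obtains i :: nat where "s \<le> 2 ^ i" "2 ^ i < 2 * s"
proof -
  have ex: "\<exists>i::nat. s \<le> 2 ^ i" using real_arch_pow[of 2 s] by (auto intro: less_imp_le)
  define i where "i = (LEAST i::nat. s \<le> 2 ^ i)"
  have 1: "s \<le> 2 ^ i" unfolding i_def using ex by (rule LeastI_ex)
  have "2 ^ i < 2 * s"
  proof (cases i)
    case 0 then show ?thesis using assms by simp
  next
    case (Suc j)
    then have "\<not> s \<le> 2 ^ j" unfolding i_def by (metis lessI not_less_Least)
    then show ?thesis using Suc by simp
  qed
  with 1 show thesis by (rule that)
qed

text \<open>For each source time s the one frequency 1/2^i with 2^i comparable to R + 1 + s already
  contributes enough, so the sum over scales is bounded below by a term with an s-dependent index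
  before integrating in s. This choice produces (R + 1 + s)^(-(\<alpha> - 1/p)), and
  \<open>strauss\<close> makes the total power -1, so the integral is logarithmic.\<close>

lemma (in mode_system) dyadic_sum_lower:
  fixes \<alpha> K \<theta> a t :: real
  assumes p: "1 < p" and R: "0 < R" and \<alpha>: "0 \<le> \<alpha> - 1 / p"
    and strauss: "\<alpha> * (2 - p) - (\<alpha> - 1 / p) = - 1"
    and K: "0 \<le> K" and \<theta>: "0 \<le> \<theta>" and a: "0 \<le> a" "a \<le> t" "t \<le> \<tau>"
    and m: "\<And>s. s \<in> {a..t} \<Longrightarrow> \<theta> * m t \<le> m s"
    and Q: "AE s in lborel. s \<in> {a..t} \<longrightarrow> K * (R + 1 + s) powr (\<alpha> * (2 - p)) \<le> Q s"
    and I: "2 * (R + 1 + t) \<le> 2 ^ I"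
  shows "2 powr (- (\<alpha> - 1 / p)) * exp (- 1) / 2 * \<theta> * K * (ln ((R + 1 + t) / (R + 1 + a)) - (t - a) / (R + 1 + t))
    \<le> (\<Sum>i<I. (1 / 2 ^ i) powr (\<alpha> - 1 / p + 1) * exp (- ((R + 1 + t) / 2 ^ i)) * Z (1 / 2 ^ i) t)"
proof -
  let ?q = "\<alpha> - 1 / p"
  let ?l = "\<lambda>i::nat. 1 / 2 ^ i :: real"
  let ?w = "\<lambda>s. K * (R + 1 + s) powr (\<alpha> * (2 - p))"
  let ?c = "2 powr (- ?q) * exp (- 1) / 2"
  let ?t = "R + 1 + t"
  have cw: "continuous_on {a..t} ?w"
    using R a by (intro continuous_intros) auto
  have w0: "0 \<le> ?w s" if "s \<in> {a..t}" for s using K by simp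
  have ci: "continuous_on {a..t} (\<lambda>s. ?w s * sinh (?l i * (t - s)) / ?l i)" for i
    by (intro continuous_intros cw) auto
  have Zi: "\<theta> * integral {a..t} (\<lambda>s. ?w s * sinh (?l i * (t - s)) / ?l i) \<le> Z (?l i) t" for i
    by (rule Z_Duhamel[OF _ a \<theta> m cw w0 Q]) auto
  have pt: "?c * K * (1 / (R + 1 + s) - 1 / ?t)
     \<le> (\<Sum>i<I. ?l i powr (?q + 1) * exp (- (?t / 2 ^ i)) * (?w s * sinh (?l i * (t - s)) / ?l i))" if s: "s \<in> {a..t}" for s
  proof -
    let ?s = "R + 1 + s"
    have s1: "1 \<le> ?s" using s a R by auto
    obtain i where i: "?s \<le> 2 ^ i" "2 ^ i < 2 * ?s" using ex_dyadic_scale[OF s1] .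
    \<comment> \<open>The size of \<open>I\<close> ensures that the scale chosen for any s up to t
      occurs in the sum.\<close>
    have "2 * ?s \<le> 2 * ?t" using s by simp
    with i(2) I have "(2::real) ^ i < 2 ^ I" by linarith
    then have iI: "i < I" by (rule power_less_imp_less_exp[rotated]) simp
    have l: "1 / (2 * ?s) \<le> ?l i" "?l i * ?s \<le> 1"
      using i s1 by (auto simp: field_simps)
    have nonneg: "0 \<le> ?l i powr (?q + 1) * exp (- (?t / 2 ^ i)) * (?w s * sinh (?l i * (t - s)) / ?l i)" for i
      using s K by (intro mult_nonneg_nonneg divide_nonneg_nonneg) auto
    have "?l i powr (?q + 1) = ?l i powr ?q * ?l i" by (simp add: powr_add)
    then have "?l i powr (?q + 1) * exp (- (?t / 2 ^ i)) * (?w s * sinh (?l i * (t - s)) / ?l i)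
      = ?w s * (?l i powr ?q * (exp (- (?t / 2 ^ i)) * sinh (?l i * (t - s))))" by simp
    also have "\<dots> \<ge> ?w s * ((2 powr (- ?q) * ?s powr (- ?q)) * (exp (- 1) / 2 * ((t - s) / ?t)))"
    proof (rule mult_left_mono[OF mult_mono])
      have "2 powr (- ?q) * ?s powr (- ?q) = (1 / (2 * ?s)) powr ?q"
        by (simp only: powr_divide powr_mult powr_minus powr_one_eq_one) (simp add: divide_inverse)
      also have "\<dots> \<le> ?l i powr ?q" using l(1) s1 \<alpha> by (intro powr_mono2) auto
      finally show "2 powr (- ?q) * ?s powr (- ?q) \<le> ?l i powr ?q" .
      have eqn1: "exp (- (?t / 2 ^ i)) * sinh (?l i * (t - s)) = exp (- (?l i * ?s)) * (1 - exp (- (2 * ?l i * (t - s)))) / 2"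
      proof -
        have "exp (- (?t / 2 ^ i)) * exp (?l i * (t - s)) = exp (- (?l i * ?s))"
          "exp (- (?t / 2 ^ i)) * exp (- (?l i * (t - s))) = exp (- (?l i * ?s)) * exp (- (2 * ?l i * (t - s)))"
          by (simp_all only: exp_add[symmetric]) (simp_all add: field_simps)
        then show ?thesis by (simp add: sinh_def right_diff_distrib)
      qed
      have "exp (- 1) \<le> exp (- (?l i * ?s))" using l(2) by simp
      \<comment> \<open>By 1 - exp (- z) \<ge> z/(1 + z) with z = (t - s)/(R + 1 + s); here z/(1 +
        z) is exactly (t - s)/(R + 1 + t).\<close>
      moreover have "(t - s) / ?t \<le> 1 - exp (- (2 * ?l i * (t - s)))"
      proof -
        define z where "z = (t - s) / ?s"
        have z: "0 \<le> z" using s s1 by (simp add: z_def)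
        have "z \<le> 2 * ?l i * (t - s)"
        proof -
          have "(1 / ?s) * (t - s) \<le> (2 * ?l i) * (t - s)"
            using l(1) s s1 by (intro mult_right_mono) (auto simp: field_simps)
          then show ?thesis by (simp add: z_def)
        qed
        then have "exp (- (2 * ?l i * (t - s))) \<le> exp (- z)" by simp
        also have "\<dots> \<le> 1 / (1 + z)"
          using exp_ge_add_one_self[of z] z by (simp add: exp_minus field_simps)
        finally have "1 - 1 / (1 + z) \<le> 1 - exp (- (2 * ?l i * (t - s)))" by simp
        moreover have "1 - 1 / (1 + z) = (t - s) / ?t"
        proof -
          have "1 + z = ?t / ?s" using s1 by (simp add: z_def field_simps)
          then have "1 / (1 + z) = ?s / ?t" by simp
          moreover have "1 - ?s / ?t = (t - s) / ?t" using s1 s by (simp add: divide_simps)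
          ultimately show ?thesis by simp
        qed
        ultimately show ?thesis by simp
      qed
      moreover have "0 \<le> (t - s) / ?t" using s s1 by (intro divide_nonneg_nonneg) auto
      ultimately have "exp (- 1) * ((t - s) / ?t) \<le> exp (- (?l i * ?s)) * (1 - exp (- (2 * ?l i * (t - s))))"
        by (intro mult_mono) auto
      then have "exp (- 1) * ((t - s) / ?t) / 2 \<le> exp (- (?l i * ?s)) * (1 - exp (- (2 * ?l i * (t - s)))) / 2"
        by (rule divide_right_mono) simp
      then show "exp (- 1) / 2 * ((t - s) / ?t) \<le> exp (- (?t / 2 ^ i)) * sinh (?l i * (t - s))"
        unfolding eqn1 by (simp only: times_divide_eq_left)
      show "0 \<le> exp (- 1) / 2 * ((t - s) / ?t)" using s s1 by simp
    qed (use w0[OF s] in auto)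
    also have "?w s * ((2 powr (- ?q) * ?s powr (- ?q)) * (exp (- 1) / 2 * ((t - s) / ?t)))
      = ?c * K * ((?s powr (\<alpha> * (2 - p)) * ?s powr (- ?q)) * ((t - s) / ?t))" by simp
    also have "?s powr (\<alpha> * (2 - p)) * ?s powr (- ?q) = ?s powr (- 1)"
      using strauss by (simp only: powr_add[symmetric] diff_conv_add_uminus)
    also have "\<dots> * ((t - s) / ?t) = 1 / ?s - 1 / ?t"
    proof -
      have "?s powr (- 1) = 1 / ?s" using s1 by (simp add: powr_minus_divide)
      moreover have "1 / ?s * ((t - s) / ?t) = 1 / ?s - 1 / ?t"
        using s1 s by (simp add: divide_simps)
      ultimately show ?thesis by simp
    qed
    finally have "?c * K * (1 / ?s - 1 / ?t) \<le> ?l i powr (?q + 1) * exp (- (?t / 2 ^ i)) * (?w s * sinh (?l i * (t - s)) / ?l i)" .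
    also have "\<dots> \<le> (\<Sum>i<I. ?l i powr (?q + 1) * exp (- (?t / 2 ^ i)) * (?w s * sinh (?l i * (t - s)) / ?l i))"
      by (rule member_le_sum) (use iI nonneg in auto)
    finally show ?thesis .
  qed
  have "((\<lambda>s. 1 / (R + 1 + s) - 1 / ?t) has_integral (ln ?t - t / ?t) - (ln (R + 1 + a) - a / ?t)) {a..t}"
    using a R by (intro fundamental_theorem_of_calculus)
      (auto simp: has_real_derivative_iff_has_vector_derivative[symmetric] intro!: derivative_eq_intros)
  moreover have "(ln ?t - t / ?t) - (ln (R + 1 + a) - a / ?t) = ln (?t / (R + 1 + a)) - (t - a) / ?t"
    using a R by (simp add: ln_div diff_divide_distrib)
  ultimately have "((\<lambda>s. 1 / (R + 1 + s) - 1 / ?t) has_integral ln (?t / (R + 1 + a)) - (t - a) / ?t) {a..t}"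
    by (simp only:)
  then have hi: "((\<lambda>s. ?c * K * (1 / (R + 1 + s) - 1 / ?t)) has_integral
      ?c * K * (ln (?t / (R + 1 + a)) - (t - a) / ?t)) {a..t}"
    by (rule has_integral_mult_right)
  have cs: "continuous_on {a..t} (\<lambda>s. \<Sum>i<I. ?l i powr (?q + 1) * exp (- (?t / 2 ^ i)) * (?w s * sinh (?l i * (t - s)) / ?l i))"
    by (intro continuous_on_sum continuous_on_mult_left ci)
  have "?c * K * (ln (?t / (R + 1 + a)) - (t - a) / ?t)
    \<le> integral {a..t} (\<lambda>s. \<Sum>i<I. ?l i powr (?q + 1) * exp (- (?t / 2 ^ i)) * (?w s * sinh (?l i * (t - s)) / ?l i))"
    unfolding integral_unique[OF hi, symmetric]
    by (rule integral_le[OF has_integral_integrable[OF hi] integrable_continuous_real[OF cs] pt])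
  also have "\<dots> = (\<Sum>i<I. integral {a..t} (\<lambda>s. ?l i powr (?q + 1) * exp (- (?t / 2 ^ i)) * (?w s * sinh (?l i * (t - s)) / ?l i)))"
    by (rule Henstock_Kurzweil_Integration.integral_sum)
      (intro finite_lessThan integrable_continuous_real continuous_on_mult_left ci)+
  also have "\<dots> = (\<Sum>i<I. ?l i powr (?q + 1) * exp (- (?t / 2 ^ i)) * integral {a..t} (\<lambda>s. ?w s * sinh (?l i * (t - s)) / ?l i))"
    by (simp only: integral_mult_right)
  finally have "\<theta> * (?c * K * (ln (?t / (R + 1 + a)) - (t - a) / ?t))
    \<le> \<theta> * (\<Sum>i<I. ?l i powr (?q + 1) * exp (- (?t / 2 ^ i)) * integral {a..t} (\<lambda>s. ?w s * sinh (?l i * (t - s)) / ?l i))"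
    by (intro mult_left_mono \<theta>)
  also have "\<dots> = (\<Sum>i<I. ?l i powr (?q + 1) * exp (- (?t / 2 ^ i)) * (\<theta> * integral {a..t} (\<lambda>s. ?w s * sinh (?l i * (t - s)) / ?l i)))"
    by (simp only: sum_distrib_left mult_ac)
  also have "\<dots> \<le> (\<Sum>i<I. ?l i powr (?q + 1) * exp (- (?t / 2 ^ i)) * Z (?l i) t)"
    by (intro sum_mono mult_left_mono Zi) auto
  finally show ?thesis by (simp add: mult_ac)
qed

text \<open>If X \<ge> D from some time on, then X \<ge> 2 D after a delay l with B D^(p-1) min(l,
  l^2) \<ge> 2. As D doubles, the delays may shrink geometrically and have finite total length; on a
  longer interval X(b) would exceed 2^j D0 for every j. The quadratic branch of the minimum is the
  origin of the square root.\<close>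

lemma doubling_bound:
  fixes p :: real
  assumes p: "1 < p"
  obtains C where "0 < C" "\<And>X a b B D0. a \<le> b \<Longrightarrow> 0 < B \<Longrightarrow> 0 < D0 \<Longrightarrow>
    (\<And>t. t \<in> {a..b} \<Longrightarrow> D0 \<le> X t) \<Longrightarrow>
    (\<And>D t0 t. 0 < D \<Longrightarrow> a \<le> t0 \<Longrightarrow> t0 \<le> t \<Longrightarrow> t \<le> b \<Longrightarrow> (\<And>s. s \<in> {t0..t} \<Longrightarrow> D \<le> X s) \<Longrightarrow>
      B * D powr p * min (t - t0) ((t - t0)\<^sup>2) \<le> X t) \<Longrightarrow>
    b - a \<le> C * (1 / (B * D0 powr (p - 1)) + sqrt (1 / (B * D0 powr (p - 1))))"
proof -
  \<comment> \<open>\<gamma>^2 = 2^(-(p-1)) is the factor by which the required min(l, l^2) drops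
    when D doubles.\<close>
  define \<gamma> where "\<gamma> = 2 powr (- (p - 1) / 2)"
  have g: "0 < \<gamma>" "\<gamma> < 1" using p by (auto simp: \<gamma>_def powr_less_one)
  show thesis
  proof
    show "0 < 2 / (1 - \<gamma>)" using g by simp
    fix X :: "real \<Rightarrow> real" and a b B D0 :: real
    assume ab: "a \<le> b" and B: "0 < B" and D0: "0 < D0" and X0: "\<And>t. t \<in> {a..b} \<Longrightarrow> D0 \<le> X t"
      and step: "\<And>D t0 t. 0 < D \<Longrightarrow> a \<le> t0 \<Longrightarrow> t0 \<le> t \<Longrightarrow> t \<le> b \<Longrightarrow> (\<And>s. s \<in> {t0..t} \<Longrightarrow> D \<le> X s) \<Longrightarrow>
        B * D powr p * min (t - t0) ((t - t0)\<^sup>2) \<le> X t"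
    define K where "K = 1 / (B * D0 powr (p - 1))"
    have K: "0 < K" using B D0 by (simp add: K_def)
    \<comment> \<open>The j-th delay is S \<gamma>^j, and both branches of the minimum must reach 2
      K \<gamma>^(2j): the summand 2 K serves the linear branch, 2 sqrt K the quadratic one.\<close>
    define S where "S = 2 * K + 2 * sqrt K"
    have S: "0 < S" using K by (simp add: S_def add_pos_pos)
    show "b - a \<le> 2 / (1 - \<gamma>) * (1 / (B * D0 powr (p - 1)) + sqrt (1 / (B * D0 powr (p - 1))))"
    proof (rule ccontr)
      assume "\<not> ?thesis"
      then have "2 / (1 - \<gamma>) * (K + sqrt K) < b - a" by (simp only: K_def not_le)
      moreover have "2 / (1 - \<gamma>) * (K + sqrt K) = S / (1 - \<gamma>)" by (simp add: S_def)
      ultimately have big: "S / (1 - \<gamma>) < b - a" by (simp only:)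
      define \<sigma> where "\<sigma> j = (\<Sum>i<j. S * \<gamma> ^ i)" for j :: nat
      have \<sigma>: "\<sigma> j < b - a" for j
      proof -
        have "\<sigma> j = S * ((1 - \<gamma> ^ j) / (1 - \<gamma>))"
          unfolding \<sigma>_def sum_distrib_left[symmetric] using g by (subst sum_gp_strict) simp
        also have "\<dots> \<le> S * (1 / (1 - \<gamma>))"
          using S g by (intro mult_left_mono divide_right_mono) auto
        finally show ?thesis using big by simp
      qed
      have \<sigma>0: "0 \<le> \<sigma> j" for j unfolding \<sigma>_def using S g by (intro sum_nonneg) auto
      have ind: "\<forall>t\<in>{a + \<sigma> j..b}. 2 ^ j * D0 \<le> X t" for j
      proof (induction j)
        case 0 then show ?case using X0 by (simp add: \<sigma>_def)
      next
        case (Suc j)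
        show ?case
        proof
          fix t assume t: "t \<in> {a + \<sigma> (Suc j)..b}"
          let ?D = "2 ^ j * D0" and ?l = "S * \<gamma> ^ j"
          have D: "0 < ?D" using D0 by simp
          have l: "0 < ?l" using S g by simp
          have "?l \<le> t - (a + \<sigma> j)" using t by (simp add: \<sigma>_def)
          then have m: "min ?l (?l\<^sup>2) \<le> min (t - (a + \<sigma> j)) ((t - (a + \<sigma> j))\<^sup>2)"
            using l by (intro min.mono power_mono) auto
          have \<gamma>j: "\<gamma> ^ j * \<gamma> ^ j = (2 ^ j) powr (- (p - 1))"
          proof -
            have "\<gamma> ^ j * \<gamma> ^ j = (\<gamma> * \<gamma>) ^ j" by (simp add: power_mult_distrib)
            also have "\<gamma> * \<gamma> = 2 powr (- (p - 1))" by (simp add: \<gamma>_def powr_add[symmetric])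
            finally show ?thesis by (simp add: powr_realpow[symmetric] powr_powr mult.commute)
          qed
          have key: "2 * ?D = B * ?D powr p * (2 * K * (\<gamma> ^ j * \<gamma> ^ j))"
          proof -
            have "?D powr p = ?D * ?D powr (p - 1)"
              using D powr_add[of ?D 1 "p - 1"] by simp
            also have "?D powr (p - 1) = (2 ^ j) powr (p - 1) * D0 powr (p - 1)" by (rule powr_mult)
            finally have "B * ?D powr p * (2 * K * (\<gamma> ^ j * \<gamma> ^ j))
              = 2 * ?D * ((2 ^ j) powr (p - 1) * (2 ^ j) powr (- (p - 1))) * (B * D0 powr (p - 1) * K)"
              unfolding \<gamma>j by (simp only: mult_ac)
            also have "(2 ^ j) powr (p - 1) * (2 ^ j) powr (- (p - 1)) = (1::real)"
              by (simp only: powr_add[symmetric]) simp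
            also have "B * D0 powr (p - 1) * K = 1" using B D0 by (simp add: K_def)
            finally show ?thesis by simp
          qed
          have "2 * K * (\<gamma> ^ j * \<gamma> ^ j) \<le> min ?l (?l\<^sup>2)"
          proof (rule min.boundedI)
            have "\<gamma> ^ j \<le> 1" using g by (simp add: power_le_one)
            then have "\<gamma> ^ j * \<gamma> ^ j \<le> 1 * \<gamma> ^ j" using g by (intro mult_right_mono) auto
            then have "2 * K * (\<gamma> ^ j * \<gamma> ^ j) \<le> 2 * K * \<gamma> ^ j" using K by simp
            also have "\<dots> \<le> ?l" using K g by (intro mult_right_mono) (auto simp: S_def)
            finally show "2 * K * (\<gamma> ^ j * \<gamma> ^ j) \<le> ?l" .
            have "2 * K \<le> (2 * sqrt K)\<^sup>2" using K by (simp add: power_mult_distrib)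
            also have "\<dots> \<le> S\<^sup>2" using K by (intro power_mono) (auto simp: S_def)
            finally have "2 * K * (\<gamma> ^ j * \<gamma> ^ j) \<le> S\<^sup>2 * (\<gamma> ^ j * \<gamma> ^ j)"
              using g by (intro mult_right_mono) auto
            then show "2 * K * (\<gamma> ^ j * \<gamma> ^ j) \<le> ?l\<^sup>2" by (simp add: power2_eq_square mult_ac)
          qed
          with m have "2 * K * (\<gamma> ^ j * \<gamma> ^ j) \<le> min (t - (a + \<sigma> j)) ((t - (a + \<sigma> j))\<^sup>2)" by linarith
          then have "2 * ?D \<le> B * ?D powr p * min (t - (a + \<sigma> j)) ((t - (a + \<sigma> j))\<^sup>2)"
            unfolding key using B by (intro mult_left_mono) auto
          also have "\<dots> \<le> X t"
          proof (rule step[OF D])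
            show "?D \<le> X s" if "s \<in> {a + \<sigma> j..t}" for s using Suc that t by auto
          qed (use \<sigma>0[of j] t l in \<open>auto simp: \<sigma>_def\<close>)
          finally show "2 ^ Suc j * D0 \<le> X t" by simp
        qed
      qed
      obtain j :: nat where "X b / D0 < 2 ^ j" using real_arch_pow[of 2 "X b / D0"] by auto
      then have "X b < 2 ^ j * D0" using D0 by (simp add: field_simps)
      moreover have "2 ^ j * D0 \<le> X b" using ind[of j] \<sigma>[of j] by auto
      ultimately show False by simp
    qed
  qed
qed

section \<open>Iterated logarithms and the lifespan bound in logarithmic time\<close>

text \<open>The description operator needs existence and uniqueness. The quadratic formula gives a
  positive root; for two different positive roots x and y the equation would give a x y = -1 with a
  > 0. Finally p \<le> 1 would force 1 + p \<le> 0.\<close>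

lemma strauss_exponent_root:
  assumes n: "2 \<le> n" and p: "p = strauss_exponent n"
  shows "1 < p" "1 + (real n + 1) / 2 * p - (real n - 1) / 2 * p\<^sup>2 = 0"
proof -
  let ?a = "(real n - 1) / 2" and ?b = "(real n + 1) / 2"
  let ?P = "\<lambda>p. 0 < p \<and> 1 + ?b * p - ?a * p\<^sup>2 = 0"
  define d where "d = sqrt (?b\<^sup>2 + 4 * ?a)"
  have a: "0 < ?a" and b: "0 < ?b" using n by auto
  have d: "d\<^sup>2 = ?b\<^sup>2 + 4 * ?a" unfolding d_def using a by (intro real_sqrt_pow2) simp
  have "0 \<le> d" unfolding d_def by (rule real_sqrt_ge_zero) (use a in simp)
  define r where "r = (?b + d) / (2 * ?a)"
  have r0: "0 < r" unfolding r_def by (rule divide_pos_pos) (use a b \<open>0 \<le> d\<close> in linarith)+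
  have "2 * A * ((?b + d) / (2 * A)) = ?b + d" if "0 < A" for A using that by simp
  from this[OF a] have "2 * ?a * r = ?b + d" by (simp only: r_def)
  then have "2 * ?a * r - ?b = d" by (simp only: add_diff_cancel_left')
  then have "(2 * ?a * r - ?b)\<^sup>2 = ?b\<^sup>2 + 4 * ?a" using d by (simp only:)
  moreover have "4 * A * (1 + B * r - A * r\<^sup>2) = (B\<^sup>2 + 4 * A) - (2 * A * r - B)\<^sup>2" for A B
    by (simp add: power2_eq_square algebra_simps)
  ultimately have "4 * ?a * (1 + ?b * r - ?a * r\<^sup>2) = 0" by (simp only: diff_self)
  then have r: "1 + ?b * r - ?a * r\<^sup>2 = 0" using a by simp
  have uniq: "x = y" if "?P x" "?P y" for x y :: real
  proof -
    have "(x - y) * (B - A * (x + y)) = (1 + B * x - A * x\<^sup>2) - (1 + B * y - A * y\<^sup>2)" for A B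
      by (simp add: power2_eq_square algebra_simps)
    also have "(1 + ?b * x - ?a * x\<^sup>2) - (1 + ?b * y - ?a * y\<^sup>2) = 0" using that by simp
    finally have "x = y \<or> ?b - ?a * (x + y) = 0" by simp
    moreover have "?b - ?a * (x + y) \<noteq> 0"
    proof
      assume "?b - ?a * (x + y) = 0"
      then have "x * (?b - ?a * (x + y)) = 0" by simp
      moreover have "x * (B - A * (x + y)) = (B * x - A * x\<^sup>2) - A * (x * y)" for A B
        by (simp add: power2_eq_square algebra_simps)
      ultimately have "?b * x - ?a * x\<^sup>2 = ?a * (x * y)" by (simp only: eq_iff_diff_eq_0[symmetric])
      moreover have "0 < ?a * (x * y)" using a that by simp
      ultimately show False using that by linarith
    qed
    ultimately show ?thesis by blast
  qed
  have "?P p" unfolding p strauss_exponent_def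
    by (rule theI'[of ?P]) (use r0 r uniq in blast)
  then show eq: "1 + ?b * p - ?a * p\<^sup>2 = 0" and "1 < p"
  proof -
    assume P: "?P p"
    show "1 + ?b * p - ?a * p\<^sup>2 = 0" using P by simp
    show "1 < p"
    proof (rule ccontr)
      assume "\<not> 1 < p"
      then have "p\<^sup>2 \<le> p" using P by (simp add: power2_eq_square mult_left_le)
      then have "?a * p\<^sup>2 \<le> ?a * p" using a by (intro mult_left_mono) auto
      then have "1 + ?b * p - ?a * p \<le> 0" using P by linarith
      moreover have "?b * p - ?a * p = p" by (simp add: field_simps)
      ultimately show False using P by linarith
    qed
  qed
qed

text \<open>The quadratic divided by p. The first identity balances the power \<alpha> (2 - p) of
  the Hoelder bound against the weight of the modes; the second makes that weight monotone in the
  frequency.\<close>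

lemma strauss_identities:
  fixes \<alpha> p :: real
  assumes "1 < p" "1 + (real n + 1) / 2 * p - (real n - 1) / 2 * p\<^sup>2 = 0" "\<alpha> = (real n - 1) / 2" "2 \<le> n"
  shows "\<alpha> * (2 - p) - (\<alpha> - 1 / p) = - 1" "0 \<le> \<alpha> - 1 / p"
proof -
  have e: "1 + (\<alpha> + 1) * p - \<alpha> * p\<^sup>2 = 0" using assms(2) by (simp add: assms(3) field_simps)
  then have "1 / p = \<alpha> * p - (\<alpha> + 1)"
    using assms(1) by (simp add: field_simps power2_eq_square)
  then show 1: "\<alpha> * (2 - p) - (\<alpha> - 1 / p) = - 1" by (simp add: algebra_simps)
  have "\<alpha> * p = \<alpha> + 1 + 1 / p" using 1 by (simp add: algebra_simps)
  moreover have "0 < 1 / p" "0 \<le> \<alpha>" using assms by auto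
  ultimately have "1 \<le> \<alpha> * p" by linarith
  then show "0 \<le> \<alpha> - 1 / p" using assms(1) by (simp add: field_simps)
qed

section \<open>Iterated logarithms and the integrating factor of the damping\<close>

lemma iter_e_Suc: "iter_e (Suc k) = exp (iter_e k)" and iter_e_0: "iter_e 0 = 1"
  by (simp_all add: iter_e_def)

lemma iter_ln_Suc: "iter_ln (Suc k) r = ln (iter_ln k r)" and iter_ln_0: "iter_ln 0 r = r"
  by (simp_all add: iter_ln_def)

lemma iter_e_ge_1: "1 \<le> iter_e k"
proof (induction k)
  case (Suc k)
  then show ?case using exp_ge_add_one_self[of "iter_e k"] by (simp add: iter_e_Suc)
qed (simp add: iter_e_0)

lemma iter_ln_ge: "j \<le> k \<Longrightarrow> iter_e k \<le> r \<Longrightarrow> iter_e (k - j) \<le> iter_ln j r"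
proof (induction j)
  case (Suc j)
  then have "iter_e (Suc (k - Suc j)) \<le> iter_ln j r" by (simp add: Suc_diff_Suc)
  then have "exp (iter_e (k - Suc j)) \<le> iter_ln j r" by (simp add: iter_e_Suc)
  then show ?case by (simp add: iter_ln_Suc ln_ge_iff less_le_trans[OF exp_gt_zero])
qed (simp add: iter_ln_0)

lemma iter_ln_ge_1: "j \<le> k \<Longrightarrow> iter_e k \<le> r \<Longrightarrow> 1 \<le> iter_ln j r"
  using iter_ln_ge[of j k r] iter_e_ge_1[of "k - j"] by linarith

lemma iter_ln_deriv:
  assumes "j \<le> k" "iter_e k \<le> r"
  shows "(iter_ln j has_real_derivative 1 / (\<Prod>i<j. iter_ln i r)) (at r)"
  using assms(1)
proof (induction j)
  case 0
  have "iter_ln 0 = (\<lambda>r. r)" by (simp add: fun_eq_iff iter_ln_0)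
  then show ?case by simp
next
  case (Suc j)
  have pos: "0 < iter_ln j r" using iter_ln_ge_1[of j k r] Suc assms by simp
  have "iter_ln (Suc j) = (\<lambda>r. ln (iter_ln j r))" by (simp add: fun_eq_iff iter_ln_Suc)
  moreover have "((\<lambda>r. ln (iter_ln j r)) has_real_derivative 1 / iter_ln j r * (1 / (\<Prod>i<j. iter_ln i r))) (at r)"
    by (rule DERIV_chain2[where f = ln and g = "iter_ln j", OF DERIV_ln_divide[OF pos]]) (use Suc in simp)
  ultimately show ?case by (simp add: mult.commute)
qed

text \<open>The first logarithm turns the square into a factor 2. At later levels 2 a \<le> a^2 for
  a \<ge> 2, so a factor 2 is again at most a square and passes through the next logarithm as a
  factor 2. The base point \<open>iter_e k\<close> guarantees a \<ge> 2 at the levels below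
  k.\<close>

lemma iter_ln_slowly_varying:
  assumes "1 \<le> k" "iter_e k \<le> y" "y \<le> x" "x \<le> y\<^sup>2"
  shows "iter_ln k x \<le> 2 * iter_ln k y"
proof -
  have "iter_ln j x \<le> (if j = 0 then (iter_ln j y)\<^sup>2 else 2 * iter_ln j y)" if "j \<le> k" for j
    using that
  proof (induction j)
    case 0 then show ?case using assms by (simp add: iter_ln_0)
  next
    case (Suc j)
    have y1: "1 \<le> iter_ln j y" and x1: "1 \<le> iter_ln j x"
      using iter_ln_ge_1[of j k] Suc assms by auto
    have "iter_ln j x \<le> (iter_ln j y)\<^sup>2"
    proof (cases "j = 0")
      case True then show ?thesis using Suc by simp
    next
      case False
      have "exp (iter_e (k - Suc j)) \<le> iter_ln j y"
        using iter_ln_ge[of j k y] Suc assms by (simp add: Suc_diff_Suc iter_e_Suc[symmetric])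
      moreover have "2 \<le> exp (iter_e (k - Suc j))"
        using exp_ge_add_one_self[of "iter_e (k - Suc j)"] iter_e_ge_1[of "k - Suc j"] by linarith
      ultimately have "2 \<le> iter_ln j y" by linarith
      then have "2 * iter_ln j y \<le> iter_ln j y * iter_ln j y" by (intro mult_right_mono) auto
      then show ?thesis using Suc False by (simp add: power2_eq_square)
    qed
    then have "ln (iter_ln j x) \<le> ln ((iter_ln j y)\<^sup>2)"
      by (subst ln_le_cancel_iff) (use x1 y1 in auto)
    also have "\<dots> = 2 * ln (iter_ln j y)" using y1 by (simp add: ln_realpow)
    finally show ?case by (simp add: iter_ln_Suc)
  qed
  from this[of k] show ?thesis using assms by simp
qed

text \<open>This is the exponential of the integral of \<open>damping \<mu> k\<close> over [0, t]:
  the k-fold logarithm has derivative 1 over the product of all lower ones, and the shift by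
  \<open>iter_e k\<close> normalizes the value at 0 to 1.\<close>

definition damping_weight :: "real \<Rightarrow> nat \<Rightarrow> real \<Rightarrow> real" where
  "damping_weight \<mu> k t = iter_ln k (iter_e k + t) powr \<mu>"

lemma damping_weight_0: "damping_weight \<mu> k 0 = 1"
proof -
  have "j \<le> k \<Longrightarrow> iter_ln j (iter_e k) = iter_e (k - j)" for j
  proof (induction j)
    case (Suc j)
    then have "iter_ln j (iter_e k) = exp (iter_e (k - Suc j))"
      by (simp add: Suc_diff_Suc iter_e_Suc[symmetric])
    then show ?case by (simp add: iter_ln_Suc)
  qed (simp add: iter_ln_0)
  from this[of k] show ?thesis by (simp add: damping_weight_def iter_e_0)
qed

lemma damping_weight_pos: "0 \<le> t \<Longrightarrow> 0 < damping_weight \<mu> k t"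
  using iter_ln_ge_1[of k k "iter_e k + t"] by (simp add: damping_weight_def)

lemma damping_weight_ge_1: "0 \<le> t \<Longrightarrow> 0 \<le> \<mu> \<Longrightarrow> 1 \<le> damping_weight \<mu> k t"
  using iter_ln_ge_1[of k k "iter_e k + t"] by (simp add: damping_weight_def ge_one_powr_ge_zero)

lemma damping_eq:
  "damping \<mu> k t = \<mu> / (\<Prod>j<Suc k. iter_ln j (iter_e k + t))"
proof -
  have "(\<Prod>j<Suc k. iter_ln j (iter_e k + t)) = (iter_e k + t) * (\<Prod>j=1..k. iter_ln j (iter_e k + t))"
    unfolding lessThan_Suc_atMost atMost_atLeast0
    by (subst prod.atLeast_Suc_atMost) (simp_all add: iter_ln_0)
  then show ?thesis by (simp add: damping_def)
qed

lemma iter_ln_pos: "0 \<le> t \<Longrightarrow> j \<le> k \<Longrightarrow> 0 < iter_ln j (iter_e k + t)"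
  using iter_ln_ge_1[of j k "iter_e k + t"] by simp

lemma damping_nonneg: "0 \<le> \<mu> \<Longrightarrow> 0 \<le> t \<Longrightarrow> 0 \<le> damping \<mu> k t"
  unfolding damping_eq by (intro divide_nonneg_nonneg prod_nonneg) (auto intro: less_imp_le[OF iter_ln_pos])

lemma iter_ln_continuous_on: "j \<le> k \<Longrightarrow> continuous_on {0..} (\<lambda>t. iter_ln j (iter_e k + t))"
proof (rule continuous_at_imp_continuous_on, intro ballI)
  fix t :: real assume "j \<le> k" "t \<in> {0..}"
  then have "isCont (iter_ln j) (iter_e k + t)"
    using iter_ln_deriv[of j k "iter_e k + t"] by (auto intro: DERIV_isCont)
  moreover have "isCont (\<lambda>t. iter_e k + t) t" by simp
  ultimately show "isCont (\<lambda>t. iter_ln j (iter_e k + t)) t"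
    by (intro isCont_o2[where f = "\<lambda>t. iter_e k + t" and g = "iter_ln j"])
qed

lemma damping_continuous: "continuous_on {0..\<tau>} (damping \<mu> k)"
proof -
  have "continuous_on {0..\<tau>} (\<lambda>t. \<mu> / (\<Prod>j<Suc k. iter_ln j (iter_e k + t)))"
  proof (intro continuous_on_divide continuous_on_const continuous_on_prod)
    show "continuous_on {0..\<tau>} (\<lambda>t. iter_ln j (iter_e k + t))" if "j \<in> {..<Suc k}" for j
      by (rule continuous_on_subset[OF iter_ln_continuous_on]) (use that in auto)
    have "0 < (\<Prod>j<Suc k. iter_ln j (iter_e k + t))" if "t \<in> {0..\<tau>}" for t
      by (rule prod_pos) (use that in \<open>auto intro: iter_ln_pos\<close>)
    then show "\<forall>t\<in>{0..\<tau>}. (\<Prod>j<Suc k. iter_ln j (iter_e k + t)) \<noteq> 0"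
      by (intro ballI) (rule less_imp_neq[symmetric])
  qed
  moreover have "damping \<mu> k = (\<lambda>t. \<mu> / (\<Prod>j<Suc k. iter_ln j (iter_e k + t)))"
    by (rule ext) (rule damping_eq)
  ultimately show ?thesis by (simp only:)
qed

lemma damping_weight_deriv:
  assumes "0 \<le> t"
  shows "(damping_weight \<mu> k has_real_derivative damping \<mu> k t * damping_weight \<mu> k t) (at t)"
proof -
  let ?r = "iter_e k + t"
  have pos: "0 < iter_ln k ?r" by (rule iter_ln_pos[OF assms order_refl])
  have d: "((\<lambda>t. iter_ln k (iter_e k + t)) has_real_derivative 1 / (\<Prod>i<k. iter_ln i ?r) * (0 + 1)) (at t)"
    by (rule DERIV_chain2[OF iter_ln_deriv[OF order_refl]])
      (use assms in simp, rule DERIV_add[OF DERIV_const DERIV_ident])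
  have "((\<lambda>t. iter_ln k (iter_e k + t) powr \<mu>) has_real_derivative
      (\<mu> * iter_ln k ?r powr (\<mu> - 1)) * (1 / (\<Prod>i<k. iter_ln i ?r) * (0 + 1))) (at t)"
    by (rule DERIV_chain2[OF has_real_derivative_powr[OF pos] d])
  also have "iter_ln k ?r powr (\<mu> - 1) = iter_ln k ?r powr \<mu> / iter_ln k ?r"
    using pos by (simp add: powr_diff)
  finally show ?thesis
    by (simp add: damping_weight_def[abs_def] damping_eq mult.commute)
qed

lemma damping_weight_slowly_varying:
  assumes "1 \<le> k" "0 < \<mu>" "1 \<le> \<tau>" "s \<in> {sqrt \<tau>..\<tau>}"
  shows "2 powr (- \<mu>) * damping_weight \<mu> k \<tau> \<le> damping_weight \<mu> k s"
proof -
  let ?E = "iter_e k"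
  have E: "1 \<le> ?E" by (rule iter_e_ge_1)
  have s0: "0 \<le> sqrt \<tau>" using assms by simp
  then have s: "0 \<le> s" using assms(4) by (auto intro: order_trans[OF s0])
  have "\<tau> = (sqrt \<tau>)\<^sup>2" using assms by simp
  also have "\<dots> \<le> s\<^sup>2" using assms s0 by (intro power_mono) auto
  finally have "\<tau> \<le> s\<^sup>2" .
  moreover have "?E \<le> ?E\<^sup>2" using E by (simp add: power2_eq_square)
  moreover have "0 \<le> ?E * s" using E s by simp
  ultimately have "?E + \<tau> \<le> (?E + s)\<^sup>2" by (simp add: power2_sum)
  then have le: "iter_ln k (?E + \<tau>) \<le> 2 * iter_ln k (?E + s)"
    using assms s by (intro iter_ln_slowly_varying) auto
  have "damping_weight \<mu> k \<tau> \<le> (2 * iter_ln k (?E + s)) powr \<mu>"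
    unfolding damping_weight_def using iter_ln_pos[of \<tau> k k] assms by (intro powr_mono2 le) auto
  also have "\<dots> = 2 powr \<mu> * damping_weight \<mu> k s"
    by (simp add: damping_weight_def powr_mult)
  finally show ?thesis by (simp add: powr_minus field_simps)
qed

text \<open>The kernel of the critical feedback in logarithmic time: quadratic for small l and
  linear for large l, which is the shape that \<open>doubling_bound\<close> expects.\<close>

lemma exp_minus_kernel_lower:
  fixes l :: real
  assumes "0 \<le> l"
  shows "min l (l\<^sup>2) / 4 \<le> l - 1 + exp (- l)"
proof (cases "l \<le> 2")
  case True
  have "(1 - l / 2)\<^sup>2 \<le> (exp (- l / 2))\<^sup>2"
    using exp_ge_add_one_self[of "- l / 2"] True by (intro power_mono) auto
  also have "\<dots> = exp (- l)" by (simp add: power2_eq_square exp_add[symmetric])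
  finally have "1 - l + l\<^sup>2 / 4 \<le> exp (- l)" by (simp add: power2_eq_square algebra_simps)
  then show ?thesis by (simp add: min_def)
next
  case False
  have "0 < exp (- l)" by simp
  then have "l / 4 \<le> l - 1 + exp (- l)" using False by linarith
  then show ?thesis by (simp add: min_def)
qed

text \<open>With L = ln \<tau>, the logarithmic times [L/2, L] correspond to [sqrt \<tau>, \<tau>],
  where \<theta> controls \<open>m\<close>. The data bound is integrated from just after L/2 and
  gives X of order (A/m)^p L on [3L/4, L]; doubling runs on this last quarter. The powers of L in
  its coefficient and its start value cancel, so L/4 is bounded in terms of (m/A)^(p(p-1))
  alone.\<close>

lemma log_lifespan_bound:
  fixes n :: nat and p R \<omega> \<theta> :: real
  assumes n: "2 \<le> n" and p: "1 < p"
    and strauss: "1 + (real n + 1) / 2 * p - (real n - 1) / 2 * p\<^sup>2 = 0"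
    and R: "0 < R" and \<omega>: "0 < \<omega>" and \<theta>: "0 < \<theta>"
  obtains C L0 where "0 < C" "0 < L0" "\<And>\<tau> A m Z Q. mode_system n p R \<omega> \<tau> A m Z Q \<Longrightarrow> L0 \<le> ln \<tau> \<Longrightarrow>
    (\<And>s. s \<in> {sqrt \<tau>..\<tau>} \<Longrightarrow> \<theta> * m \<tau> \<le> m s) \<Longrightarrow>
    ln \<tau> \<le> C * ((m \<tau> / A) powr (p * (p - 1)) + sqrt ((m \<tau> / A) powr (p * (p - 1))))"
proof -
  define \<alpha> where "\<alpha> = (real n - 1) / 2"
  note si = strauss_identities[OF p strauss \<alpha>_def n]
  obtain c1 where c1: "0 < c1" "\<And>\<tau> A m Z Q. mode_system n p R \<omega> \<tau> A m Z Q \<Longrightarrow>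
    AE s in lborel. s \<in> {1..\<tau>} \<longrightarrow>
      c1 * (A / m \<tau>) powr p * (R + 1 + s) powr (\<alpha> * (2 - p)) \<le> Q s"
    using Q_lower_initial[OF n p R \<omega> \<alpha>_def] by blast
  obtain c2 where c2: "0 < c2" "\<And>\<tau> A m Z Q. mode_system n p R \<omega> \<tau> A m Z Q \<Longrightarrow>
    AE s in lborel. s \<in> {0..\<tau>} \<longrightarrow> (\<forall>I D. 0 < D \<longrightarrow>
      D \<le> (\<Sum>i<I. (1 / 2 ^ i) powr (\<alpha> - 1 / p + 1) * exp (- ((R + 1 + s) / 2 ^ i)) * Z (1 / 2 ^ i) s) \<longrightarrow>
      c2 * D powr p * (R + 1 + s) powr (\<alpha> * (2 - p)) * ln (R + 1 + s) powr (- (p - 1)) \<le> Q s)"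
    using Q_lower_of_dyadic_sum[OF n p R \<omega> \<alpha>_def] by blast
  obtain Cd where Cd: "0 < Cd" "\<And>X a b B D0. a \<le> b \<Longrightarrow> 0 < B \<Longrightarrow> 0 < D0 \<Longrightarrow>
    (\<And>t. t \<in> {a..b} \<Longrightarrow> D0 \<le> X t) \<Longrightarrow>
    (\<And>D t0 t. 0 < D \<Longrightarrow> a \<le> t0 \<Longrightarrow> t0 \<le> t \<Longrightarrow> t \<le> b \<Longrightarrow> (\<And>s. s \<in> {t0..t} \<Longrightarrow> D \<le> X s) \<Longrightarrow>
      B * D powr p * min (t - t0) ((t - t0)\<^sup>2) \<le> X t) \<Longrightarrow>
    b - a \<le> Cd * (1 / (B * D0 powr (p - 1)) + sqrt (1 / (B * D0 powr (p - 1))))"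
    using doubling_bound[OF p] by blast
  define c3 where "c3 = 2 powr (- (\<alpha> - 1 / p)) * exp (- 1) / 2 * \<theta>"
  have c3: "0 < c3" using \<theta> by (simp add: c3_def)
  define C' where "C' = 1 / (c3 * c2 / 4 * (c3 * c1 / 8) powr (p - 1))"
  have C': "0 < C'" using c1 c2 c3 by (simp add: C'_def)
  \<comment> \<open>The entry 16 makes L/4 - 2 \<ge> L/8 in the first lower bound for
    \<open>X\<close>; the other entry gives R + 1 \<le> sqrt \<tau>.\<close>
  define L0 where "L0 = max 16 (2 * ln (R + 1))"
  show thesis
  proof
    show "0 < 4 * Cd * (C' + sqrt C')" using Cd C' by (simp add: add_pos_pos)
    show "0 < L0" by (simp add: L0_def)
    fix \<tau> A m Z Q
    assume ms: "mode_system n p R \<omega> \<tau> A m Z Q" and L0: "L0 \<le> ln \<tau>"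
      and mq: "\<And>s. s \<in> {sqrt \<tau>..\<tau>} \<Longrightarrow> \<theta> * m \<tau> \<le> m s"
    interpret mode_system n p R \<omega> \<tau> A m Z Q by (rule ms)
    define L where "L = ln \<tau>"
    define \<rho> where "\<rho> = R + 1"
    have \<rho>: "1 < \<rho>" using R by (simp add: \<rho>_def)
    have L: "16 \<le> L" "2 * ln \<rho> \<le> L" using L0 by (auto simp: L0_def L_def \<rho>_def)
    have \<tau>L: "\<tau> = exp L" using tau by (simp add: L_def)
    define a where "a = exp (L / 2)"
    have a: "a = sqrt \<tau>" by (simp add: a_def \<tau>L exp_half_le2 real_sqrt_unique[symmetric] power2_eq_square exp_add[symmetric])
    have a1: "1 \<le> a" using L by (simp add: a_def)
    have \<rho>a: "\<rho> \<le> a"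
    proof -
      have "ln \<rho> \<le> L / 2" using L by simp
      then have "exp (ln \<rho>) \<le> exp (L / 2)" by simp
      then show ?thesis using \<rho> by (simp add: a_def)
    qed
    \<comment> \<open>One number of scales serves all times up to \<tau>, so that \<open>U\<close>
      is a fixed finite sum.\<close>
    obtain I :: nat where I: "2 * (\<rho> + \<tau>) \<le> 2 ^ I"
      using real_arch_pow[of 2 "2 * (\<rho> + \<tau>)"] by (auto intro: less_imp_le)
    define U where "U t = (\<Sum>i<I. (1 / 2 ^ i) powr (\<alpha> - 1 / p + 1) * exp (- ((R + 1 + t) / 2 ^ i)) * Z (1 / 2 ^ i) t)" for t
    define X where "X x = U (exp x - \<rho>)" for x
    have low: "c3 * K * (x - y - 1 + exp y / exp x) \<le> X x" 
      if K: "0 \<le> K" and xy: "a \<le> exp y - \<rho>" "y \<le> x" "x \<le> L"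
        and Q: "AE s in lborel. s \<in> {exp y - \<rho>..exp x - \<rho>} \<longrightarrow> K * (R + 1 + s) powr (\<alpha> * (2 - p)) \<le> Q s" for K x y
    proof -
      let ?t = "exp x - \<rho>" and ?a = "exp y - \<rho>"
      have t: "?a \<le> ?t" "?t \<le> \<tau>" using xy \<rho> by (auto simp: \<tau>L intro: order_trans[of _ "exp x"])
      have "2 powr (- (\<alpha> - 1 / p)) * exp (- 1) / 2 * \<theta> * K * (ln ((R + 1 + ?t) / (R + 1 + ?a)) - (?t - ?a) / (R + 1 + ?t)) \<le> U ?t"
        unfolding U_def
      proof (rule dyadic_sum_lower[OF p R si(2) si(1) K _ _ t _ Q])
        show "0 \<le> ?a" using xy a1 by simp
        show "\<theta> * m ?t \<le> m s" if "s \<in> {?a..?t}" for s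
        proof -
          have "0 \<le> ?t" using t(1) xy(1) a1 by linarith
          then have "\<theta> * m ?t \<le> \<theta> * m \<tau>" using \<theta> t(2) by (intro mult_left_mono m_mono) auto
          also have "\<dots> \<le> m s" using that t xy a by (intro mq) auto
          finally show ?thesis .
        qed
        have "R + 1 + ?t \<le> \<rho> + \<tau>" using t by (simp add: \<rho>_def)
        then have "2 * (R + 1 + ?t) \<le> 2 * (\<rho> + \<tau>)" by (rule mult_left_mono) simp
        then show "2 * (R + 1 + ?t) \<le> 2 ^ I" using I by (rule order_trans)
      qed (use \<theta> in simp)
      moreover have "R + 1 + ?t = exp x" "R + 1 + ?a = exp y" by (simp_all add: \<rho>_def)
      moreover have "ln (exp x / exp y) - (exp x - exp y) / exp x = x - y - 1 + exp y / exp x"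
        by (simp add: ln_div diff_divide_distrib)
      ultimately show ?thesis by (simp add: c3_def X_def)
    qed
    have am: "0 < m \<tau>" using m_pos[of \<tau>] tau by simp
    define K1 where "K1 = c1 * (A / m \<tau>) powr p"
    have K1: "0 < K1" using c1 A am by (simp add: K1_def)
    have e34: "2 * a \<le> exp x" if "3 * L / 4 \<le> x" for x
    proof -
      have "2 \<le> exp (L / 4)" using exp_ge_add_one_self[of "L / 4"] L by linarith
      then have "2 * a \<le> exp (L / 4) * exp (L / 2)" by (simp add: a_def)
      also have "\<dots> = exp (3 * L / 4)" by (simp add: exp_add[symmetric])
      also have "\<dots> \<le> exp x" using that by simp
      finally show ?thesis .
    qed
    have X0: "c3 * K1 * L / 8 \<le> X x" if x: "x \<in> {3 * L / 4..L}" for x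
    proof -
      \<comment> \<open>The logarithmic time of s = sqrt \<tau>; since \<rho> \<le> a it exceeds L/2
        by at most ln 2.\<close>
      define y where "y = ln (a + \<rho>)"
      have ey: "exp y = a + \<rho>" using a1 \<rho> by (simp add: y_def)
      have y: "y \<le> L / 2 + 1"
      proof -
        have "y \<le> ln (2 * a)" unfolding y_def using \<rho>a a1 \<rho> by simp
        also have "\<dots> = ln 2 + L / 2" using a1 by (simp add: ln_mult a_def)
        also have "ln 2 \<le> (1::real)" using ln_le_minus_one[of 2] by simp
        finally show ?thesis by simp
      qed
      have "c3 * K1 * (L / 8) \<le> c3 * K1 * (x - y - 1 + exp y / exp x)"
      proof (intro mult_left_mono)
        have "0 < exp y / exp x" by simp
        moreover have "3 * L / 4 \<le> x" using x by simp
        ultimately show "L / 8 \<le> x - y - 1 + exp y / exp x" using y L(1) by linarith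
      qed (use c3 K1 in auto)
      also have "\<dots> \<le> X x"
      proof (rule low)
        show "AE s in lborel. s \<in> {exp y - \<rho>..exp x - \<rho>} \<longrightarrow> K1 * (R + 1 + s) powr (\<alpha> * (2 - p)) \<le> Q s"
          using c1(2)[OF ms]
        proof eventually_elim
          case (elim s)
          show ?case
          proof
            assume s: "s \<in> {exp y - \<rho>..exp x - \<rho>}"
            have "exp x \<le> \<tau>" using x by (simp add: \<tau>L)
            then have "s \<in> {1..\<tau>}" using s ey a1 \<rho> by auto
            then show "K1 * (R + 1 + s) powr (\<alpha> * (2 - p)) \<le> Q s" using elim by (simp add: K1_def)
          qed
        qed
        have "3 * L / 4 \<le> x" using x by simp
        then show "y \<le> x" using y L(1) by linarith
      qed (use K1 ey x in auto)
      finally show ?thesis by simp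
    qed
    define B where "B = c3 * c2 * L powr (- (p - 1)) / 4"
    have B: "0 < B" using c3 c2 L by (simp add: B_def)
    have step: "B * D powr p * min (x - y) ((x - y)\<^sup>2) \<le> X x"
      if D: "0 < D" and xy: "3 * L / 4 \<le> y" "y \<le> x" "x \<le> L" and XD: "\<And>z. z \<in> {y..x} \<Longrightarrow> D \<le> X z" for D x y
    proof -
      define K2 where "K2 = c2 * D powr p * L powr (- (p - 1))"
      have K2: "0 \<le> K2" using c2 by (simp add: K2_def)
      have "B * D powr p * min (x - y) ((x - y)\<^sup>2) = c3 * K2 * (min (x - y) ((x - y)\<^sup>2) / 4)"
        by (simp add: B_def K2_def)
      also have "\<dots> \<le> c3 * K2 * (x - y - 1 + exp (- (x - y)))"
        using c3 K2 xy by (intro mult_left_mono exp_minus_kernel_lower) auto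
      also have "exp (- (x - y)) = exp y / exp x" by (simp add: exp_diff)
      also have "c3 * K2 * (x - y - 1 + exp y / exp x) \<le> X x"
      proof (rule low[OF K2 _ xy(2,3)])
        show "a \<le> exp y - \<rho>" using e34[OF xy(1)] \<rho>a by linarith
        show "AE s in lborel. s \<in> {exp y - \<rho>..exp x - \<rho>} \<longrightarrow> K2 * (R + 1 + s) powr (\<alpha> * (2 - p)) \<le> Q s"
          using c2(2)[OF ms]
        proof eventually_elim
          case (elim s)
          show ?case
          proof
            assume s: "s \<in> {exp y - \<rho>..exp x - \<rho>}"
            have "exp x \<le> \<tau>" using xy by (simp add: \<tau>L)
            moreover have "a \<le> exp y - \<rho>" using e34[OF xy(1)] \<rho>a by linarith
            ultimately have s0: "s \<in> {0..\<tau>}" using s a1 \<rho> by auto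
            have sp: "0 < s + \<rho>" using s0 \<rho> by simp
            have z: "ln (s + \<rho>) \<in> {y..x}"
            proof -
              have "exp y \<le> s + \<rho>" "s + \<rho> \<le> exp x" using s by auto
              then have "ln (exp y) \<le> ln (s + \<rho>)" "ln (s + \<rho>) \<le> ln (exp x)"
                using sp by (subst ln_le_cancel_iff; simp)+
              then show ?thesis by simp
            qed
            have "D \<le> U s" using XD[OF z] sp by (simp add: X_def)
            then have 1: "c2 * D powr p * (R + 1 + s) powr (\<alpha> * (2 - p)) * ln (R + 1 + s) powr (- (p - 1)) \<le> Q s"
              using elim s0 D by (simp add: U_def)
            have eq: "R + 1 + s = s + \<rho>" by (simp add: \<rho>_def)
            have "0 < ln (s + \<rho>)" using s0 \<rho> by (intro ln_gt_zero) auto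
            \<comment> \<open>The logarithm is at most L and its exponent is negative, so it may be
              frozen at L; the doubling argument needs a coefficient independent of time.\<close>
            then have "L powr (- (p - 1)) \<le> ln (s + \<rho>) powr (- (p - 1))"
              using z xy p by (intro powr_mono2') auto
            then have "c2 * D powr p * (R + 1 + s) powr (\<alpha> * (2 - p)) * L powr (- (p - 1))
               \<le> c2 * D powr p * (R + 1 + s) powr (\<alpha> * (2 - p)) * ln (R + 1 + s) powr (- (p - 1))"
              unfolding eq using c2 by (intro mult_left_mono) auto
            with 1 show "K2 * (R + 1 + s) powr (\<alpha> * (2 - p)) \<le> Q s" by (simp add: K2_def mult_ac)
          qed
        qed
      qed
      finally show ?thesis .
    qed
    let ?D0 = "c3 * K1 * L / 8"
    have D0: "0 < ?D0" using c3 K1 L by simp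
    have le: "L - 3 * L / 4 \<le> Cd * (1 / (B * ?D0 powr (p - 1)) + sqrt (1 / (B * ?D0 powr (p - 1))))"
      by (rule Cd(2)[OF _ B D0 X0]) (use L step in auto)
    let ?K = "(m \<tau> / A) powr (p * (p - 1))"
    have K: "1 / (B * ?D0 powr (p - 1)) = C' * ?K"
    proof -
      have "?D0 = (c3 * c1 / 8) * (A / m \<tau>) powr p * L" by (simp add: K1_def)
      then have "?D0 powr (p - 1) = (c3 * c1 / 8) powr (p - 1) * (A / m \<tau>) powr (p * (p - 1)) * L powr (p - 1)"
        by (simp only: powr_mult powr_powr)
      then have "B * ?D0 powr (p - 1) = (c3 * c2 / 4 * (c3 * c1 / 8) powr (p - 1)) * (A / m \<tau>) powr (p * (p - 1))
        * (L powr (p - 1) * L powr (- (p - 1)))"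
        by (simp add: B_def)
      also have "L powr (p - 1) * L powr (- (p - 1)) = 1"
        using L by (simp only: powr_add[symmetric]) simp
      also have "(A / m \<tau>) powr (p * (p - 1)) = 1 / ?K"
        using A am by (simp add: powr_divide)
      finally show ?thesis by (simp add: C'_def)
    qed
    have "L / 4 \<le> Cd * (C' * ?K + sqrt (C' * ?K))" using le unfolding K by simp
    also have "\<dots> \<le> Cd * ((C' + sqrt C') * (?K + sqrt ?K))"
    proof (intro mult_left_mono)
      have "0 \<le> C' * sqrt ?K" "0 \<le> sqrt C' * ?K" using C' by auto
      then show "C' * ?K + sqrt (C' * ?K) \<le> (C' + sqrt C') * (?K + sqrt ?K)"
        by (simp add: real_sqrt_mult algebra_simps)
    qed (use Cd in auto)
    finally show "ln \<tau> \<le> 4 * Cd * (C' + sqrt C') * (?K + sqrt ?K)" by (simp add: L_def)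
  qed
qed

section \<open>Large data and conclusion\<close>

text \<open>On [0, 1] all geometric factors of the mode \<kappa> = 1 are constants, and doubling
  starts from A/e by the exponential lower bound. Hence a solution that reaches time 1 has bounded
  A. This keeps (m/A)^(p(p-1)) away from 0, so that its square root is controlled by a multiple of
  it.\<close>

lemma large_data_bound:
  fixes n :: nat and p R \<omega> \<theta> :: real
  assumes n: "1 \<le> n" and p: "1 < p" and R: "0 < R" and \<omega>: "0 < \<omega>" and \<theta>: "0 < \<theta>"
  obtains A0 where "0 < A0" "\<And>A m Z Q. mode_system n p R \<omega> 1 A m Z Q \<Longrightarrow>
    (\<And>s. s \<in> {0..1} \<Longrightarrow> \<theta> * m 1 \<le> m s) \<Longrightarrow> A \<le> A0"
proof -
  obtain Cd where Cd: "0 < Cd" "\<And>X a b B D0. a \<le> b \<Longrightarrow> 0 < B \<Longrightarrow> 0 < D0 \<Longrightarrow>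
    (\<And>t. t \<in> {a..b} \<Longrightarrow> D0 \<le> X t) \<Longrightarrow>
    (\<And>D t0 t. 0 < D \<Longrightarrow> a \<le> t0 \<Longrightarrow> t0 \<le> t \<Longrightarrow> t \<le> b \<Longrightarrow> (\<And>s. s \<in> {t0..t} \<Longrightarrow> D \<le> X s) \<Longrightarrow>
      B * D powr p * min (t - t0) ((t - t0)\<^sup>2) \<le> X t) \<Longrightarrow>
    b - a \<le> Cd * (1 / (B * D0 powr (p - 1)) + sqrt (1 / (B * D0 powr (p - 1))))"
    using doubling_bound[OF p] by blast
  define M where "M = exp (R + 1) powr (p / (p - 1))"
  define E where "E = \<omega> * (R + 2) ^ (n - 1) * (M * (R + 1))"
  have M: "0 < M" and E: "0 < E" using R \<omega> by (auto simp: M_def E_def)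
  define c where "c = 2 powr (- p) * E powr (- (p - 1))"
  have c: "0 < c" using E by (simp add: c_def)
  define B where "B = \<theta> * c / 2"
  have B: "0 < B" using \<theta> c by (simp add: B_def)
  \<comment> \<open>K \<le> \<delta> gives K \<le> sqrt K \<le> 1/(3 Cd), so the length allowed by
    \<open>doubling_bound\<close> would be at most 2/3, less than the length 1 of the
    interval.\<close>
  define \<delta> where "\<delta> = min 1 ((1 / (3 * Cd))\<^sup>2)"
  have \<delta>: "0 < \<delta>" "\<delta> \<le> 1" "sqrt \<delta> \<le> 1 / (3 * Cd)"
  proof -
    show "0 < \<delta>" "\<delta> \<le> 1" using Cd by (auto simp: \<delta>_def)
    have "\<delta> \<le> (1 / (3 * Cd))\<^sup>2" unfolding \<delta>_def by (rule min.cobounded2)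
    then have "sqrt \<delta> \<le> sqrt ((1 / (3 * Cd))\<^sup>2)" by (rule real_sqrt_le_mono)
    also have "\<dots> = 1 / (3 * Cd)" using Cd by simp
    finally show "sqrt \<delta> \<le> 1 / (3 * Cd)" .
  qed
  \<comment> \<open>The value of A at which B (A/e)^(p-1) = 1/\<delta>; a larger A makes K \<le>
    \<delta>.\<close>
  define A0 where "A0 = exp 1 * (1 / (B * \<delta>)) powr (1 / (p - 1))"
  show thesis
  proof
    show "0 < A0" using B \<delta> by (simp add: A0_def)
    fix A m Z Q assume "mode_system n p R \<omega> 1 A m Z Q" and m: "\<And>s. s \<in> {0..1} \<Longrightarrow> \<theta> * m 1 \<le> m s"
    then interpret mode_system n p R \<omega> 1 A m Z Q by simp
    let ?D0 = "A * exp (- 1)"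
    have D0: "0 < ?D0" using A by simp
    have X0: "?D0 \<le> Z 1 t" if "t \<in> {0..1}" for t
    proof -
      have "A * exp (- 1) \<le> A * exp (- 1 * t)" using A that by (intro mult_left_mono) auto
      also have "\<dots> \<le> Z 1 t" by (rule Z_exp[OF _ that]) simp
      finally show ?thesis .
    qed
    have Q: "AE s in lborel. s \<in> {0..1} \<longrightarrow> (\<forall>D. 0 < D \<longrightarrow> D \<le> Z 1 s \<longrightarrow> c * D powr p \<le> Q s)"
      using Q_lower
    proof eventually_elim
      case (elim s)
      show ?case
      proof (intro impI allI)
        fix D assume s: "s \<in> {0..1}" and D: "0 < D" "D \<le> Z 1 s"
        have "(D / 2) powr p * E powr (- (p - 1)) \<le> Q s"
        proof (rule elim[rule_format, of "{0}" "\<lambda>_. 1" "\<lambda>_. M" "\<lambda>_. 1" E D])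
          show "(\<Sum>j\<in>{0}. 1 * bessel n ((1 * r)\<^sup>2)) powr (p / (p - 1)) \<le> M" if "r \<in> {0..R + s}" for r
          proof -
            have "bessel n (r\<^sup>2) \<le> exp r" using that by (intro bessel_le_exp n) auto
            also have "\<dots> \<le> exp (R + 1)" using that s by simp
            finally have "bessel n (r\<^sup>2) \<le> exp (R + 1)" .
            moreover have "0 \<le> bessel n (r\<^sup>2)" using bessel_ge_1[OF n, of "r\<^sup>2"] by simp
            ultimately show ?thesis using p by (simp add: M_def powr_mono2)
          qed
          have "\<omega> * (R + 1 + s) ^ (n - 1) * (M * (R + s)) \<le> E"
            unfolding E_def using R s \<omega> M
            by (intro mult_mono mult_left_mono power_mono mult_nonneg_nonneg) auto
          then show "\<omega> * (R + 1 + s) ^ (n - 1) * integral {1..R + 1 + s} (\<lambda>_. M) \<le> E"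
            using R s by (simp add: mult.commute)
        qed (use s D E in auto)
        then show "c * D powr p \<le> Q s" using D by (simp add: c_def powr_p_div_2 mult_ac)
      qed
    qed
    have step: "B * D powr p * min (t - t0) ((t - t0)\<^sup>2) \<le> Z 1 t"
      if D: "0 < D" and t: "0 \<le> t0" "t0 \<le> t" "t \<le> 1" and ZD: "\<And>s. s \<in> {t0..t} \<Longrightarrow> D \<le> Z 1 s" for D t0 t
    proof -
      let ?w = "c * D powr p"
      have w: "0 \<le> ?w" using c by simp
      have cs: "continuous_on {t0..t} (\<lambda>s. ?w * sinh (1 * (t - s)) / 1)"
        by (intro continuous_intros) auto
      have cl: "((\<lambda>s. ?w * (t - s)) has_integral ?w * (t - t0)\<^sup>2 / 2) {t0..t}"
      proof -
        have "((\<lambda>s. ?w * (t - s)) has_integral (- ?w * (t - t)\<^sup>2 / 2 - - ?w * (t - t0)\<^sup>2 / 2)) {t0..t}"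
          using t by (intro fundamental_theorem_of_calculus)
            (auto simp: has_real_derivative_iff_has_vector_derivative[symmetric] field_simps intro!: derivative_eq_intros)
        then show ?thesis by simp
      qed
      have "B * D powr p * min (t - t0) ((t - t0)\<^sup>2) \<le> B * D powr p * (t - t0)\<^sup>2"
        using B by (intro mult_left_mono) auto
      also have "\<dots> = \<theta> * (?w * (t - t0)\<^sup>2 / 2)" by (simp add: B_def)
      also have "\<dots> \<le> \<theta> * integral {t0..t} (\<lambda>s. ?w * sinh (1 * (t - s)) / 1)"
      proof (rule mult_left_mono)
        show "?w * (t - t0)\<^sup>2 / 2 \<le> integral {t0..t} (\<lambda>s. ?w * sinh (1 * (t - s)) / 1)"
          unfolding integral_unique[OF cl, symmetric]
        proof (rule integral_le[OF has_integral_integrable[OF cl] integrable_continuous_real[OF cs]])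
          fix s assume "s \<in> {t0..t}"
          then have "t - s \<le> (exp (t - s) - inverse (exp (t - s))) / 2" by (intro real_le_x_sinh) simp
          then have "t - s \<le> sinh (t - s)" by (simp only: sinh_def exp_minus scaleR_conv_of_real) simp
          then show "?w * (t - s) \<le> ?w * sinh (1 * (t - s)) / 1" using w by (simp add: mult_left_mono)
        qed
      qed (use \<theta> in simp)
      also have "\<dots> \<le> Z 1 t"
      proof (rule Z_Duhamel[where a = t0])
        show "\<theta> * m t \<le> m s" if "s \<in> {t0..t}" for s
        proof -
          have "\<theta> * m t \<le> \<theta> * m 1" using \<theta> t by (intro mult_left_mono m_mono) auto
          also have "\<dots> \<le> m s" using that t by (intro m) auto
          finally show ?thesis .
        qed
        show "AE s in lborel. s \<in> {t0..t} \<longrightarrow> ?w \<le> Q s"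
          using Q by eventually_elim (use D t ZD in auto)
      qed (use t \<theta> w in auto)
      finally show ?thesis .
    qed
    let ?K = "1 / (B * ?D0 powr (p - 1))"
    have K0: "0 < ?K" using B A by simp
    have "1 - 0 \<le> Cd * (?K + sqrt ?K)"
      by (rule Cd(2)[OF _ B D0 X0 step]) auto
    show "A \<le> A0"
    proof (rule ccontr)
      assume "\<not> A \<le> A0"
      then have "(1 / (B * \<delta>)) powr (1 / (p - 1)) < ?D0"
        by (simp add: A0_def exp_minus field_simps)
      then have "((1 / (B * \<delta>)) powr (1 / (p - 1))) powr (p - 1) \<le> ?D0 powr (p - 1)"
        using p by (intro powr_mono2) auto
      then have "1 / (B * \<delta>) \<le> ?D0 powr (p - 1)"
        using p B \<delta> by (simp add: powr_powr)
      then have "B * (1 / (B * \<delta>)) \<le> B * ?D0 powr (p - 1)" using B by (intro mult_left_mono) auto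
      then have "1 / \<delta> \<le> B * ?D0 powr (p - 1)" using B by simp
      then have K\<delta>: "?K \<le> \<delta>" using \<delta> B A by (simp add: field_simps)
      then have "sqrt ?K \<le> sqrt \<delta>" by simp
      also have "\<dots> \<le> 1 / (3 * Cd)" by (rule \<delta>(3))
      finally have sK: "sqrt ?K \<le> 1 / (3 * Cd)" .
      have "?K = sqrt ?K * sqrt ?K" using K0 by simp
      also have "\<dots> \<le> 1 * sqrt ?K"
      proof (rule mult_right_mono)
        have "?K \<le> 1" using K\<delta> \<delta>(2) by linarith
        then show "sqrt ?K \<le> 1" by simp
      qed (use K0 in simp)
      finally have "?K + sqrt ?K \<le> 2 * (1 / (3 * Cd))" using sK by linarith
      then have "Cd * (?K + sqrt ?K) \<le> Cd * (2 * (1 / (3 * Cd)))" using Cd by (intro mult_left_mono) auto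
      also have "\<dots> = 2 / 3" using Cd by simp
      finally show False using \<open>1 - 0 \<le> Cd * (?K + sqrt ?K)\<close> by linarith
    qed
  qed
qed

section \<open>Solving the logarithmic bound for the lifespan\<close>

lemma iter_ln_le_ln_ln:
  assumes "2 \<le> j" "j \<le> k" "iter_e k \<le> r"
  shows "iter_ln j r \<le> ln (ln r)"
  using assms(1,2)
proof (induction j rule: dec_induct)
  case base
  then show ?case by (simp add: iter_ln_def numeral_2_eq_2)
next
  case (step j)
  have "iter_ln (Suc j) r \<le> iter_ln j r"
    using ln_le_minus_one[of "iter_ln j r"] iter_ln_ge_1[of j k r] step assms by (simp add: iter_ln_Suc)
  then show ?case using step by simp
qed

text \<open>For k \<ge> 2 the k-fold logarithm is at most ln ln, any power of which is below any
  positive power of ln \<tau> up to a constant; 1/2 is one exponent smaller than 1. For k = 1 the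
  exponent remains \<open>a\<close>, and there the size of \<mu> matters.\<close>

lemma iter_ln_powr_growth:
  fixes a :: real
  assumes k: "1 \<le> k" and a: "0 < a"
  obtains C where "0 < C" "\<And>\<tau>. iter_e k \<le> \<tau> \<Longrightarrow>
    iter_ln k (iter_e k + \<tau>) powr a \<le> C * ln \<tau> powr (if k = 1 then a else 1 / 2)"
proof -
  have e1: "2 \<le> iter_e k"
  proof -
    obtain j where "k = Suc j" using k by (cases k) auto
    then have "iter_e k = exp (iter_e j)" by (simp add: iter_e_Suc)
    then show ?thesis using exp_ge_add_one_self[of "iter_e j"] iter_e_ge_1[of j] by linarith
  qed
  have ln2: "ln (iter_e k + \<tau>) \<le> 2 * ln \<tau>" if "iter_e k \<le> \<tau>" for \<tau>
  proof -
    have "iter_e k + \<tau> \<le> 2 * \<tau>" using that by simp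
    also have "\<dots> \<le> \<tau> * \<tau>" using that e1 by (intro mult_right_mono) auto
    finally have "ln (iter_e k + \<tau>) \<le> ln (\<tau> * \<tau>)" using that e1 by (subst ln_le_cancel_iff) auto
    then show ?thesis using that e1 by (simp add: ln_mult)
  qed
  have lnpos: "0 < ln \<tau>" if "iter_e k \<le> \<tau>" for \<tau> using that e1 by (intro ln_gt_zero) auto
  show thesis
  proof (cases "k = 1")
    case True
    show thesis
    proof
      show "0 < (2::real) powr a" by simp
      fix \<tau> assume t: "iter_e k \<le> \<tau>"
      have "1 \<le> iter_ln k (iter_e k + \<tau>)" using t e1 by (intro iter_ln_ge_1[OF order_refl]) auto
      moreover have eq: "iter_ln k (iter_e k + \<tau>) = ln (iter_e k + \<tau>)"
        using True by (simp add: iter_ln_def)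
      ultimately have "iter_ln k (iter_e k + \<tau>) powr a \<le> (2 * ln \<tau>) powr a"
        using ln2[OF t] a by (intro powr_mono2) auto
      also have "\<dots> = 2 powr a * ln \<tau> powr a" by (rule powr_mult)
      finally show "iter_ln k (iter_e k + \<tau>) powr a \<le> 2 powr a * ln \<tau> powr (if k = 1 then a else 1 / 2)"
        using True by simp
    qed
  next
    case False
    show thesis
    proof
      let ?C = "(a / (1 / 2)) powr a * 2 powr (1 / 2)"
      show "0 < ?C" using a by simp
      fix \<tau> assume t: "iter_e k \<le> \<tau>"
      let ?r = "iter_e k + \<tau>"
      have 1: "1 \<le> iter_ln k ?r" using t e1 by (intro iter_ln_ge_1[OF order_refl]) auto
      have 2: "iter_ln k ?r \<le> ln (ln ?r)"
        using False k t e1 by (intro iter_ln_le_ln_ln[of k k]) auto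
      have "0 < ln ?r" using t e1 by (intro ln_gt_zero) auto
      then have 3: "ln (ln ?r) \<le> ln (2 * ln \<tau>)"
        using ln2[OF t] lnpos[OF t] by (subst ln_le_cancel_iff) auto
      have pos: "0 < ln (2 * ln \<tau>)" using 1 2 3 by linarith
      have "iter_ln k ?r powr a \<le> ln (2 * ln \<tau>) powr a"
        using 1 2 3 a by (intro powr_mono2) auto
      also have "\<dots> \<le> (a / (1 / 2)) powr a * exp (1 / 2 * ln (2 * ln \<tau>))"
        by (rule powr_le_exp[OF pos a]) simp
      also have "exp (1 / 2 * ln (2 * ln \<tau>)) = (2 * ln \<tau>) powr (1 / 2)"
        using lnpos[OF t] by (simp add: powr_def)
      also have "\<dots> = 2 powr (1 / 2) * ln \<tau> powr (1 / 2)" by (rule powr_mult)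
      finally show "iter_ln k ?r powr a \<le> ?C * ln \<tau> powr (if k = 1 then a else 1 / 2)"
        using False by (simp add: mult.assoc)
    qed
  qed
qed

lemma weak_solution_mode_system:
  fixes u0 u1 :: "real^'n \<Rightarrow> real"
  assumes "1 < p" "0 < \<mu>" and "loc_integrable_on u0 UNIV"
    and "AE x in lebesgue. u0 x \<ge> 0" "AE x in lebesgue. u1 x \<ge> 0" "\<not> (AE x in lebesgue. u0 x = 0)"
    and "R > 0" "ess_supp u0 \<union> ess_supp u1 \<subseteq> cball 0 R" "0 < \<epsilon>"
    and sol: "weak_solution (\<lambda>y z. \<bar>y\<bar> powr p) (damping \<mu> k) \<epsilon> u0 u1 R T u"
    and \<tau>: "0 < \<tau>" "ereal \<tau> < T"
  shows "0 < (LINT x:cball 0 R|lebesgue. u0 x) \<and>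
    (\<exists>Z Q. mode_system CARD('n) p R (real CARD('n) * unit_ball_vol (real CARD('n))) \<tau>
      (\<epsilon> * (LINT x:cball 0 R|lebesgue. u0 x)) (damping_weight \<mu> k) Z Q)"
proof -
  from sol obtain v G where s: "cont_W11_loc (time_interval T) u G" "C1_L1_loc (time_interval T) u v"
    "loc_integrable_on (\<lambda>(t, x). \<bar>u t x\<bar> powr p) (time_interval T \<times> UNIV)"
    "\<forall>t>0. ereal t < T \<longrightarrow> ess_supp (u t) \<subseteq> cball 0 (R + t)"
    "AE x in lebesgue. u 0 x = \<epsilon> * u0 x"
    "\<forall>t>0. ereal t < T \<longrightarrow> (\<forall>\<psi>. spacetime_test_function T \<psi> \<longrightarrow>
           (LINT s:{0..t}|lebesgue. (LINT x|lebesgue.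
               - v s x * deriv (\<lambda>r. \<psi> (r, x)) s
               + G s x \<bullet> gradient (\<lambda>y. \<psi> (s, y)) x
               + damping \<mu> k s * v s x * \<psi> (s, x)))
           + (LINT x|lebesgue. v t x * \<psi> (t, x))
           = \<epsilon> * (LINT x|lebesgue. u1 x * \<psi> (0, x))
           + (LINT s:{0..t}|lebesgue. (LINT x|lebesgue. \<bar>u s x\<bar> powr p * \<psi> (s, x))))"
    unfolding weak_solution_def by blast
  interpret damped_wave_solution u v G "damping \<mu> k" "damping_weight \<mu> k" u0 u1 p \<epsilon> R \<tau> T
  proof
    show "(damping_weight \<mu> k has_real_derivative damping \<mu> k s * damping_weight \<mu> k s) (at s within {0..\<tau>})"
      if "s \<in> {0..\<tau>}" for s
      using damping_weight_deriv[of s \<mu> k] that by (auto intro: has_field_derivative_at_within)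
  qed (use assms s in \<open>auto intro: damping_continuous damping_nonneg damping_weight_0 damping_weight_pos\<close>)
  have "initial_mass = (LINT x:cball 0 R|lebesgue. u0 x)" by (rule initial_mass_def)
  then show ?thesis using initial_mass_pos ex_mode_system by auto
qed

text \<open>The bound in K + sqrt K becomes linear in K once K \<ge> K0, which follows from the
  bound on \<epsilon> for solutions living beyond time 1. Times with ln \<tau> below the threshold
  \<open>L0\<close> are covered by adding L0/K0 to the constant.\<close>

lemma weak_solution_log_bound:
  fixes u0 u1 :: "real^'n \<Rightarrow> real" and \<mu> p R :: real
  assumes n: "CARD('n) \<ge> 2" and \<mu>: "\<mu> > 0" and k: "k \<ge> 1" and p: "p = strauss_exponent CARD('n)"
    and "loc_integrable_on u0 UNIV"
    and "AE x in lebesgue. u0 x \<ge> 0" "AE x in lebesgue. u1 x \<ge> 0" "\<not> (AE x in lebesgue. u0 x = 0)"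
    and R: "R > 0" and "ess_supp u0 \<union> ess_supp u1 \<subseteq> cball 0 R"
  obtains C \<epsilon>1 where "0 < C" "0 < \<epsilon>1"
    "\<And>\<epsilon> T u. 0 < \<epsilon> \<Longrightarrow> weak_solution (\<lambda>y z. \<bar>y\<bar> powr p) (damping \<mu> k) \<epsilon> u0 u1 R T u \<Longrightarrow> 1 < T \<Longrightarrow> \<epsilon> \<le> \<epsilon>1"
    "\<And>\<epsilon> T u \<tau>. 0 < \<epsilon> \<Longrightarrow> weak_solution (\<lambda>y z. \<bar>y\<bar> powr p) (damping \<mu> k) \<epsilon> u0 u1 R T u \<Longrightarrow>
      1 < \<tau> \<Longrightarrow> ereal \<tau> < T \<Longrightarrow>
      ln \<tau> \<le> C * \<epsilon> powr (- (p * (p - 1))) * iter_ln k (iter_e k + \<tau>) powr (\<mu> * p * (p - 1))"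
proof (cases "0 < (LINT x:cball 0 R|lebesgue. u0 x)")
  case False
  note strauss = strauss_exponent_root[OF n p]
  \<comment> \<open>Positivity of the mass is proved in the presence of a solution. Where it fails
    there is no weak solution at all, and any constants do.\<close>
  have no: "\<not> ereal \<tau> < T" if "0 < \<epsilon>" "weak_solution (\<lambda>y z. \<bar>y\<bar> powr p) (damping \<mu> k) \<epsilon> u0 u1 R T u" "0 < \<tau>" for \<epsilon> T u \<tau>
    using weak_solution_mode_system[OF strauss(1) \<mu> assms(5-8) R assms(10) that(1,2,3)] False by blast
  show thesis
    by (rule that[of 1 1]) (use no[of _ _ _ 1] no in \<open>force simp: one_ereal_def\<close>)+
next
  case True
  define I0 where "I0 = (LINT x:cball 0 R|lebesgue. u0 x)"
  have I0: "0 < I0" using True by (simp add: I0_def)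
  note strauss = strauss_exponent_root[OF n p]
  let ?n = "CARD('n)" and ?\<omega> = "real CARD('n) * unit_ball_vol (real CARD('n))"
  let ?m = "damping_weight \<mu> k"
  define g where "g = p * (p - 1)"
  have g: "0 < g" using strauss(1) by (simp add: g_def)
  have \<omega>: "0 < ?\<omega>" using n by simp
  have ms: "\<exists>Z Q. mode_system ?n p R ?\<omega> \<tau> (\<epsilon> * I0) ?m Z Q"
    if "0 < \<epsilon>" "weak_solution (\<lambda>y z. \<bar>y\<bar> powr p) (damping \<mu> k) \<epsilon> u0 u1 R T u" "0 < \<tau>" "ereal \<tau> < T" for \<epsilon> T u \<tau>
    using weak_solution_mode_system[OF strauss(1) \<mu> assms(5-8) R assms(10) that] by (simp add: I0_def)
  have m1: "1 \<le> ?m t" if "0 \<le> t" for t using that \<mu> by (intro damping_weight_ge_1) auto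
  \<comment> \<open>On [0, 1] the comparison constant 1/m(1) is available because m \<ge> 1.\<close>
  obtain A0 where A0: "0 < A0" "\<And>A m Z Q. mode_system ?n p R ?\<omega> 1 A m Z Q \<Longrightarrow>
    (\<And>s. s \<in> {0..1} \<Longrightarrow> 1 / ?m 1 * m 1 \<le> m s) \<Longrightarrow> A \<le> A0"
  proof (rule large_data_bound[OF _ strauss(1) R \<omega>])
    show "1 \<le> ?n" using n by simp
    show "0 < 1 / ?m 1" using m1[of 1] by simp
  qed blast
  obtain C L0 where C: "0 < C" "0 < L0" "\<And>\<tau> A m Z Q. mode_system ?n p R ?\<omega> \<tau> A m Z Q \<Longrightarrow> L0 \<le> ln \<tau> \<Longrightarrow>
    (\<And>s. s \<in> {sqrt \<tau>..\<tau>} \<Longrightarrow> 2 powr (- \<mu>) * m \<tau> \<le> m s) \<Longrightarrow>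
    ln \<tau> \<le> C * ((m \<tau> / A) powr (p * (p - 1)) + sqrt ((m \<tau> / A) powr (p * (p - 1))))"
  proof (rule log_lifespan_bound[OF n strauss R \<omega>])
    show "0 < 2 powr (- \<mu>)" by simp
  qed blast
  \<comment> \<open>A lower bound for (m/(\<epsilon> I0))^g, since m \<ge> 1 and \<epsilon> I0 \<le>
    A0.\<close>
  define K0 where "K0 = (1 / A0) powr g"
  have K0: "0 < K0" using A0 by (simp add: K0_def)
  define C1 where "C1 = C * (1 + 1 / sqrt K0) + L0 / K0"
  have C1: "0 < C1" using C K0 by (auto simp: C1_def intro!: add_pos_pos mult_pos_pos)
  show thesis
  proof (rule that)
    show "0 < C1 * I0 powr (- g)" using C1 I0 by simp
    show "0 < A0 / I0" using A0 I0 by simp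
  next
    fix \<epsilon> T u assume e: "0 < \<epsilon>" and sol: "weak_solution (\<lambda>y z. \<bar>y\<bar> powr p) (damping \<mu> k) \<epsilon> u0 u1 R T u" and T: "1 < T"
    have "ereal 1 < T" using T by (simp add: one_ereal_def)
    then obtain Z Q where "mode_system ?n p R ?\<omega> 1 (\<epsilon> * I0) ?m Z Q"
      using ms[OF e sol] by (metis zero_less_one)
    then have "\<epsilon> * I0 \<le> A0"
    proof (rule A0(2))
      show "1 / ?m 1 * ?m 1 \<le> ?m s" if "s \<in> {0..1}" for s
        using m1[of 1] m1[of s] that by simp
    qed
    then show e1: "\<epsilon> \<le> A0 / I0" using I0 by (simp add: field_simps)
  next
    fix \<epsilon> T u \<tau> assume e: "0 < \<epsilon>" and sol: "weak_solution (\<lambda>y z. \<bar>y\<bar> powr p) (damping \<mu> k) \<epsilon> u0 u1 R T u"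
      and \<tau>: "1 < \<tau>" "ereal \<tau> < T"
    have "ereal 1 < ereal \<tau>" using \<tau> by simp
    then have "ereal 1 < T" using \<tau>(2) by (rule less_trans)
    then obtain Z Q where "mode_system ?n p R ?\<omega> 1 (\<epsilon> * I0) ?m Z Q"
      using ms[OF e sol] by (metis zero_less_one)
    then have eA: "\<epsilon> * I0 \<le> A0"
    proof (rule A0(2))
      show "1 / ?m 1 * ?m 1 \<le> ?m s" if "s \<in> {0..1}" for s
        using m1[of 1] m1[of s] that by simp
    qed
    obtain Z Q where msys: "mode_system ?n p R ?\<omega> \<tau> (\<epsilon> * I0) ?m Z Q"
      using ms[OF e sol _ \<tau>(2)] \<tau>(1) by auto
    let ?K = "(?m \<tau> / (\<epsilon> * I0)) powr g"
    have mt: "1 \<le> ?m \<tau>" using \<tau> by (intro m1) simp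
    have KK: "K0 \<le> ?K"
    proof -
      have "1 / A0 \<le> ?m \<tau> / (\<epsilon> * I0)" using mt eA e I0 by (intro frac_le) auto
      then show ?thesis unfolding K0_def using A0 g by (intro powr_mono2) auto
    qed
    have "ln \<tau> \<le> C1 * ?K"
    proof (cases "L0 \<le> ln \<tau>")
      case True
      have "ln \<tau> \<le> C * (?K + sqrt ?K)"
        unfolding g_def
        by (rule C(3)[OF msys True]) (use damping_weight_slowly_varying[OF k \<mu>, of \<tau>] \<tau> in auto)
      also have "\<dots> \<le> C * (?K + 1 / sqrt K0 * ?K)"
      proof (intro mult_left_mono add_left_mono)
        have "sqrt K0 * sqrt ?K \<le> sqrt ?K * sqrt ?K" using KK by (intro mult_right_mono) auto
        also have "\<dots> = ?K" by simp
        finally show "sqrt ?K \<le> 1 / sqrt K0 * ?K" using K0 by (simp add: field_simps)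
      qed (use C in simp)
      also have "\<dots> = C * (1 + 1 / sqrt K0) * ?K" by (simp add: algebra_simps)
      also have "\<dots> \<le> C1 * ?K" unfolding C1_def using C K0 by (intro mult_right_mono) auto
      finally show ?thesis .
    next
      case False
      then have "ln \<tau> \<le> L0 / K0 * K0" using K0 by simp
      also have "\<dots> \<le> L0 / K0 * ?K" using KK C K0 by (intro mult_left_mono) auto
      also have "\<dots> \<le> C1 * ?K" unfolding C1_def using C K0 by (intro mult_right_mono) auto
      finally show ?thesis .
    qed
    also have "?K = ?m \<tau> powr g * (\<epsilon> powr (- g) * I0 powr (- g))"
      by (simp only: powr_divide powr_mult powr_minus) (simp add: divide_inverse)
    also have "?m \<tau> powr g = iter_ln k (iter_e k + \<tau>) powr (\<mu> * p * (p - 1))"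
      by (simp add: damping_weight_def powr_powr g_def mult.assoc)
    finally show "ln \<tau> \<le> C1 * I0 powr (- g) * \<epsilon> powr (- (p * (p - 1))) * iter_ln k (iter_e k + \<tau>) powr (\<mu> * p * (p - 1))"
      by (simp add: g_def mult_ac)
  qed
qed

text \<open>The logarithmic bound is available at every time below T, not at T itself. Finiteness
  follows by evaluating it at a time that it excludes; the estimates at T follow by approaching T
  from below.\<close>

theorem theorem2p2:
  fixes u0 u1 :: "real^'n \<Rightarrow> real" and \<mu> p R :: real and k :: nat
  assumes "CARD('n) \<ge> 2" and "\<mu> > 0" and "k \<ge> 1"
    and "p = strauss_exponent CARD('n)"
    and "k = 1 \<Longrightarrow> \<mu> < mu0_star CARD('n)"
    and "W11_loc u0" and "loc_integrable_on u1 UNIV"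
    and "AE x in lebesgue. u0 x \<ge> 0" and "AE x in lebesgue. u1 x \<ge> 0"
    and "\<not> (AE x in lebesgue. u0 x = 0)" and "\<not> (AE x in lebesgue. u1 x = 0)"
    and "compact (ess_supp u0)" and "compact (ess_supp u1)"
    and "R > 0" and "ess_supp u0 \<union> ess_supp u1 \<subseteq> cball 0 R"
  shows "\<exists>C>0. \<forall>\<epsilon>>0. \<forall>T u.
    weak_solution_with_lifespan (\<lambda>y z. \<bar>y\<bar> powr p) (damping \<mu> k) \<epsilon> u0 u1 R T u \<longrightarrow>
      T < \<infinity> \<and>
      (k \<ge> 2 \<longrightarrow>
         ln (real_of_ereal T) * iter_ln k (iter_e k + real_of_ereal T) powr (- (\<mu> * p * (p - 1)))
           \<le> C * \<epsilon> powr (- (p * (p - 1)))) \<and>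
      (k = 1 \<and> \<mu> < mu0_star CARD('n) \<longrightarrow>
         ln (real_of_ereal T) \<le> C * \<epsilon> powr (- (p * (p - 1) / (1 - \<mu> * p * (p - 1)))))"
proof -
  let ?f = "\<lambda>y z :: real. \<bar>y\<bar> powr p"
  define g where "g = p * (p - 1)"
  define a where "a = \<mu> * p * (p - 1)"
  have p1: "1 < p" by (rule strauss_exponent_root(1)[OF assms(1,4)])
  have g: "0 < g" and a: "0 < a" using p1 assms(2) by (auto simp: g_def a_def)
  have a1: "a < 1" if "k = 1"
    using assms(5)[OF that] g by (simp add: mu0_star_def assms(4)[symmetric] a_def g_def field_simps)
  have u0: "loc_integrable_on u0 UNIV" using assms(6) by (auto simp: W11_loc_def weak_gradient_def)
  obtain C \<epsilon>1 where C: "0 < C" "0 < \<epsilon>1"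
    and small: "\<And>\<epsilon> T u. 0 < \<epsilon> \<Longrightarrow> weak_solution ?f (damping \<mu> k) \<epsilon> u0 u1 R T u \<Longrightarrow> 1 < T \<Longrightarrow> \<epsilon> \<le> \<epsilon>1"
    and log: "\<And>\<epsilon> T u \<tau>. 0 < \<epsilon> \<Longrightarrow> weak_solution ?f (damping \<mu> k) \<epsilon> u0 u1 R T u \<Longrightarrow>
      1 < \<tau> \<Longrightarrow> ereal \<tau> < T \<Longrightarrow>
      ln \<tau> \<le> C * \<epsilon> powr (- g) * iter_ln k (iter_e k + \<tau>) powr a"
    using weak_solution_log_bound[OF assms(1-4) u0 assms(8-10,14,15)] unfolding g_def a_def by blast
  obtain C' where C': "0 < C'" "\<And>\<tau>. iter_e k \<le> \<tau> \<Longrightarrow>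
    iter_ln k (iter_e k + \<tau>) powr a \<le> C' * ln \<tau> powr (if k = 1 then a else 1 / 2)"
    using iter_ln_powr_growth[OF assms(3) a] by blast
  \<comment> \<open>The exponent of ln \<tau> contributed by the power of the iterated logarithm. It
    is below 1 in both cases, for k = 1 by the upper bound on \<mu>.\<close>
  define d where "d = (if k = 1 then a else 1 / 2 :: real)"
  have d: "0 < 1 - d" using a1 by (auto simp: d_def)
  have e1: "1 < iter_e k"
  proof -
    obtain j where "k = Suc j" using assms(3) by (cases k) auto
    then have "iter_e k = exp (iter_e j)" by (simp add: iter_e_Suc)
    then show ?thesis using exp_ge_add_one_self[of "iter_e j"] iter_e_ge_1[of j] by linarith
  qed
  have powr_log: "ln \<tau> \<le> (C * C' * \<epsilon> powr (- g)) powr (1 / (1 - d))"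
    if e: "0 < \<epsilon>" and sol: "weak_solution ?f (damping \<mu> k) \<epsilon> u0 u1 R T u" and \<tau>: "iter_e k \<le> \<tau>" "ereal \<tau> < T" for \<epsilon> T u \<tau>
  proof -
    have l: "0 < ln \<tau>" using \<tau> e1 by (intro ln_gt_zero) auto
    have "ln \<tau> \<le> C * \<epsilon> powr (- g) * iter_ln k (iter_e k + \<tau>) powr a"
      using \<tau> e1 by (intro log[OF e sol]) auto
    also have "\<dots> \<le> C * \<epsilon> powr (- g) * (C' * ln \<tau> powr d)"
      unfolding d_def using C by (intro mult_left_mono C' \<tau>) auto
    finally have "ln \<tau> \<le> (C * C' * \<epsilon> powr (- g)) * ln \<tau> powr d" by (simp add: mult_ac)
    moreover have "ln \<tau> = ln \<tau> powr (1 - d) * ln \<tau> powr d" using l by (simp add: powr_add[symmetric])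
    ultimately have "ln \<tau> powr (1 - d) * ln \<tau> powr d \<le> (C * C' * \<epsilon> powr (- g)) * ln \<tau> powr d" by simp
    then have "ln \<tau> powr (1 - d) \<le> C * C' * \<epsilon> powr (- g)" using l by (simp add: mult_le_cancel_right)
    then have "(ln \<tau> powr (1 - d)) powr (1 / (1 - d)) \<le> (C * C' * \<epsilon> powr (- g)) powr (1 / (1 - d))"
      using d by (intro powr_mono2) auto
    then show ?thesis using d l by (simp add: powr_powr)
  qed
  have finite: "T < \<infinity>" if e: "0 < \<epsilon>" and sol: "weak_solution ?f (damping \<mu> k) \<epsilon> u0 u1 R T u" for \<epsilon> T u
  proof (rule ccontr)
    assume "\<not> T < \<infinity>"
    then have T: "T = \<infinity>" by simp
    let ?B = "(C * C' * \<epsilon> powr (- g)) powr (1 / (1 - d))"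
    define \<tau> where "\<tau> = max (iter_e k) (exp (?B + 1))"
    have "ln \<tau> \<le> ?B" by (rule powr_log[OF e sol]) (simp_all add: \<tau>_def[symmetric] T, simp add: \<tau>_def)
    moreover have "?B + 1 \<le> ln \<tau>"
    proof -
      have "ln (exp (?B + 1)) \<le> ln \<tau>" by (subst ln_le_cancel_iff) (auto simp: \<tau>_def less_max_iff_disj)
      then show ?thesis by simp
    qed
    ultimately show False by simp
  qed
  \<comment> \<open>The second summand serves times 1 < s < e for k = 1, which
    \<open>powr_log\<close> does not reach: there \<epsilon> \<le> \<open>\<epsilon>1\<close>, so
    this summand times \<epsilon>^(-g/(1-d)) is at least 1.\<close>
  define C2 where "C2 = (C * C') powr (1 / (1 - d)) + \<epsilon>1 powr (g / (1 - d))"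
  show ?thesis
  proof (intro exI[of _ "C + C2"] conjI allI impI)
    show "0 < C + C2" using C C' by (auto simp: C2_def intro!: add_pos_pos)
  next
    fix \<epsilon> :: real and T u
    assume e: "0 < \<epsilon>" and "weak_solution_with_lifespan ?f (damping \<mu> k) \<epsilon> u0 u1 R T u"
    then have sol: "weak_solution ?f (damping \<mu> k) \<epsilon> u0 u1 R T u"
      by (simp add: weak_solution_with_lifespan_def)
    show "T < \<infinity>" by (rule finite[OF e sol])
  next
    fix \<epsilon> :: real and T u
    assume e: "0 < \<epsilon>" and "weak_solution_with_lifespan ?f (damping \<mu> k) \<epsilon> u0 u1 R T u"
    then have sol: "weak_solution ?f (damping \<mu> k) \<epsilon> u0 u1 R T u"
      by (simp add: weak_solution_with_lifespan_def)
    have T0: "0 < T" using sol by (simp add: weak_solution_def)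
    with finite[OF e sol] obtain t where t: "T = ereal t" "0 < t" by (cases T) auto
    let ?F = "\<lambda>s. ln s * iter_ln k (iter_e k + s) powr (- a)"
    have "?F t \<le> C * \<epsilon> powr (- g)"
    proof (cases "t \<le> 1")
      case True
      then have "ln t \<le> 0" using t by simp
      then have "?F t \<le> 0" by (rule mult_nonpos_nonneg) simp
      also have "0 \<le> C * \<epsilon> powr (- g)" using C by simp
      finally show ?thesis .
    next
      case False
      have le: "?F s \<le> C * \<epsilon> powr (- g)" if "1 < s" "s < t" for s
      proof -
        have i: "0 < iter_ln k (iter_e k + s)" using that by (intro iter_ln_pos) auto
        have "ln s * iter_ln k (iter_e k + s) powr (- a) \<le>
          C * \<epsilon> powr (- g) * iter_ln k (iter_e k + s) powr a * iter_ln k (iter_e k + s) powr (- a)"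
          using that t by (intro mult_right_mono log[OF e sol]) auto
        also have "\<dots> = C * \<epsilon> powr (- g)" using i by (simp add: powr_minus)
        finally show ?thesis .
      qed
      have it: "0 < iter_ln k (iter_e k + t)" using t by (intro iter_ln_pos) auto
      have "isCont (\<lambda>s. iter_ln k (iter_e k + s)) t"
        by (rule continuous_on_interior[OF iter_ln_continuous_on[OF order_refl]]) (use t in simp)
      then have "isCont ?F t" using t it by (intro continuous_intros) auto
      \<comment> \<open>For k \<ge> 2 the left side need not be monotone in time, so the bound is
        carried to the endpoint by continuity.\<close>
      then have "(?F \<longlongrightarrow> ?F t) (at_left t)" by (simp add: isCont_def filterlim_at_split)
      then show ?thesis
      proof (rule tendsto_upperbound)
        show "\<forall>\<^sub>F s in at_left t. ?F s \<le> C * \<epsilon> powr (- g)"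
          using eventually_at_left_real[of 1 t] False by (auto elim!: eventually_mono intro!: le)
      qed simp
    qed
    also have "\<dots> \<le> (C + C2) * \<epsilon> powr (- g)" by (intro mult_right_mono) (auto simp: C2_def)
    finally show "ln (real_of_ereal T) * iter_ln k (iter_e k + real_of_ereal T) powr (- (\<mu> * p * (p - 1)))
           \<le> (C + C2) * \<epsilon> powr (- (p * (p - 1)))"
      by (simp add: t a_def g_def)
  next
    fix \<epsilon> :: real and T u
    assume e: "0 < \<epsilon>" and "weak_solution_with_lifespan ?f (damping \<mu> k) \<epsilon> u0 u1 R T u"
      and k1: "k = 1 \<and> \<mu> < mu0_star CARD('n)"
    then have sol: "weak_solution ?f (damping \<mu> k) \<epsilon> u0 u1 R T u"
      by (simp add: weak_solution_with_lifespan_def)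
    have T0: "0 < T" using sol by (simp add: weak_solution_def)
    with finite[OF e sol] obtain t where t: "T = ereal t" "0 < t" by (cases T) auto
    have da: "d = a" using k1 by (simp add: d_def)
    let ?B = "C2 * \<epsilon> powr (- (g / (1 - d)))"
    have B: "0 \<le> ?B" by (simp add: C2_def)
    have le: "ln s \<le> ?B" if s: "1 < s" "s < t" for s
    proof (cases "iter_e k \<le> s")
      case True
      have "ln s \<le> (C * C' * \<epsilon> powr (- g)) powr (1 / (1 - d))"
        using True s t by (intro powr_log[OF e sol]) auto
      also have "\<dots> = (C * C') powr (1 / (1 - d)) * \<epsilon> powr (- (g / (1 - d)))"
        by (simp add: powr_mult powr_powr)
      also have "\<dots> \<le> ?B" by (intro mult_right_mono) (auto simp: C2_def)
      finally show ?thesis .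
    next
      case False
      then have "ln s < ln (exp 1)" using s k1 by (subst ln_less_cancel_iff) (auto simp: iter_e_def)
      then have "ln s \<le> 1" by simp
      also have "1 \<le> \<epsilon>1 powr (g / (1 - d)) * \<epsilon> powr (- (g / (1 - d)))"
      proof -
        have "\<epsilon> \<le> \<epsilon>1" using s t by (intro small[OF e sol]) (auto simp: one_ereal_def)
        then have "\<epsilon> powr (g / (1 - d)) \<le> \<epsilon>1 powr (g / (1 - d))"
          using e g d by (intro powr_mono2) auto
        then show ?thesis using e by (simp add: powr_minus field_simps)
      qed
      also have "\<dots> \<le> ?B" by (intro mult_right_mono) (auto simp: C2_def)
      finally show ?thesis .
    qed
    have "ln t \<le> ?B"
    proof (rule ccontr)
      assume "\<not> ln t \<le> ?B"
      then have "exp ?B < t" using t by (metis exp_less_mono exp_ln not_le)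
      then obtain s where s: "exp ?B < s" "s < t" using dense by blast
      \<comment> \<open>Nonnegativity of \<open>?B\<close> places the time s above 1, where the
        bound \<open>le\<close> may be applied to it.\<close>
      have "1 \<le> exp ?B" using B by simp
      then have "1 < s" using s by linarith
      then have "ln s \<le> ?B" using le s by blast
      moreover have "?B < ln s" using s \<open>1 < s\<close> by (metis exp_less_cancel_iff exp_ln less_trans zero_less_one)
      ultimately show False by simp
    qed
    also have "\<dots> \<le> (C + C2) * \<epsilon> powr (- (g / (1 - d)))"
      using C by (intro mult_right_mono) auto
    finally show "ln (real_of_ereal T) \<le> (C + C2) * \<epsilon> powr (- (p * (p - 1) / (1 - \<mu> * p * (p - 1))))"
      by (simp add: t da a_def g_def)
  qed
qed

end
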